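(* Let $\Gamma$ be a decay function on $\mathbb{Z}^m$, $r\ge1$ an integer, $U\subset\ell^\infty(\mathbb{R}^n)$ an open set with $0\in U$, and $F\in C^r_\Gamma(U,\ell^\infty(\mathbb{R}^n))$ with $F(0)=0$. Assume that $A=DF(0)\in L_\Gamma(\ell^\infty(\mathbb{R}^n),\ell^\infty(\mathbb{R}^n))$ is invertible. Let $$J=\{2\le j\le r:\ (\operatorname{Spec}_\Gamma(A))^j\cap\operatorname{Spec}_\Gamma(A)\neq\emptyset\}.$$ Then there exist polynomial maps $K,H:\ell^\infty(\mathbb{R}^n)\to\ell^\infty(\mathbb{R}^n)$ with decay, of degree at most $r$, such that $K(0)=0$, $DK(0)=\operatorname{Id}$, $$F\circ K(x)-K\circ H(x)=o(\|x\|^r)\quad (x\to0),$$ and $H(x)=Ax+\sum_{j\in J}H_jx^{\otimes j}$ with $H_j\in L^j_\Gamma(\ell^\infty(\mathbb{R}^n),\ell^\infty(\mathbb{R}^n))$.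
   Context: Fix integers $n,m\ge1$ and a norm $\|\cdot\|$ on $\mathbb{R}^n$. $\ell^\infty(\mathbb{R}^n)$ is the Banach space of bounded families $x=(x_i)_{i\in\mathbb{Z}^m}$, $x_i\in\mathbb{R}^n$, with norm $\|x\|=\|x\|_\infty=\sup_i\|x_i\|$; $\ell^\infty(\mathbb{C}^n)$ is defined analogously and is the complexification of $\ell^\infty(\mathbb{R}^n)$. Decay function: $\Gamma:\mathbb{Z}^m\to\mathbb{R}^+=(0,\infty)$ with $\sum_{k}\Gamma(k)\le1$ and $\sum_k\Gamma(i-k)\Gamma(k-j)\le\Gamma(i-j)$ for all $i,j\in\mathbb{Z}^m$. Linear maps with decay: for a bounded linear map $A$ of $\ell^\infty(\mathbb{R}^n)$ (or $\ell^\infty(\mathbb{C}^n)$) let $\|A\|$ be the operator norm, $\gamma(A)=\sup_{i,k\in\mathbb{Z}^m}\sup\{\|(Au)_i\|\,\Gamma(i-k)^{-1}: \|u\|_\infty\le1,\ u_j=0 \text{ for } j\ne k\}$ and $\|A\|_\Gamma=\max\{\|A\|,\gamma(A)\}$; $L_\Gamma$ is the set of $A$ with $\|A\|_\Gamma<\infty$. Multilinear maps with decay: $L^k_\Gamma$ is the space of bounded $k$-linear maps $A:\ell^\infty(\mathbb{R}^n)^k\to\ell^\infty(\mathbb{R}^n)$ with $\|A\|_\Gamma=\max\{\|A\|,\gamma(A)\}<\infty$, where $\gamma(A)=\max_{1\le p\le k}\sup_{i,l\in\mathbb{Z}^m}\sup\|A(v_1,\ldots,v_{p-1},w,v_p,\ldots,v_{k-1})_i\|\,\Gamma(i-l)^{-1}$,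 the inner supremum being over $w$ with $\|w\|_\infty\le1$, $w_j=0$ for $j\neq l$, and $v_q$ with $\|v_q\|_\infty\le1$. For $V\subset\ell^\infty(\mathbb{R}^n)$ open and an integer $r\ge1$, $C^r_\Gamma(V,\ell^\infty(\mathbb{R}^n))$ is the space of maps $F\in C^r(V,\ell^\infty(\mathbb{R}^n))$ (Fréchet sense) with $\sup_{x\in V}\|F(x)\|_\infty<\infty$, $D^jF(x)\in L^j_\Gamma$ for all $x\in V$ and $\sup_{x\in V}\|D^jF(x)\|_\Gamma<\infty$ for $1\le j\le r$. A polynomial map with decay of degree at most $d$ vanishing at $0$ is a map $P(x)=\sum_{j=1}^{d}P_jx^{\otimes j}$ with $P_j\in L^j_\Gamma$, where $P_jx^{\otimes j}=P_j(x,\ldots,x)$. $\Gamma$-spectrum: for $A\in L_\Gamma$, extended complex-linearly to $\ell^\infty(\mathbb{C}^n)$, $\operatorname{Spec}_\Gamma(A)$ is the complement in $\mathbb{C}$ of the set of $\lambda$ such that $A-\lambda\operatorname{Id}$ is invertible and $(A-\lambda\operatorname{Id})^{-1}\in L_\Gamma$. For $X\subset\mathbb{C}$, $X^j=\{x_1x_2\cdots x_j: x_1,\ldots,x_j\in X\}$. *)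

theory Defs
  imports "HOL-Analysis.Analysis" "HOL-Library.Landau_Symbols"
begin

section \<open>Bounded families indexed by the lattice\<close>

text \<open>
  The lattice of rank \<open>m = CARD('m)\<close> is \<^typ>\<open>int ^ 'm\<close>. It is discrete, so every bounded family is
  a bounded continuous function, and the type below consists of all bounded families.
\<close>

type_synonym ('m, 'v) linf = "(int ^ 'm) \<Rightarrow>\<^sub>C 'v"

lemma open_lattice: "open (S :: (int ^ 'm) set)"
  unfolding open_vec_def
proof
  fix x assume "x \<in> S"
  then show "\<exists>A. (\<forall>i. open (A i) \<and> x $ i \<in> A i) \<and> (\<forall>y. (\<forall>i. y $ i \<in> A i) \<longrightarrow> y \<in> S)"
    by (intro exI[of _ "\<lambda>i. {x $ i}"]) (auto simp: open_discrete simp flip: vec_eq_iff)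
qed

lemma continuous_on_lattice: "continuous_on S (f :: int ^ 'm \<Rightarrow> 'v::topological_space)"
  unfolding continuous_on_open_invariant
  by (metis Int_commute inf_assoc inf_idem open_lattice)

lemma apply_Bcontfun_lattice:
  fixes f :: "int ^ 'm \<Rightarrow> 'v::metric_space"
  assumes "bounded (range f)"
  shows "apply_bcontfun (Bcontfun f) = f"
  using assms by (intro Bcontfun_inverse) (simp add: bcontfun_def continuous_on_lattice)

definition is_norm :: "('v::real_vector \<Rightarrow> real) \<Rightarrow> bool" where
  "is_norm N \<longleftrightarrow> (\<forall>x. N x = 0 \<longleftrightarrow> x = 0) \<and> (\<forall>c x. N (c *\<^sub>R x) = \<bar>c\<bar> * N x)
     \<and> (\<forall>x y. N (x + y) \<le> N x + N y)"

definition linf_norm :: "('v \<Rightarrow> real) \<Rightarrow> ('m::finite, 'v::real_normed_vector) linf \<Rightarrow> real" where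
  "linf_norm N x = (SUP i. N (x i))"

text \<open>
  The type carries the library supremum norm built from the Euclidean norm. By lemma \<open>linf_norm_equiv\<close>
  \<^const>\<open>linf_norm\<close> is equivalent to it for every norm \<open>N\<close>, so the library notions that depend
  only on the topology (\<^const>\<open>open\<close>, \<^const>\<open>at\<close>, \<^const>\<open>bounded_linear\<close>,
  \<^const>\<open>has_derivative\<close>) are those of the space normed by \<^const>\<open>linf_norm\<close>. All quantities
  are measured with \<open>N\<close>.
\<close>

lemma is_norm_nonneg:
  assumes "is_norm N"
  shows "0 \<le> N x"
proof -
  have "N (x + (-1) *\<^sub>R x) \<le> N x + N ((-1) *\<^sub>R x)"
    using assms unfolding is_norm_def by blast
  moreover have "N ((-1) *\<^sub>R x) = N x" "N (x + (-1) *\<^sub>R x) = 0"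
    using assms unfolding is_norm_def by (metis abs_minus_cancel abs_one mult_1, simp)
  ultimately show ?thesis by simp
qed

lemma is_norm_equiv:
  fixes N :: "'v::euclidean_space \<Rightarrow> real"
  assumes "is_norm N"
  obtains c C where "0 < c" "0 < C" "\<And>x. c * norm x \<le> N x" "\<And>x. N x \<le> C * norm x"
proof -
  have N0: "\<And>x. N x = 0 \<longleftrightarrow> x = 0" and Ns: "\<And>c x. N (c *\<^sub>R x) = \<bar>c\<bar> * N x"
    and Nt: "\<And>x y. N (x + y) \<le> N x + N y"
    using assms unfolding is_norm_def by auto
  note Nn = is_norm_nonneg[OF assms]
  have Nsum: "N (sum f B) \<le> (\<Sum>b\<in>B. N (f b))" if "finite B" for f :: "'v \<Rightarrow> 'v" and B
    using that
  proof (induction B rule: finite_induct)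
    case empty
    show ?case using N0[of 0] by simp
  next
    case (insert b B)
    then show ?case using Nt[of "f b" "sum f B"] by simp
  qed
  define C where "C = 1 + (\<Sum>b\<in>Basis. N (b::'v))"
  have "C > 0"
    using Nn unfolding C_def by (simp add: add_pos_nonneg sum_nonneg)
  have upper: "N x \<le> C * norm x" for x
  proof -
    have "N x = N (\<Sum>b\<in>Basis. (x \<bullet> b) *\<^sub>R b)"
      by (simp add: euclidean_representation)
    also have "\<dots> \<le> (\<Sum>b\<in>Basis. N ((x \<bullet> b) *\<^sub>R b))"
      by (rule Nsum) simp
    also have "\<dots> \<le> (\<Sum>b\<in>Basis. norm x * N b)"
      by (intro sum_mono) (simp add: Ns Nn mult_right_mono Basis_le_norm)
    also have "\<dots> \<le> C * norm x"
      by (simp add: C_def algebra_simps sum_distrib_left)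
    finally show ?thesis .
  qed
  have Nd: "\<bar>N x - N y\<bar> \<le> C * norm (x - y)" for x y
  proof -
    have "N x \<le> N y + N (x - y)" "N y \<le> N x + N (y - x)"
      using Nt[of y "x - y"] Nt[of x "y - x"] by simp_all
    then show ?thesis
      using upper[of "x - y"] upper[of "y - x"] by (simp add: norm_minus_commute abs_le_iff)
  qed
  have "continuous_on (sphere 0 1) N"
  proof (rule lipschitz_on_continuous_on)
    show "C-lipschitz_on (sphere 0 1) N"
      using Nd \<open>C > 0\<close> by (intro lipschitz_onI) (auto simp: dist_norm)
  qed
  moreover have "compact (sphere (0::'v) 1)" "sphere (0::'v) 1 \<noteq> {}"
    by auto
  ultimately obtain y where y: "y \<in> sphere 0 1" "\<And>x. x \<in> sphere 0 1 \<Longrightarrow> N y \<le> N x"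
    by (meson continuous_attains_inf)
  have "N y > 0"
    using y(1) N0[of y] Nn[of y] by (auto simp: less_le)
  moreover have "N y * norm x \<le> N x" for x
  proof (cases "x = 0")
    case False
    then have "N y \<le> N ((1 / norm x) *\<^sub>R x)"
      by (intro y(2)) simp
    then show ?thesis
      using False by (simp add: Ns field_simps)
  qed (simp add: Nn)
  ultimately show ?thesis
    using that \<open>C > 0\<close> upper by blast
qed

lemma linf_norm_equiv:
  fixes N :: "'v::euclidean_space \<Rightarrow> real"
  assumes "is_norm N"
  obtains c C where "0 < c" "0 < C"
    "\<And>x :: ('m::finite, 'v) linf. c * norm x \<le> linf_norm N x"
    "\<And>x :: ('m, 'v) linf. linf_norm N x \<le> C * norm x"
proof -
  obtain c C where cC: "0 < c" "0 < C" "\<And>x. c * norm x \<le> N x" "\<And>x. N x \<le> C * norm x"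
    using is_norm_equiv[OF assms] by metis
  have up: "N (x i) \<le> C * norm x" for x :: "('m, 'v) linf" and i
    using cC(4)[of "x i"] norm_bounded[of x i] \<open>0 < C\<close>
    by (meson mult_left_mono less_imp_le order_trans)
  then have bdd: "bdd_above (range (\<lambda>i. N (x i)))" for x :: "('m, 'v) linf"
    by (intro bdd_aboveI2)
  have "linf_norm N x \<le> C * norm x" for x :: "('m, 'v) linf"
    unfolding linf_norm_def by (rule cSUP_least) (auto simp: up)
  moreover have "c * norm x \<le> linf_norm N x" for x :: "('m, 'v) linf"
  proof -
    have "norm (x i) \<le> linf_norm N x / c" for i
    proof -
      have "c * norm (x i) \<le> linf_norm N x"
        unfolding linf_norm_def by (rule cSUP_upper2[OF bdd, of i]) (auto simp: cC(3))
      then show ?thesis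
        using \<open>0 < c\<close> by (simp add: field_simps)
    qed
    then have "norm x \<le> linf_norm N x / c"
      by (rule norm_bound)
    then show ?thesis
      using \<open>0 < c\<close> by (simp add: field_simps)
  qed
  ultimately show ?thesis
    using that cC(1,2) by blast
qed

section \<open>Linear maps with decay\<close>

definition decay_function :: "(int ^ 'm::finite \<Rightarrow> real) \<Rightarrow> bool" where
  "decay_function \<Gamma> \<longleftrightarrow> (\<forall>k. 0 < \<Gamma> k) \<and> \<Gamma> summable_on UNIV \<and> (\<Sum>\<^sub>\<infinity>k. \<Gamma> k) \<le> 1
     \<and> (\<forall>i j. (\<lambda>k. \<Gamma> (i - k) * \<Gamma> (k - j)) summable_on UNIV
          \<and> (\<Sum>\<^sub>\<infinity>k. \<Gamma> (i - k) * \<Gamma> (k - j)) \<le> \<Gamma> (i - j))"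

definition supported_at :: "int ^ 'm::finite \<Rightarrow> ('m, 'v::real_normed_vector) linf \<Rightarrow> bool" where
  "supported_at k u \<longleftrightarrow> (\<forall>j. j \<noteq> k \<longrightarrow> u j = 0)"

text \<open>Suprema are taken in \<^typ>\<open>ereal\<close>, so that being finite is a genuine condition.\<close>

definition lin_norm ::
  "('v \<Rightarrow> real) \<Rightarrow> (('m::finite, 'v::real_normed_vector) linf \<Rightarrow> ('m, 'v) linf) \<Rightarrow> ereal" where
  "lin_norm N A = (SUP u\<in>{u. linf_norm N u \<le> 1}. ereal (linf_norm N (A u)))"

definition lin_gamma ::
  "('v \<Rightarrow> real) \<Rightarrow> (int ^ 'm::finite \<Rightarrow> real) \<Rightarrow>
   (('m, 'v::real_normed_vector) linf \<Rightarrow> ('m, 'v) linf) \<Rightarrow> ereal" where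
  "lin_gamma N \<Gamma> A =
     (SUP i. SUP k. SUP u\<in>{u. linf_norm N u \<le> 1 \<and> supported_at k u}.
        ereal (N (A u i) * inverse (\<Gamma> (i - k))))"

definition lin_decay_norm ::
  "('v \<Rightarrow> real) \<Rightarrow> (int ^ 'm::finite \<Rightarrow> real) \<Rightarrow>
   (('m, 'v::real_normed_vector) linf \<Rightarrow> ('m, 'v) linf) \<Rightarrow> ereal" where
  "lin_decay_norm N \<Gamma> A = max (lin_norm N A) (lin_gamma N \<Gamma> A)"

definition L_decay ::
  "(real ^ 'n \<Rightarrow> real) \<Rightarrow> (int ^ 'm::finite \<Rightarrow> real) \<Rightarrow>
   (('m, real ^ 'n) linf \<Rightarrow> ('m, real ^ 'n) linf) set" where
  "L_decay N \<Gamma> = {A. linear A \<and> lin_decay_norm N \<Gamma> A < \<infinity>}"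

section \<open>Complexification and spectrum\<close>

text \<open>
  The norm on \<open>\<complex>\<^sup>n\<close> is the Taylor complexification of \<open>N\<close>, which extends \<open>N\<close>. As all norms on
  \<open>\<complex>\<^sup>n\<close> are equivalent, another choice gives the same maps with decay and the same spectrum.
\<close>

definition complex_norm :: "(real ^ 'n \<Rightarrow> real) \<Rightarrow> complex ^ 'n \<Rightarrow> real" where
  "complex_norm N z = (SUP t::real. N (\<chi> k. Re (cis t * z $ k)))"

definition cscale :: "complex \<Rightarrow> ('m::finite, complex ^ 'n) linf \<Rightarrow> ('m, complex ^ 'n) linf" where
  "cscale c z = Bcontfun (\<lambda>i. c *s z i)"

definition re_linf :: "('m::finite, complex ^ 'n) linf \<Rightarrow> ('m, real ^ 'n) linf" where
  "re_linf z = Bcontfun (\<lambda>i. \<chi> k. Re (z i $ k))"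

definition im_linf :: "('m::finite, complex ^ 'n) linf \<Rightarrow> ('m, real ^ 'n) linf" where
  "im_linf z = Bcontfun (\<lambda>i. \<chi> k. Im (z i $ k))"

definition complex_linf ::
  "('m::finite, real ^ 'n) linf \<Rightarrow> ('m, real ^ 'n) linf \<Rightarrow> ('m, complex ^ 'n) linf" where
  "complex_linf x y = Bcontfun (\<lambda>i. \<chi> k. Complex (x i $ k) (y i $ k))"

lemma bounded_vecI:
  fixes f :: "'a \<Rightarrow> 'b::real_normed_vector ^ 'n"
  assumes "\<And>i k. norm (f i $ k) \<le> B"
  shows "bounded (range f)"
proof -
  have "norm (f i) \<le> (\<Sum>k\<in>(UNIV::'n set). B)" for i
    unfolding norm_vec_def
    by (rule order_trans[OF L2_set_le_sum]) (simp_all only: norm_ge_zero sum_mono assms)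
  then show ?thesis
    by (auto simp: bounded_iff)
qed

lemma norm_linf_component:
  fixes x :: "('m::finite, 'b::real_normed_vector ^ 'n) linf"
  shows "norm (x i $ k) \<le> norm x"
  by (rule order_trans[OF Finite_Cartesian_Product.norm_nth_le norm_bounded])

lemma apply_cscale: "cscale c z i = c *s z i"
  unfolding cscale_def
  by (subst apply_Bcontfun_lattice, rule bounded_vecI[where B = "norm c * norm z"])
     (auto simp: norm_mult intro!: mult_left_mono norm_linf_component)

lemma apply_re_linf: "re_linf z i = (\<chi> k. Re (z i $ k))"
  unfolding re_linf_def
  by (subst apply_Bcontfun_lattice, rule bounded_vecI[where B = "norm z"])
     (auto intro: order_trans[OF abs_Re_le_cmod norm_linf_component])

lemma apply_im_linf: "im_linf z i = (\<chi> k. Im (z i $ k))"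
  unfolding im_linf_def
  by (subst apply_Bcontfun_lattice, rule bounded_vecI[where B = "norm z"])
     (auto intro: order_trans[OF abs_Im_le_cmod norm_linf_component])

lemma apply_complex_linf: "complex_linf x y i = (\<chi> k. Complex (x i $ k) (y i $ k))"
proof -
  have "norm (Complex (x i $ k) (y i $ k)) \<le> norm x + norm y" for i k
    using cmod_le[of "Complex (x i $ k) (y i $ k)"] norm_linf_component[of x i k]
      norm_linf_component[of y i k] by simp
  then show ?thesis
    unfolding complex_linf_def
    by (subst apply_Bcontfun_lattice, intro bounded_vecI[where B = "norm x + norm y"]) auto
qed

definition complexify ::
  "(('m::finite, real ^ 'n) linf \<Rightarrow> ('m, real ^ 'n) linf) \<Rightarrow>
   ('m, complex ^ 'n) linf \<Rightarrow> ('m, complex ^ 'n) linf" where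
  "complexify A z = complex_linf (A (re_linf z)) (A (im_linf z))"

definition clinear :: "(('m::finite, complex ^ 'n) linf \<Rightarrow> ('m, complex ^ 'n) linf) \<Rightarrow> bool" where
  "clinear B \<longleftrightarrow> (\<forall>z w. B (z + w) = B z + B w) \<and> (\<forall>c z. B (cscale c z) = cscale c (B z))"

definition CL_decay ::
  "(real ^ 'n \<Rightarrow> real) \<Rightarrow> (int ^ 'm::finite \<Rightarrow> real) \<Rightarrow>
   (('m, complex ^ 'n) linf \<Rightarrow> ('m, complex ^ 'n) linf) set" where
  "CL_decay N \<Gamma> = {B. clinear B \<and> lin_decay_norm (complex_norm N) \<Gamma> B < \<infinity>}"

definition Spec_decay ::
  "(real ^ 'n \<Rightarrow> real) \<Rightarrow> (int ^ 'm::finite \<Rightarrow> real) \<Rightarrow>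
   (('m, real ^ 'n) linf \<Rightarrow> ('m, real ^ 'n) linf) \<Rightarrow> complex set" where
  "Spec_decay N \<Gamma> A = - {c. let T = (\<lambda>z. complexify A z - cscale c z) in
     \<exists>B\<in>CL_decay N \<Gamma>. B \<circ> T = id \<and> T \<circ> B = id}"

definition set_power :: "complex set \<Rightarrow> nat \<Rightarrow> complex set" where
  "set_power X j = {\<Prod>i<j. x i | x. \<forall>i<j. x i \<in> X}"

section \<open>Multilinear maps with decay\<close>

text \<open>
  A \<open>k\<close>-linear map is a function on lists, of which only the values on lists of length \<open>k\<close> matter.
\<close>

definition multilinear :: "nat \<Rightarrow> ('a::real_vector list \<Rightarrow> 'b::real_vector) \<Rightarrow> bool" where
  "multilinear k A \<longleftrightarrow> (\<forall>vs i. length vs = k \<longrightarrow> i < k \<longrightarrow> linear (\<lambda>v. A (vs[i := v])))"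

definition mlin_norm ::
  "('v \<Rightarrow> real) \<Rightarrow> nat \<Rightarrow>
   (('m::finite, 'v::real_normed_vector) linf list \<Rightarrow> ('m, 'v) linf) \<Rightarrow> ereal" where
  "mlin_norm N k A =
     (SUP vs\<in>{vs. length vs = k \<and> (\<forall>v\<in>set vs. linf_norm N v \<le> 1)}. ereal (linf_norm N (A vs)))"

definition mlin_gamma ::
  "('v \<Rightarrow> real) \<Rightarrow> (int ^ 'm::finite \<Rightarrow> real) \<Rightarrow> nat \<Rightarrow>
   (('m, 'v::real_normed_vector) linf list \<Rightarrow> ('m, 'v) linf) \<Rightarrow> ereal" where
  "mlin_gamma N \<Gamma> k A =
     (SUP p\<in>{..<k}. SUP i. SUP l.
        SUP (vs, w)\<in>{(vs, w). length vs = k - 1 \<and> (\<forall>v\<in>set vs. linf_norm N v \<le> 1)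
                        \<and> linf_norm N w \<le> 1 \<and> supported_at l w}.
          ereal (N (A (take p vs @ w # drop p vs) i) * inverse (\<Gamma> (i - l))))"

definition mlin_decay_norm ::
  "('v \<Rightarrow> real) \<Rightarrow> (int ^ 'm::finite \<Rightarrow> real) \<Rightarrow> nat \<Rightarrow>
   (('m, 'v::real_normed_vector) linf list \<Rightarrow> ('m, 'v) linf) \<Rightarrow> ereal" where
  "mlin_decay_norm N \<Gamma> k A = max (mlin_norm N k A) (mlin_gamma N \<Gamma> k A)"

definition Lk_decay ::
  "(real ^ 'n \<Rightarrow> real) \<Rightarrow> (int ^ 'm::finite \<Rightarrow> real) \<Rightarrow> nat \<Rightarrow>
   (('m, real ^ 'n) linf list \<Rightarrow> ('m, real ^ 'n) linf) set" where
  "Lk_decay N \<Gamma> k = {A. multilinear k A \<and> mlin_decay_norm N \<Gamma> k A < \<infinity>}"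

definition decay_polynomial ::
  "(real ^ 'n \<Rightarrow> real) \<Rightarrow> (int ^ 'm::finite \<Rightarrow> real) \<Rightarrow> nat \<Rightarrow>
   (('m, real ^ 'n) linf \<Rightarrow> ('m, real ^ 'n) linf) \<Rightarrow> bool" where
  "decay_polynomial N \<Gamma> d P \<longleftrightarrow>
     (\<exists>p. (\<forall>j\<in>{1..d}. p j \<in> Lk_decay N \<Gamma> j) \<and> (\<forall>x. P x = (\<Sum>j=1..d. p j (replicate j x))))"

section \<open>Differentiable maps with decay\<close>

text \<open>
  \<open>D j x\<close> is the \<open>j\<close>-th Frechet derivative of \<open>F\<close> at \<open>x\<close>, a bounded \<open>j\<close>-linear map: \<open>D (j + 1)\<close> is
  the derivative of the map \<open>D j\<close> into the bounded \<open>j\<close>-linear maps with their operator norm, where the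
  direction of differentiation is the first argument. On an open set \<open>V\<close> the family \<open>D\<close> is unique
  there (on lists of the right length).
\<close>

definition is_Cr_with_derivs ::
  "(real ^ 'n \<Rightarrow> real) \<Rightarrow> nat \<Rightarrow> ('m::finite, real ^ 'n) linf set \<Rightarrow>
   (('m, real ^ 'n) linf \<Rightarrow> ('m, real ^ 'n) linf) \<Rightarrow>
   (nat \<Rightarrow> ('m, real ^ 'n) linf \<Rightarrow> ('m, real ^ 'n) linf list \<Rightarrow> ('m, real ^ 'n) linf) \<Rightarrow> bool" where
  "is_Cr_with_derivs N r V F D \<longleftrightarrow>
     (\<forall>x\<in>V. D 0 x [] = F x) \<and>
     (\<forall>j\<le>r. \<forall>x\<in>V. multilinear j (D j x) \<and> mlin_norm N j (D j x) < \<infinity>) \<and>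
     (\<forall>j<r. \<forall>x\<in>V. \<forall>e>0. \<forall>\<^sub>F h in at 0.
        mlin_norm N j (\<lambda>vs. D j (x + h) vs - D j x vs - D (Suc j) x (h # vs))
          \<le> ereal (e * linf_norm N h)) \<and>
     (\<forall>j\<le>r. \<forall>x\<in>V. \<forall>e>0. \<forall>\<^sub>F y in at x within V.
        mlin_norm N j (\<lambda>vs. D j y vs - D j x vs) \<le> ereal e)"

definition Cr_decay ::
  "(real ^ 'n \<Rightarrow> real) \<Rightarrow> (int ^ 'm::finite \<Rightarrow> real) \<Rightarrow> nat \<Rightarrow> ('m, real ^ 'n) linf set \<Rightarrow>
   (('m, real ^ 'n) linf \<Rightarrow> ('m, real ^ 'n) linf) set" where
  "Cr_decay N \<Gamma> r V = {F. \<exists>D. is_Cr_with_derivs N r V F D \<and>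
     (SUP x\<in>V. ereal (linf_norm N (F x))) < \<infinity> \<and>
     (\<forall>j\<in>{1..r}. (\<forall>x\<in>V. D j x \<in> Lk_decay N \<Gamma> j) \<and>
        (SUP x\<in>V. mlin_decay_norm N \<Gamma> j (D j x)) < \<infinity>)}"

end

theory Submission
  imports Defs "HOL-Library.Function_Algebras"
begin

text \<open>
  The terms of \<open>K\<close> and \<open>H\<close> are found degree by degree. If \<open>F \<circ> K - K \<circ> H = o(|x|\<^sup>d)\<close> with polynomials
  \<open>K\<close>, \<open>H\<close>, then this difference is \<open>q(x, \<dots>, x) + o(|x|\<^sup>d\<^sup>+\<^sup>1)\<close> with \<open>q\<close> multilinear of degree \<open>d + 1\<close>, and
  new terms \<open>k\<close>, \<open>h\<close> of degree \<open>d + 1\<close> remove \<open>q\<close> if \<open>A \<circ> k - k \<circ> (A, \<dots>, A) - h = - q\<close>. In the resonant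
  case one takes \<open>k = 0\<close>, \<open>h = q\<close>. Otherwise one takes \<open>h = 0\<close> and has to solve a linear equation for \<open>k\<close>.

  On the complex Banach space of multilinear maps with decay its left-hand side is
  \<open>L - R\<^sub>1 \<cdots> R\<^sub>j\<close>, where \<open>L\<close> is composition with \<open>A\<close> and \<open>R\<^sub>i\<close> is composition with \<open>A\<close> in the \<open>i\<close>-th
  argument. These operators commute, and their resolvents exist off the \<open>\<Gamma>\<close>-spectrum of \<open>A\<close>. If
  \<open>t = L - R\<^sub>1 \<cdots> R\<^sub>j\<close> had no inverse in the bicommutant, it would generate a proper ideal there. By the
  Gelfand-Mazur argument a proper ideal stays proper when a suitable \<open>a - \<lambda>\<close> is adjoined. Doing this
  for \<open>a = L, R\<^sub>1, \<dots>, R\<^sub>j\<close> gives spectral values with \<open>\<lambda>\<^sub>0 = \<lambda>\<^sub>1 \<cdots> \<lambda>\<^sub>j\<close>, a resonance.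
\<close>

section \<open>Commutative normed algebras\<close>

text \<open>The ideal generated by \<open>t\<close> is enlarged by the finitely many elements in
  question only. A scalar relation modulo an ideal persists in every larger one, so all of
  \<open>L, R\<^sub>1, \<dots>, R\<^sub>j\<close> become scalars modulo one proper ideal, and no
  maximal ideal is formed. The factors \<open>R\<^sub>i\<close> are kept apart because each may
  receive its own spectral value; this is why the nonresonance condition concerns products of
  arbitrary members of the spectrum and not powers.

  That a quotient has nonempty spectrum is proved without analytic functions. Iterated squaring
  averages a resolvent over roots of unity, which takes the place of Cauchy's estimate, and the
  resolvent identity gives the uniform continuity by which the radius is pushed outward.

  The bicommutant is commutative, and it contains the inverse of each of its elements that is
  invertible among the bounded operators. Hence resolvents written down concretely from those of
  \<open>A\<close> belong to it automatically.\<close>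

locale comm_algebra =
  fixes A :: "'a::ab_group_add set"
    and mult :: "'a \<Rightarrow> 'a \<Rightarrow> 'a" (infixl "\<star>" 70)
    and e :: 'a
    and sc :: "complex \<Rightarrow> 'a \<Rightarrow> 'a" (infixr "\<odot>" 75)
  assumes e_mem [simp, intro]: "e \<in> A"
    and diff_mem [simp, intro]: "x \<in> A \<Longrightarrow> y \<in> A \<Longrightarrow> x - y \<in> A"
    and mult_mem [simp, intro]: "x \<in> A \<Longrightarrow> y \<in> A \<Longrightarrow> x \<star> y \<in> A"
    and sc_mem [simp, intro]: "x \<in> A \<Longrightarrow> c \<odot> x \<in> A"
    and mult_assoc: "x \<in> A \<Longrightarrow> y \<in> A \<Longrightarrow> z \<in> A \<Longrightarrow> (x \<star> y) \<star> z = x \<star> (y \<star> z)"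
    and mult_comm: "x \<in> A \<Longrightarrow> y \<in> A \<Longrightarrow> x \<star> y = y \<star> x"
    and e_mult [simp]: "x \<in> A \<Longrightarrow> e \<star> x = x"
    and mult_diff: "x \<in> A \<Longrightarrow> y \<in> A \<Longrightarrow> z \<in> A \<Longrightarrow> x \<star> (y - z) = x \<star> y - x \<star> z"
    and sc_mult: "x \<in> A \<Longrightarrow> y \<in> A \<Longrightarrow> (c \<odot> x) \<star> y = c \<odot> (x \<star> y)"
    and sc_diff: "x \<in> A \<Longrightarrow> y \<in> A \<Longrightarrow> c \<odot> (x - y) = c \<odot> x - c \<odot> y"
    and sc_diff_left: "x \<in> A \<Longrightarrow> (c - d) \<odot> x = c \<odot> x - d \<odot> x"
    and sc_sc: "x \<in> A \<Longrightarrow> c \<odot> d \<odot> x = (c * d) \<odot> x"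
    and sc_one [simp]: "x \<in> A \<Longrightarrow> 1 \<odot> x = x"
begin

lemma zero_mem [simp, intro]: "0 \<in> A"
  using diff_mem[OF e_mem e_mem] by simp

lemma uminus_mem [simp, intro]: "x \<in> A \<Longrightarrow> - x \<in> A"
  using diff_mem[of 0 x] by simp

lemma add_mem [simp, intro]: "x \<in> A \<Longrightarrow> y \<in> A \<Longrightarrow> x + y \<in> A"
  using diff_mem[of x "- y"] by simp

lemma sc_zero_left [simp]: "x \<in> A \<Longrightarrow> 0 \<odot> x = 0"
  using sc_diff_left[of x 0 0] by simp

lemma sc_zero [simp]: "c \<odot> 0 = 0"
  using sc_diff[of 0 0 c] by simp

lemma sc_minus: "x \<in> A \<Longrightarrow> c \<odot> (- x) = - (c \<odot> x)"
  using sc_diff[of 0 x c] by simp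

lemma sc_minus_left: "x \<in> A \<Longrightarrow> (- c) \<odot> x = - (c \<odot> x)"
  using sc_diff_left[of x 0 c] by simp

lemma sc_add: "x \<in> A \<Longrightarrow> y \<in> A \<Longrightarrow> c \<odot> (x + y) = c \<odot> x + c \<odot> y"
  using sc_diff[of x "- y" c] by (simp add: sc_minus)

lemma sc_add_left: "x \<in> A \<Longrightarrow> (c + d) \<odot> x = c \<odot> x + d \<odot> x"
  using sc_diff_left[of x c "- d"] by (simp add: sc_minus_left)

lemma mult_e [simp]: "x \<in> A \<Longrightarrow> x \<star> e = x"
  using mult_comm[of x e] by simp

lemma diff_mult: "x \<in> A \<Longrightarrow> y \<in> A \<Longrightarrow> z \<in> A \<Longrightarrow> (x - y) \<star> z = x \<star> z - y \<star> z"
  using mult_comm[of "x - y" z] mult_comm[of x z] mult_comm[of y z] by (simp add: mult_diff)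

lemma mult_sc: "x \<in> A \<Longrightarrow> y \<in> A \<Longrightarrow> x \<star> (c \<odot> y) = c \<odot> (x \<star> y)"
  using mult_comm[of x "c \<odot> y"] mult_comm[of x y] by (simp add: sc_mult)

lemma mult_zero [simp]: "x \<in> A \<Longrightarrow> x \<star> 0 = 0"
  using mult_diff[of x 0 0] by simp

lemma zero_mult [simp]: "x \<in> A \<Longrightarrow> 0 \<star> x = 0"
  using mult_comm[of 0 x] by simp

lemma mult_minus: "x \<in> A \<Longrightarrow> y \<in> A \<Longrightarrow> x \<star> (- y) = - (x \<star> y)"
  using mult_diff[of x 0 y] by simp

lemma minus_mult: "x \<in> A \<Longrightarrow> y \<in> A \<Longrightarrow> (- x) \<star> y = - (x \<star> y)"
  using diff_mult[of 0 x y] by simp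

lemma mult_add: "x \<in> A \<Longrightarrow> y \<in> A \<Longrightarrow> z \<in> A \<Longrightarrow> x \<star> (y + z) = x \<star> y + x \<star> z"
  using mult_diff[of x y "- z"] by (simp add: mult_minus)

lemma add_mult: "x \<in> A \<Longrightarrow> y \<in> A \<Longrightarrow> z \<in> A \<Longrightarrow> (x + y) \<star> z = x \<star> z + y \<star> z"
  using diff_mult[of x "- y" z] by (simp add: minus_mult)

lemma mult_left_comm: "x \<in> A \<Longrightarrow> y \<in> A \<Longrightarrow> z \<in> A \<Longrightarrow> x \<star> (y \<star> z) = y \<star> (x \<star> z)"
  by (metis mult_assoc mult_comm)

lemmas ring_simps = mult_diff diff_mult mult_add add_mult mult_minus minus_mult sc_mult mult_sc
  sc_diff sc_add sc_minus sc_sc mult_assoc mult_left_comm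

end

text \<open>With a seminorm in place of a norm, a quotient by an ideal is represented on the same
  carrier by changing \<open>q\<close>, and no quotient type is formed. The size of the unit is left
  free; by \<open>e_ge_1\<close> it is at least \<open>1\<close> unless it is zero.\<close>

locale seminormed_algebra = comm_algebra A mult e sc
  for A :: "'a::ab_group_add set"
    and mult :: "'a \<Rightarrow> 'a \<Rightarrow> 'a" (infixl "\<star>" 70)
    and e :: 'a
    and sc :: "complex \<Rightarrow> 'a \<Rightarrow> 'a" (infixr "\<odot>" 75) +
  fixes q :: "'a \<Rightarrow> real"
  assumes q_nonneg [simp]: "0 \<le> q x"
    and q_add: "x \<in> A \<Longrightarrow> y \<in> A \<Longrightarrow> q (x + y) \<le> q x + q y"
    and q_mult: "x \<in> A \<Longrightarrow> y \<in> A \<Longrightarrow> q (x \<star> y) \<le> q x * q y"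
    and q_sc: "x \<in> A \<Longrightarrow> q (c \<odot> x) \<le> cmod c * q x"
begin

lemma q_zero [simp]: "q 0 = 0"
  using q_sc[of 0 0] by (metis antisym mult_zero_left norm_zero q_nonneg sc_zero zero_mem)

lemma q_minus [simp]: "x \<in> A \<Longrightarrow> q (- x) = q x"
  using q_sc[of x "-1"] q_sc[of "- x" "-1"] by (simp add: sc_minus_left)

lemma q_diff: "x \<in> A \<Longrightarrow> y \<in> A \<Longrightarrow> q (x - y) \<le> q x + q y"
  using q_add[of x "- y"] by simp

lemma q_diff_commute: "x \<in> A \<Longrightarrow> y \<in> A \<Longrightarrow> q (x - y) = q (y - x)"
  by (metis minus_diff_eq diff_mem q_minus)

lemma q_cong: "x \<in> A \<Longrightarrow> y \<in> A \<Longrightarrow> q (x - y) = 0 \<Longrightarrow> q x = q y"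
  using q_add[of "x - y" y] q_add[of "y - x" x] q_diff_commute[of x y] by simp

text \<open>Equality in the Hausdorff quotient of \<open>A\<close> by the null space of
  \<open>q\<close>. Membership in \<open>A\<close> is built in, so that chains of congruences carry
  it along.\<close>

definition eqv (infix "\<simeq>" 50) where "x \<simeq> y \<longleftrightarrow> x \<in> A \<and> y \<in> A \<and> q (x - y) = 0"

lemma eqv_refl [simp]: "x \<in> A \<Longrightarrow> x \<simeq> x"
  by (simp add: eqv_def)

lemma eqv_add: "x \<simeq> y \<Longrightarrow> x' \<simeq> y' \<Longrightarrow> x + x' \<simeq> y + y'"
  using q_add[of "x - y" "x' - y'"] by (auto simp: eqv_def algebra_simps intro: antisym)

lemma eqv_diff: "x \<simeq> y \<Longrightarrow> x' \<simeq> y' \<Longrightarrow> x - x' \<simeq> y - y'"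
  using q_diff[of "x - y" "x' - y'"] by (auto simp: eqv_def algebra_simps intro: antisym)

lemma eqv_mult: "z \<in> A \<Longrightarrow> x \<simeq> y \<Longrightarrow> z \<star> x \<simeq> z \<star> y"
  using q_mult[of z "x - y"] by (auto simp: eqv_def mult_diff intro: antisym)

lemma eqv_sc: "x \<simeq> y \<Longrightarrow> c \<odot> x \<simeq> c \<odot> y"
  using q_sc[of "x - y" c] by (auto simp: eqv_def sc_diff intro: antisym)

lemma eqv_q: "x \<simeq> y \<Longrightarrow> q x = q y"
  by (auto simp: eqv_def intro: q_cong)

text \<open>
  \<open>resolves a z u\<close> says that \<open>u\<close> inverts \<open>e - z a\<close> modulo the null space of \<open>q\<close>. Half the sum of the inverses
  at \<open>z\<close> and \<open>- z\<close> resolves \<open>a\<^sup>2\<close> at \<open>z\<^sup>2\<close>. By iteration, estimates for the resolvent of \<open>a\<close> on a circle of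
  radius \<open>r\<close> carry over to the powers \<open>sqpow a m\<close>, which have exponent \<open>2 ^ m\<close>, on the circle of radius \<open>r ^ 2 ^ m\<close>.
\<close>

definition resolves :: "'a \<Rightarrow> complex \<Rightarrow> 'a \<Rightarrow> bool" where
  "resolves a z u \<longleftrightarrow> a \<in> A \<and> u \<in> A \<and> u - z \<odot> (a \<star> u) \<simeq> e"

lemma resolves_mem: "resolves a z u \<Longrightarrow> a \<in> A" "resolves a z u \<Longrightarrow> u \<in> A"
  by (auto simp: resolves_def)

text \<open>The resolvent identity. The relation that defines either inverse is multiplied by the
  other inverse, and the product \<open>u \<star> v\<close> cancels in the difference.\<close>

lemma resolves_diff:
  assumes "resolves a z u" "resolves a w v"
  shows "u - v \<simeq> (z - w) \<odot> (a \<star> (u \<star> v))"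
proof -
  note [simp] = resolves_mem[OF assms(1)] resolves_mem[OF assms(2)]
  have "u - w \<odot> (a \<star> (u \<star> v)) = u \<star> (v - w \<odot> (a \<star> v)) + u - u \<star> v"
    by (simp add: ring_simps)
  also have "\<dots> \<simeq> u \<star> e + u - u \<star> v"
    using assms by (intro eqv_add eqv_diff eqv_mult) (auto simp: resolves_def)
  finally have 1: "u - w \<odot> (a \<star> (u \<star> v)) \<simeq> u + u - u \<star> v" by simp
  have "v - z \<odot> (a \<star> (u \<star> v)) = v \<star> (u - z \<odot> (a \<star> u)) + v - u \<star> v"
    by (simp add: ring_simps mult_comm[of v u])
  also have "\<dots> \<simeq> v \<star> e + v - u \<star> v"
    using assms by (intro eqv_add eqv_diff eqv_mult) (auto simp: resolves_def)
  finally have 2: "v - z \<odot> (a \<star> (u \<star> v)) \<simeq> v + v - u \<star> v" by simp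
  have "(u - v) + (u - v) - ((u - w \<odot> (a \<star> (u \<star> v))) - (v - z \<odot> (a \<star> (u \<star> v))))
      \<simeq> (u - v) + (u - v) - ((u + u - u \<star> v) - (v + v - u \<star> v))"
    by (intro eqv_diff 1 2 eqv_refl) auto
  then have "(u - v) - (z - w) \<odot> (a \<star> (u \<star> v)) \<simeq> 0"
    by (simp add: algebra_simps sc_diff_left)
  then show ?thesis
    by (auto simp: eqv_def)
qed

lemma resolves_unique: "resolves a z u \<Longrightarrow> resolves a z v \<Longrightarrow> u \<simeq> v"
  using resolves_diff[of a z u z v] resolves_mem[of a z u] resolves_mem[of a z v]
  by (auto simp: eqv_def)

text \<open>\<open>e - z\<^sup>2 a\<^sup>2\<close> factors as \<open>(e + z a)(e - z a)\<close>.
  Applied to \<open>u\<close> it leaves \<open>e + z a\<close>, applied to \<open>v\<close> it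
  leaves \<open>e - z a\<close>, and these add up to \<open>2 e\<close>.\<close>

lemma resolves_square:
  assumes "resolves a z u" "resolves a (- z) v"
  shows "resolves (a \<star> a) (z\<^sup>2) ((1/2) \<odot> (u + v))"
proof -
  note [simp] = resolves_mem[OF assms(1)] resolves_mem[OF assms(2)]
  have u: "u - z \<odot> (a \<star> u) \<simeq> e" and v: "v + z \<odot> (a \<star> v) \<simeq> e"
    using assms by (auto simp: resolves_def sc_minus_left)
  have "u - z\<^sup>2 \<odot> (a \<star> (a \<star> u)) = (u - z \<odot> (a \<star> u)) + z \<odot> (a \<star> (u - z \<odot> (a \<star> u)))"
    by (simp add: ring_simps power2_eq_square)
  also have "\<dots> \<simeq> e + z \<odot> (a \<star> e)"
    by (intro eqv_add u eqv_sc eqv_mult) auto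
  finally have 1: "u - z\<^sup>2 \<odot> (a \<star> (a \<star> u)) \<simeq> e + z \<odot> a" by simp
  have "v - z\<^sup>2 \<odot> (a \<star> (a \<star> v)) = (v + z \<odot> (a \<star> v)) - z \<odot> (a \<star> (v + z \<odot> (a \<star> v)))"
    by (simp add: ring_simps power2_eq_square)
  also have "\<dots> \<simeq> e - z \<odot> (a \<star> e)"
    by (intro eqv_diff v eqv_sc eqv_mult) auto
  finally have 2: "v - z\<^sup>2 \<odot> (a \<star> (a \<star> v)) \<simeq> e - z \<odot> a" by simp
  have "(1/2) \<odot> (u + v) - z\<^sup>2 \<odot> ((a \<star> a) \<star> ((1/2) \<odot> (u + v)))
     = (1/2) \<odot> ((u - z\<^sup>2 \<odot> (a \<star> (a \<star> u))) + (v - z\<^sup>2 \<odot> (a \<star> (a \<star> v))))"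
    by (simp add: ring_simps algebra_simps)
  also have "\<dots> \<simeq> (1/2) \<odot> ((e + z \<odot> a) + (e - z \<odot> a))"
    by (intro eqv_sc eqv_add 1 2)
  also have "(1/2) \<odot> ((e + z \<odot> a) + (e - z \<odot> a)) = (1/2 + 1/2) \<odot> e"
    by (simp only: sc_add_left e_mem) (simp add: sc_add)
  finally show ?thesis
    by (auto simp: resolves_def)
qed

text \<open>Modulo the null space \<open>u - e = z a (u - e) + z a\<close>, and the term with
  \<open>u - e\<close> is absorbed on the left because \<open>d < 1\<close>.\<close>

lemma resolves_near_e:
  assumes "resolves a z u" "q (z \<odot> a) \<le> d" "d < 1"
  shows "q (u - e) \<le> d * q e / (1 - d)"
proof -
  note [simp] = resolves_mem[OF assms(1)]
  have "u - e \<simeq> (z \<odot> a) \<star> u"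
    using assms(1) by (auto simp: resolves_def eqv_def ring_simps algebra_simps)
  then have "q (u - e) = q ((z \<odot> a) \<star> (u - e) + (z \<odot> a) \<star> e)"
    using eqv_q[of "u - e" "(z \<odot> a) \<star> u"] by (simp only: mult_add[symmetric] diff_mem e_mem sc_mem resolves_mem[OF assms(1)]) simp
  also have "\<dots> \<le> q (z \<odot> a) * q (u - e) + q (z \<odot> a) * q e"
    by (rule order_trans[OF q_add]) (auto intro!: add_mono q_mult simp del: mult_e)
  also have "\<dots> \<le> d * q (u - e) + d * q e"
    using assms by (intro add_mono mult_right_mono) auto
  finally show ?thesis
    using assms by (simp add: field_simps)
qed

text \<open>The way back from inverses to elements: \<open>z a = (u - e) - z a (u - e)\<close>
  modulo the null space, and the last term is absorbed. In this way knowledge about resolvents of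
  powers becomes a bound on the powers themselves.\<close>

lemma near_e_resolves:
  assumes "resolves a z u" "q (u - e) \<le> 1/2"
  shows "q (z \<odot> a) \<le> 1"
proof -
  note [simp] = resolves_mem[OF assms(1)]
  have "z \<odot> a = (z \<odot> a) \<star> u - (z \<odot> a) \<star> (u - e)"
    by (simp add: ring_simps)
  moreover have "(z \<odot> a) \<star> u \<simeq> u - e"
    using assms(1) by (auto simp: resolves_def eqv_def ring_simps algebra_simps q_diff_commute)
  ultimately have "z \<odot> a \<simeq> (u - e) - (z \<odot> a) \<star> (u - e)"
    by (metis (no_types) diff_mem e_mem eqv_diff eqv_refl mult_mem resolves_mem assms(1) sc_mem)
  then have "q (z \<odot> a) \<le> q (u - e) + q ((z \<odot> a) \<star> (u - e))"
    by (subst eqv_q[of "z \<odot> a"]) (auto intro!: q_diff)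
  also have "\<dots> \<le> 1/2 + q (z \<odot> a) * (1/2)"
    using assms by (intro add_mono order_trans[OF q_mult] mult_left_mono) auto
  finally show ?thesis by simp
qed

section \<open>Resolvents of iterated squares\<close>

primrec sqpow :: "'a \<Rightarrow> nat \<Rightarrow> 'a" where
  "sqpow a 0 = a"
| "sqpow a (Suc m) = sqpow a m \<star> sqpow a m"

lemma sqpow_mem [simp]: "a \<in> A \<Longrightarrow> sqpow a m \<in> A"
  by (induction m) auto

lemma resolves_sqpow_exists:
  assumes "\<And>z. \<exists>u. resolves a z u"
  shows "\<exists>u. resolves (sqpow a m) z u"
proof (induction m arbitrary: z)
  case (Suc m)
  obtain u v where "resolves (sqpow a m) (csqrt z) u" "resolves (sqpow a m) (- csqrt z) v"
    using Suc by metis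
  from resolves_square[OF this] show ?case by auto
qed (simp add: assms)

text \<open>Passing to the next square replaces a point of the circle by its two square roots, so
  the induction hypothesis has to cover the whole circle. Averaging two differences bounded by
  \<open>\<delta>\<close> gives \<open>\<delta>\<close> again: the estimate does not deteriorate
  with \<open>m\<close>, although the radii \<open>r ^ 2 ^ m\<close> and \<open>s ^ 2 ^ m\<close>
  may drift apart.\<close>

lemma resolves_sqpow_close:
  fixes r s :: real
  assumes ex: "\<And>z. \<exists>u. resolves a z u"
    and base: "\<And>\<omega> u v. cmod \<omega> = 1 \<Longrightarrow> resolves a (of_real r * \<omega>) u \<Longrightarrow>
      resolves a (of_real s * \<omega>) v \<Longrightarrow> q (u - v) \<le> \<delta>"
  shows "cmod \<omega> = 1 \<Longrightarrow> resolves (sqpow a m) (of_real (r ^ 2 ^ m) * \<omega>) u \<Longrightarrow>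
      resolves (sqpow a m) (of_real (s ^ 2 ^ m) * \<omega>) v \<Longrightarrow> q (u - v) \<le> \<delta>"
proof (induction m arbitrary: \<omega> u v)
  case (Suc m)
  define \<eta> where "\<eta> = csqrt \<omega>"
  have \<eta>: "\<eta>\<^sup>2 = \<omega>" "cmod \<eta> = 1" "cmod (- \<eta>) = 1"
    using Suc.prems(1) by (auto simp: \<eta>_def)
  obtain u1 u2 v1 v2 where
    u1: "resolves (sqpow a m) (of_real (r ^ 2 ^ m) * \<eta>) u1" and
    u2: "resolves (sqpow a m) (of_real (r ^ 2 ^ m) * - \<eta>) u2" and
    v1: "resolves (sqpow a m) (of_real (s ^ 2 ^ m) * \<eta>) v1" and
    v2: "resolves (sqpow a m) (of_real (s ^ 2 ^ m) * - \<eta>) v2"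
    using resolves_sqpow_exists[OF ex] by metis
  note [simp] = u1[THEN resolves_mem(2)] u2[THEN resolves_mem(2)]
    v1[THEN resolves_mem(2)] v2[THEN resolves_mem(2)]
  have sq: "(of_real (t ^ 2 ^ m) * \<eta>)\<^sup>2 = complex_of_real (t ^ 2 ^ Suc m) * \<omega>" for t
    by (simp add: power_mult_distrib \<eta> power_mult [symmetric] mult.commute flip: of_real_power)
  have "u \<simeq> (1/2) \<odot> (u1 + u2)"
    using resolves_square[OF u1, of u2] u2 Suc.prems(2) unfolding sq
    by (intro resolves_unique) (auto simp: sq)
  moreover have "v \<simeq> (1/2) \<odot> (v1 + v2)"
    using resolves_square[OF v1, of v2] v2 Suc.prems(3) unfolding sq
    by (intro resolves_unique) (auto simp: sq)
  ultimately have "q (u - v) = q ((1/2) \<odot> ((u1 - v1) + (u2 - v2)))"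
    using eqv_q[OF eqv_diff[of u "(1/2) \<odot> (u1 + u2)" v "(1/2) \<odot> (v1 + v2)"]]
    by (simp add: sc_add sc_diff algebra_simps)
  also have "\<dots> \<le> cmod (1/2) * (q (u1 - v1) + q (u2 - v2))"
    by (intro order_trans[OF q_sc] mult_left_mono q_add) auto
  also have "\<dots> \<le> cmod (1/2) * (\<delta> + \<delta>)"
    using Suc.IH[OF \<eta>(2) u1 v1] Suc.IH[OF \<eta>(3) u2 v2] by (intro mult_left_mono add_mono) auto
  finally show ?case by simp
qed (use base in auto)

text \<open>The same averaging over square roots, now for the size of a single inverse.\<close>

lemma resolves_sqpow_bound:
  fixes r :: real
  assumes ex: "\<And>z. \<exists>u. resolves a z u"
    and base: "\<And>\<omega> u. cmod \<omega> = 1 \<Longrightarrow> resolves a (of_real r * \<omega>) u \<Longrightarrow> q u \<le> \<delta>"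
  shows "cmod \<omega> = 1 \<Longrightarrow> resolves (sqpow a m) (of_real (r ^ 2 ^ m) * \<omega>) u \<Longrightarrow> q u \<le> \<delta>"
proof (induction m arbitrary: \<omega> u)
  case (Suc m)
  define \<eta> where "\<eta> = csqrt \<omega>"
  have \<eta>: "\<eta>\<^sup>2 = \<omega>" "cmod \<eta> = 1" "cmod (- \<eta>) = 1"
    using Suc.prems(1) by (auto simp: \<eta>_def)
  obtain u1 u2 where
    u1: "resolves (sqpow a m) (of_real (r ^ 2 ^ m) * \<eta>) u1" and
    u2: "resolves (sqpow a m) (of_real (r ^ 2 ^ m) * - \<eta>) u2"
    using resolves_sqpow_exists[OF ex] by metis
  note [simp] = u1[THEN resolves_mem(2)] u2[THEN resolves_mem(2)]
  have sq: "(of_real (t ^ 2 ^ m) * \<eta>)\<^sup>2 = complex_of_real (t ^ 2 ^ Suc m) * \<omega>" for t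
    by (simp add: power_mult_distrib \<eta> power_mult [symmetric] mult.commute flip: of_real_power)
  have "u \<simeq> (1/2) \<odot> (u1 + u2)"
    using resolves_square[OF u1, of u2] u2 Suc.prems(2) unfolding sq
    by (intro resolves_unique) (auto simp: sq)
  then have "q u = q ((1/2) \<odot> (u1 + u2))"
    by (rule eqv_q)
  also have "\<dots> \<le> cmod (1/2) * (q u1 + q u2)"
    by (intro order_trans[OF q_sc] mult_left_mono q_add) auto
  also have "\<dots> \<le> cmod (1/2) * (\<delta> + \<delta>)"
    using Suc.IH[OF \<eta>(2) u1] Suc.IH[OF \<eta>(3) u2] by (intro mult_left_mono add_mono) auto
  finally show ?case by simp
qed (use base in auto)

section \<open>Continuity of the resolvent and nonempty spectrum\<close>

lemma resolves_q_diff_le: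
  assumes "resolves a z u" "resolves a w v"
  shows "q (u - v) \<le> cmod (z - w) * (q a * (q u * q v))"
proof -
  note [simp] = resolves_mem[OF assms(1)] resolves_mem[OF assms(2)]
  have "q (u - v) = q ((z - w) \<odot> (a \<star> (u \<star> v)))"
    using resolves_diff[OF assms] by (rule eqv_q)
  also have "\<dots> \<le> cmod (z - w) * (q a * (q u * q v))"
    by (intro order_trans[OF q_sc] mult_left_mono order_trans[OF q_mult] q_mult) auto
  finally show ?thesis .
qed

text \<open>The resolvent identity bounds an increment by a multiple of \<open>g z * g w\<close>,
  with the unknown \<open>g w\<close> on the right. It has to be controlled by \<open>g z\<close>
  before a Lipschitz estimate results.\<close>

lemma continuous_on_q_resolves:
  assumes "\<And>z. resolves a z (u z)"
  shows "continuous_on S (\<lambda>z. q (u z))"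
proof -
  have a [simp]: "a \<in> A" and u [simp]: "u z \<in> A" for z
    using resolves_mem[OF assms] by auto
  define g where "g z = q (u z)" for z
  have g0: "0 \<le> g z" for z by (simp add: g_def)
  have lip: "\<bar>g z - g w\<bar> \<le> cmod (z - w) * (q a * (g z * g w))" for z w
  proof -
    have "\<bar>g z - g w\<bar> \<le> q (u z - u w)"
      using q_add[of "u z - u w" "u w"] q_add[of "u w - u z" "u z"] q_diff_commute[of "u z" "u w"]
      by (simp add: g_def abs_le_iff)
    then show ?thesis
      using resolves_q_diff_le[OF assms assms, of z w] by (simp add: g_def)
  qed
  have "isCont g z" for z
    unfolding continuous_at_eps_delta
  proof (intro allI impI)
    fix \<epsilon> :: real assume "\<epsilon> > 0"
    \<comment> \<open>The first entry secures \<open>g w \<le> 2 * g z\<close>, the second turns the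
      resulting estimate into \<open>\<epsilon>\<close>; the added ones keep the denominators
      positive.\<close>
    define d where "d = min (1 / (2 * (q a * g z + 1))) (\<epsilon> / (2 * (q a * (g z * g z)) + 1))"
    have p: "0 \<le> q a * g z" "0 \<le> q a * (g z * g z)" by (simp_all add: g0)
    have "d > 0" using \<open>\<epsilon> > 0\<close> p by (auto simp: d_def add_nonneg_pos)
    moreover have "dist (g w) (g z) < \<epsilon>" if "dist w z < d" for w
    proof -
      have wz: "cmod (w - z) < d" using that by (simp add: dist_norm)
      have "cmod (w - z) * (q a * g z) \<le> d * (q a * g z + 1)"
        using wz p \<open>d > 0\<close> by (intro mult_mono) auto
      also have "\<dots> \<le> 1 / (2 * (q a * g z + 1)) * (q a * g z + 1)"
        using p by (intro mult_right_mono) (auto simp: d_def)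
      also have "\<dots> = 1/2" using p by simp
      finally have "g w * (cmod (w - z) * (q a * g z)) \<le> g w * (1/2)"
        using g0 by (intro mult_left_mono) auto
      then have "\<bar>g w - g z\<bar> \<le> g w * (1/2)"
        using lip[of w z] by (simp add: mult_ac)
      then have w2: "g w \<le> 2 * g z" by linarith
      have "\<bar>g w - g z\<bar> \<le> cmod (w - z) * (q a * ((2 * g z) * g z))"
        by (rule order_trans[OF lip]) (intro mult_left_mono mult_right_mono w2, auto simp: g0)
      also have "\<dots> \<le> cmod (w - z) * (2 * (q a * (g z * g z)) + 1)"
        by (intro mult_left_mono) (auto simp: algebra_simps)
      also have "\<dots> < d * (2 * (q a * (g z * g z)) + 1)"
        using wz p(2) by (intro mult_strict_right_mono) linarith+
      also have "\<dots> \<le> \<epsilon> / (2 * (q a * (g z * g z)) + 1) * (2 * (q a * (g z * g z)) + 1)"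
        using p by (intro mult_right_mono) (auto simp: d_def)
      also have "\<dots> = \<epsilon>"
      proof -
        have "2 * (q a * (g z * g z)) + 1 \<noteq> 0" using p(2) by linarith
        then show ?thesis by simp
      qed
      finally show ?thesis by (simp add: dist_real_def)
    qed
    ultimately show "\<exists>d>0. \<forall>x'. dist x' z < d \<longrightarrow> dist (g x') (g z) < \<epsilon>" by blast
  qed
  then have "continuous_on S g"
    by (simp add: continuous_at_imp_continuous_on)
  then show ?thesis by (simp add: g_def [abs_def])
qed

lemma e_ge_1: "0 < q e \<Longrightarrow> 1 \<le> q e"
  using q_mult[of e e] by simp

text \<open>A Liouville argument. The inverse of \<open>e - z a\<close> is \<open>e\<close> at
  \<open>z = 0\<close>, while the invertibility of \<open>a\<close> makes it small for large
  \<open>z\<close>. The powers \<open>(r a) ^ 2 ^ m\<close> tend to zero for every radius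
  \<open>r\<close> up to \<open>R\<close> that can be reached from \<open>0\<close> in steps of
  fixed length. At the radius \<open>R\<close> this puts the inverse for a power near
  \<open>e\<close>, whereas averaging keeps it below \<open>q e / 4\<close>.\<close>

lemma not_everywhere_resolved:
  assumes "0 < q e" and a [simp]: "a \<in> A" and ex: "\<And>z. \<exists>u. resolves a z u"
    and b: "b \<in> A" "a \<star> b \<simeq> e"
  shows False
proof -
  note [simp] = b(1)
  obtain u where u: "\<And>z. resolves a z (u z)"
    using ex by metis
  have [simp]: "u z \<in> A" for z
    using resolves_mem[OF u] by auto
  have e1: "1 \<le> q e" using e_ge_1 assms(1) .
  \<comment> \<open>The estimate below gives \<open>(R - q b) * q v \<le> q b * q e\<close>. With
    this \<open>R\<close> the factor on the left is \<open>4 * q b + 1\<close>, which produces the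
    quarter of \<open>q e\<close>.\<close>
  define R where "R = 5 * q b + 1"
  have "R > 0" by (simp add: R_def add_nonneg_pos)
  have far: "q v \<le> q e / 4" if v: "resolves a (of_real R * \<omega>) v" and \<omega>: "cmod \<omega> = 1" for v \<omega>
  proof -
    define z where "z = of_real R * \<omega>"
    have z: "cmod z = R" "z \<noteq> 0"
      using \<open>R > 0\<close> \<omega> by (auto simp: z_def norm_mult)
    have [simp]: "v \<in> A" using resolves_mem[OF v] by auto
    \<comment> \<open>An exact identity, arranged so that the resolvent relation and
      \<open>a \<star> b \<simeq> e\<close> can be substituted in its last two terms.\<close>
    have "z \<odot> v = b \<star> v - b \<star> (v - z \<odot> (a \<star> v)) + z \<odot> (v - v \<star> (a \<star> b))"
      by (simp add: ring_simps mult_comm[of a b] mult_comm[of v])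
    also have "\<dots> \<simeq> b \<star> v - b \<star> e + z \<odot> (v - v \<star> e)"
      using v by (intro eqv_add eqv_diff eqv_mult eqv_sc b(2) eqv_refl)
        (auto simp: resolves_def z_def)
    finally have "z \<odot> v \<simeq> b \<star> v - b" by simp
    then have "q (z \<odot> v) \<le> q b * q v + q b"
      by (subst eqv_q) (auto intro!: order_trans[OF q_diff] q_mult)
    also have "\<dots> \<le> q b * q v + q b * q e"
      using mult_left_mono[OF e1 q_nonneg[of b]] by simp
    finally have 1: "q (z \<odot> v) \<le> q b * q v + q b * q e" .
    have "q v = q ((1/z) \<odot> (z \<odot> v))" using z by (simp add: sc_sc)
    also have "\<dots> \<le> q (z \<odot> v) / R"
      by (rule order_trans[OF q_sc]) (auto simp: z norm_divide)
    finally have "R * q v \<le> q b * q v + q b * q e"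
      using 1 \<open>R > 0\<close> by (simp add: field_simps)
    then have "(4 * q b + 1) * q v \<le> q b * q e" by (simp add: R_def algebra_simps)
    also have "\<dots> \<le> (4 * q b + 1) * (q e / 4)"
      using e1 by (simp add: algebra_simps)
    finally show ?thesis
      by (rule mult_left_le_imp_le) (simp add: add_nonneg_pos)
  qed
  have "compact ((\<lambda>z. q (u z)) ` cball 0 (R + 1))"
    by (intro compact_continuous_image continuous_on_q_resolves[OF u]) auto
  then obtain B where B: "\<And>z. cmod z \<le> R + 1 \<Longrightarrow> q (u z) \<le> B"
    by (force dest!: compact_imp_bounded simp: bounded_iff)
  have "0 \<le> B" using order_trans[OF q_nonneg B[of 0]] \<open>R > 0\<close> by simp
  \<comment> \<open>The resolvent is Lipschitz on the disc with constant
    \<open>q a * (B * B)\<close>. The disc has radius \<open>R + 1\<close> because a step starts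
    within radius \<open>R\<close> and has length \<open>\<delta> \<le> 1\<close>.\<close>
  define \<delta> where "\<delta> = min 1 (1 / (4 * (q a * (B * B)) + 1))"
  have p: "0 \<le> q a * (B * B)" using \<open>0 \<le> B\<close> by simp
  then have \<delta>: "0 < \<delta>" "\<delta> \<le> 1" by (auto simp: \<delta>_def add_nonneg_pos)
  have close: "q (v - w) \<le> 1/4"
    if "resolves a z v" "resolves a z' w" "cmod z \<le> R + 1" "cmod z' \<le> R + 1" "cmod (z - z') \<le> \<delta>"
    for z z' v w
  proof -
    have "q v = q (u z)" "q w = q (u z')"
      using that u resolves_unique eqv_q by metis+
    then have vw: "q v \<le> B" "q w \<le> B" using B that by auto
    have "q (v - w) \<le> cmod (z - z') * (q a * (q v * q w))"
      using that by (intro resolves_q_diff_le)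
    also have "\<dots> \<le> \<delta> * (q a * (B * B))"
      using that vw \<open>0 \<le> B\<close> \<open>0 < \<delta>\<close> by (intro mult_mono) auto
    also have "\<dots> \<le> 1 / (4 * (q a * (B * B)) + 1) * (q a * (B * B))"
      using p by (intro mult_right_mono) (auto simp: \<delta>_def)
    also have "\<dots> \<le> 1/4" using p by (simp add: field_simps)
    finally show ?thesis .
  qed
  \<comment> \<open>\<open>P r\<close> holds if \<open>r\<close> is below the inverse spectral radius. As the resolvent is uniformly continuous on the
    disc, \<open>r\<close> can be increased by a fixed step, up to the radius \<open>R\<close> where the resolvent is too small.\<close>
  define P where "P r \<longleftrightarrow> (\<lambda>m. q (of_real (r ^ 2 ^ m) \<odot> sqpow a m)) \<longlonglongrightarrow> 0" for r :: real
  \<comment> \<open>Chosen so that the bound of \<open>resolves_near_e\<close> equals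
    \<open>1/4\<close>.\<close>
  define d where "d = 1 / (1 + 4 * q e)"
  have d: "0 < d" "d < 1" "d * q e / (1 - d) \<le> 1/4"
    using e1 by (auto simp: d_def field_simps)
  have near: "\<forall>\<^sub>F m in sequentially. \<forall>v. resolves (sqpow a m) (of_real (r ^ 2 ^ m)) v \<longrightarrow> q (v - e) \<le> 1/4"
    if "P r" for r
  proof -
    have "\<forall>\<^sub>F m in sequentially. q (of_real (r ^ 2 ^ m) \<odot> sqpow a m) < d"
      using that d(1) unfolding P_def by (rule order_tendstoD)
    then show ?thesis
      by eventually_elim
        (blast intro: order_trans[OF resolves_near_e[OF _ less_imp_le d(2)] d(3)])
  qed
  \<comment> \<open>At radius \<open>r\<close> the inverses for the powers are eventually within
    \<open>1/4\<close> of \<open>e\<close>, and those at \<open>r + \<delta>\<close> are within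
    \<open>1/4\<close> of them. By \<open>near_e_resolves\<close> the powers are bounded at
    \<open>r + \<delta>\<close>; retreating by \<open>\<delta> / 2\<close> turns boundedness into
    geometric decay.\<close>
  have step: "P s" if r: "P r" "0 \<le> r" "r \<le> R" and s: "0 \<le> s" "s \<le> r + \<delta> / 2" for r s
  proof -
    let ?r = "r + \<delta>"
    have base: "q (v - w) \<le> 1/4" if "cmod \<omega> = 1" "resolves a (of_real r * \<omega>) v"
        "resolves a (of_real ?r * \<omega>) w" for \<omega> v w
    proof (rule close[OF that(2,3)])
      have "of_real r * \<omega> - of_real ?r * \<omega> = of_real (- \<delta>) * \<omega>" by (simp add: algebra_simps)
      then show "cmod (of_real r * \<omega> - of_real ?r * \<omega>) \<le> \<delta>"
        using that \<delta> by (simp del: of_real_minus of_real_add add: norm_mult)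
      show "cmod (of_real r * \<omega>) \<le> R + 1" using that r by (simp add: norm_mult)
      show "cmod (of_real ?r * \<omega>) \<le> R + 1"
        using that r \<delta> by (simp only: norm_mult norm_of_real) simp
    qed
    have "\<forall>\<^sub>F m in sequentially. q (of_real (?r ^ 2 ^ m) \<odot> sqpow a m) \<le> 1"
      using near[OF \<open>P r\<close>]
    proof eventually_elim
      case (elim m)
      obtain v w where v: "resolves (sqpow a m) (of_real (r ^ 2 ^ m)) v"
        and w: "resolves (sqpow a m) (of_real (?r ^ 2 ^ m)) w"
        using resolves_sqpow_exists[OF ex] by metis
      have [simp]: "v \<in> A" "w \<in> A" using v w by (auto dest: resolves_mem)
      have vw: "q (v - w) \<le> 1/4"
      proof (rule resolves_sqpow_close[where a = a and r = r and s = ?r and \<omega> = 1 and m = m])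
        show "\<exists>u. resolves a z u" for z by (rule ex)
        show "q (x - y) \<le> 1/4" if "cmod \<eta> = 1" "resolves a (of_real r * \<eta>) x"
          "resolves a (of_real ?r * \<eta>) y" for \<eta> x y by (rule base[OF that])
        show "resolves (sqpow a m) (of_real (r ^ 2 ^ m) * 1) v"
          "resolves (sqpow a m) (of_real (?r ^ 2 ^ m) * 1) w"
          using v w by (simp_all only: mult_1_right)
      qed (rule norm_one)
      have "q (w - e) \<le> q (v - e) + q (v - w)"
        using q_add[of "v - e" "w - v"] q_diff_commute[of v w] by simp
      also have "\<dots> \<le> 1/4 + 1/4"
        using elim v vw by (intro add_mono) auto
      finally show ?case
        using near_e_resolves[OF w] by simp
    qed
    then have ev: "\<forall>\<^sub>F m in sequentially. q (of_real (s ^ 2 ^ m) \<odot> sqpow a m) \<le> (s / ?r) ^ m"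
    proof eventually_elim
      case (elim m)
      have "?r > 0" using r \<delta> by simp
      have sr: "0 \<le> s / ?r" "s / ?r \<le> 1" using s \<open>?r > 0\<close> \<delta> by (auto simp: field_simps)
      have "of_real (s ^ 2 ^ m) \<odot> sqpow a m
          = of_real ((s / ?r) ^ 2 ^ m) \<odot> (of_real (?r ^ 2 ^ m) \<odot> sqpow a m)"
      proof -
        have "s ^ 2 ^ m = (s / ?r) ^ 2 ^ m * ?r ^ 2 ^ m"
          using \<open>?r > 0\<close> by (simp add: power_divide)
        then show ?thesis
          by (simp only: sc_sc sqpow_mem a of_real_mult)
      qed
      then have "q (of_real (s ^ 2 ^ m) \<odot> sqpow a m)
          \<le> (s / ?r) ^ 2 ^ m * q (of_real (?r ^ 2 ^ m) \<odot> sqpow a m)"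
        using q_sc[of "of_real (?r ^ 2 ^ m) \<odot> sqpow a m" "of_real ((s / ?r) ^ 2 ^ m)"] sr
        by (simp only: norm_of_real abs_of_nonneg zero_le_power sc_mem sqpow_mem a)
      also have "\<dots> \<le> (s / ?r) ^ 2 ^ m * 1"
        using sr elim by (intro mult_left_mono) auto
      also have "\<dots> \<le> (s / ?r) ^ m"
        using power_decreasing[OF less_imp_le[OF less_exp] sr] by simp
      finally show ?case .
    qed
    have "(\<lambda>m. (s / ?r) ^ m) \<longlonglongrightarrow> 0"
      using r s \<delta> by (intro LIMSEQ_power_zero) (auto simp: abs_if field_simps)
    then show ?thesis
      unfolding P_def by (rule tendsto_sandwich[OF always_eventually ev tendsto_const, rotated]) auto
  qed
  have "P (min (real k * (\<delta> / 2)) R)" for k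
  proof (induction k)
    case 0
    show ?case using \<open>R > 0\<close> by (simp add: P_def zero_power)
  next
    case (Suc k)
    show ?case
      by (rule step[OF Suc]) (use \<delta> \<open>R > 0\<close> in \<open>auto simp: algebra_simps min_def\<close>)
  qed
  moreover obtain k where "R / (\<delta> / 2) < real k"
    using reals_Archimedean2 by blast
  ultimately have "P R"
    using \<delta> by (metis divide_pos_pos less_imp_le min.absorb2 pos_divide_less_eq zero_less_numeral)
  then obtain m where m: "\<And>v. resolves (sqpow a m) (of_real (R ^ 2 ^ m)) v \<Longrightarrow> q (v - e) \<le> 1/4"
    using near[of R] by (metis (mono_tags, lifting) eventually_happens' sequentially_bot)
  obtain v where v: "resolves (sqpow a m) (of_real (R ^ 2 ^ m)) v"
    using resolves_sqpow_exists[OF ex] by metis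
  have [simp]: "v \<in> A" using v by (auto dest: resolves_mem)
  \<comment> \<open>The contradiction at radius \<open>R\<close>: \<open>v\<close> is within
    \<open>1/4\<close> of \<open>e\<close>, but the bound \<open>far\<close> passes to the power by
    averaging, and \<open>1 \<le> q e\<close>.\<close>
  have "q v \<le> q e / 4"
  proof (rule resolves_sqpow_bound[where a = a and r = R and \<omega> = 1 and m = m])
    show "\<exists>u. resolves a z u" for z by (rule ex)
    show "q x \<le> q e / 4" if "cmod \<eta> = 1" "resolves a (of_real R * \<eta>) x" for \<eta> x
      by (rule far[OF that(2,1)])
    show "resolves (sqpow a m) (of_real (R ^ 2 ^ m) * 1) v"
      using v by (simp only: mult_1_right)
  qed (rule norm_one)
  moreover have "q e \<le> q v + q (v - e)"
    using q_diff[of v "v - e"] by simp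
  ultimately show False using m[OF v] e1 by simp
qed

text \<open>The substitution \<open>z = 1 / c\<close> turns inverses of \<open>a - c e\<close> into
  inverses of \<open>e - z a\<close>. The value \<open>c = 0\<close>, which corresponds to
  \<open>z\<close> at infinity, supplies the inverse \<open>b\<close> of \<open>a\<close>.\<close>

theorem spectrum_nonempty:
  assumes "0 < q e" and a [simp]: "a \<in> A"
  shows "\<exists>c. \<forall>b\<in>A. \<not> (a - c \<odot> e) \<star> b \<simeq> e"
proof (rule ccontr)
  assume "\<not> ?thesis"
  then have inv: "\<exists>b\<in>A. (a - c \<odot> e) \<star> b \<simeq> e" for c by blast
  have "\<exists>u. resolves a z u" for z
  proof (cases "z = 0")
    case True
    then show ?thesis by (auto simp: resolves_def intro!: exI[of _ e])
  next
    case False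
    obtain b where b: "b \<in> A" "(a - (1/z) \<odot> e) \<star> b \<simeq> e" using inv by blast
    have "(- 1 / z) \<odot> b - z \<odot> (a \<star> ((- 1 / z) \<odot> b)) = (a - (1/z) \<odot> e) \<star> b"
      using b(1) False sc_minus_left[of b "1/z"] sc_minus_left[of "a \<star> b" 1] by (simp add: ring_simps)
    then show ?thesis
      using b by (intro exI[of _ "(- 1 / z) \<odot> b"]) (auto simp: resolves_def)
  qed
  moreover obtain b where "b \<in> A" "(a - 0 \<odot> e) \<star> b \<simeq> e"
    using inv by blast
  ultimately show False
    using not_everywhere_resolved[OF assms, of b] by simp
qed

end


text \<open>The form in which completeness reaches the ideals: \<open>near_e_invertible\<close>
  keeps every proper ideal at distance at least \<open>1\<close> from the unit.\<close>

locale inverse_closed_algebra = seminormed_algebra A mult e sc nrm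
  for A :: "'a::ab_group_add set"
    and mult :: "'a \<Rightarrow> 'a \<Rightarrow> 'a" (infixl "\<star>" 70)
    and e :: 'a
    and sc :: "complex \<Rightarrow> 'a \<Rightarrow> 'a" (infixr "\<odot>" 75)
    and nrm :: "'a \<Rightarrow> real" +
  assumes near_e_invertible: "x \<in> A \<Longrightarrow> nrm (e - x) < 1 \<Longrightarrow> \<exists>y\<in>A. x \<star> y = e"
begin

section \<open>Proper ideals and quotient seminorms\<close>

definition proper_ideal :: "'a set \<Rightarrow> bool" where
  "proper_ideal I \<longleftrightarrow> I \<subseteq> A \<and> 0 \<in> I \<and> (\<forall>x\<in>I. \<forall>y\<in>I. x + y \<in> I) \<and>
     (\<forall>x\<in>I. \<forall>b\<in>A. x \<star> b \<in> I) \<and> e \<notin> I"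

lemma proper_idealD:
  assumes "proper_ideal I"
  shows "\<And>x. x \<in> I \<Longrightarrow> x \<in> A" "0 \<in> I" "\<And>x y. x \<in> I \<Longrightarrow> y \<in> I \<Longrightarrow> x + y \<in> I"
    "\<And>x b. x \<in> I \<Longrightarrow> b \<in> A \<Longrightarrow> x \<star> b \<in> I" "\<And>x b. x \<in> I \<Longrightarrow> b \<in> A \<Longrightarrow> b \<star> x \<in> I" "e \<notin> I"
    "\<And>x. x \<in> I \<Longrightarrow> - x \<in> I" "\<And>x c. x \<in> I \<Longrightarrow> c \<odot> x \<in> I"
    "\<And>x y. x \<in> I \<Longrightarrow> y \<in> I \<Longrightarrow> x - y \<in> I"
proof -
  show A: "x \<in> I \<Longrightarrow> x \<in> A" for x using assms by (auto simp: proper_ideal_def)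
  show "0 \<in> I" "e \<notin> I" using assms by (auto simp: proper_ideal_def)
  show add: "x \<in> I \<Longrightarrow> y \<in> I \<Longrightarrow> x + y \<in> I" for x y using assms by (auto simp: proper_ideal_def)
  show m: "x \<in> I \<Longrightarrow> b \<in> A \<Longrightarrow> x \<star> b \<in> I" for x b using assms by (auto simp: proper_ideal_def)
  show "x \<in> I \<Longrightarrow> b \<in> A \<Longrightarrow> b \<star> x \<in> I" for x b using m A by (metis mult_comm)
  show minus: "x \<in> I \<Longrightarrow> - x \<in> I" for x using m[of x "- e"] A by (simp add: mult_minus)
  show "x \<in> I \<Longrightarrow> c \<odot> x \<in> I" for x c using m[of x "c \<odot> e"] A by (simp add: mult_sc)
  show "x \<in> I \<Longrightarrow> y \<in> I \<Longrightarrow> x - y \<in> I" for x y using add[of x "- y"] minus by simp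
qed

definition quotient_norm :: "'a set \<Rightarrow> 'a \<Rightarrow> real" where
  "quotient_norm I x = (INF i\<in>I. nrm (x - i))"

lemma quotient_norm_le: "i \<in> I \<Longrightarrow> quotient_norm I x \<le> nrm (x - i)"
  unfolding quotient_norm_def by (rule cINF_lower) (auto intro: bdd_belowI2[of _ 0])

lemma quotient_norm_less:
  assumes "proper_ideal I" "quotient_norm I x < c"
  obtains i where "i \<in> I" "nrm (x - i) < c"
  using assms proper_idealD(2)[OF assms(1)] unfolding quotient_norm_def
  by (subst (asm) cINF_less_iff) (auto intro: bdd_belowI2[of _ 0])

lemma quotient_norm_nonneg:
  assumes "proper_ideal I"
  shows "0 \<le> quotient_norm I x"
  using proper_idealD(2)[OF assms] unfolding quotient_norm_def by (intro cINF_greatest) auto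

lemma quotient_norm_seminormed:
  assumes I: "proper_ideal I"
  shows "seminormed_algebra A mult e sc (quotient_norm I)"
proof
  note D = proper_idealD[OF I]
  show "0 \<le> quotient_norm I x" for x by (rule quotient_norm_nonneg[OF I])
  show "quotient_norm I (x + y) \<le> quotient_norm I x + quotient_norm I y" if [simp]: "x \<in> A" "y \<in> A" for x y
  proof (rule field_le_epsilon)
    fix \<epsilon> :: real assume "\<epsilon> > 0"
    obtain i where i: "i \<in> I" "nrm (x - i) < quotient_norm I x + \<epsilon> / 2"
      using \<open>\<epsilon> > 0\<close> by (auto intro: quotient_norm_less[OF I, of x "quotient_norm I x + \<epsilon> / 2"])
    obtain j where j: "j \<in> I" "nrm (y - j) < quotient_norm I y + \<epsilon> / 2"
      using \<open>\<epsilon> > 0\<close> by (auto intro: quotient_norm_less[OF I, of y "quotient_norm I y + \<epsilon> / 2"])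
    have "quotient_norm I (x + y) \<le> nrm ((x - i) + (y - j))"
      using quotient_norm_le[of "i + j" I "x + y"] D(3) i j by (simp add: algebra_simps)
    also have "\<dots> \<le> nrm (x - i) + nrm (y - j)"
      using i j D by (intro q_add) auto
    finally show "quotient_norm I (x + y) \<le> quotient_norm I x + quotient_norm I y + \<epsilon>"
      using i j by simp
  qed
  show "quotient_norm I (x \<star> y) \<le> quotient_norm I x * quotient_norm I y"
    if [simp]: "x \<in> A" "y \<in> A" for x y
  proof (rule field_le_epsilon)
    fix \<epsilon> :: real assume "\<epsilon> > 0"
    let ?a = "quotient_norm I x" and ?b = "quotient_norm I y"
    have ab: "0 \<le> ?a" "0 \<le> ?b" using quotient_norm_nonneg[OF I] by auto
    \<comment> \<open>As \<open>\<delta> \<le> 1\<close>, the excess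
      \<open>\<delta> * (?a + ?b + \<delta>)\<close> of the product over \<open>?a * ?b\<close> is
      at most \<open>\<epsilon>\<close>.\<close>
    define \<delta> where "\<delta> = min 1 (\<epsilon> / (?a + ?b + 1))"
    have "\<delta> > 0" "\<delta> \<le> 1" using \<open>\<epsilon> > 0\<close> ab by (auto simp: \<delta>_def)
    have "\<delta> * (?a + ?b + 1) \<le> \<epsilon> / (?a + ?b + 1) * (?a + ?b + 1)"
      using ab by (intro mult_right_mono) (auto simp: \<delta>_def)
    also have "\<dots> = \<epsilon>" using ab by simp
    finally have \<delta>: "\<delta> * (?a + ?b + 1) \<le> \<epsilon>" .
    obtain i where i: "i \<in> I" "nrm (x - i) < ?a + \<delta>"
      using \<open>\<delta> > 0\<close> by (auto intro: quotient_norm_less[OF I, of x "?a + \<delta>"])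
    obtain j where j: "j \<in> I" "nrm (y - j) < ?b + \<delta>"
      using \<open>\<delta> > 0\<close> by (auto intro: quotient_norm_less[OF I, of y "?b + \<delta>"])
    have [simp]: "i \<in> A" "j \<in> A" using i j D by auto
    \<comment> \<open>This is the difference of \<open>x \<star> y\<close> and
      \<open>(x - i) \<star> (y - j)\<close>.\<close>
    have "i \<star> y + x \<star> j - i \<star> j \<in> I"
      using i j by (intro D(3,9) D(4)[OF i(1)] D(5)[OF j(1)]) auto
    from quotient_norm_le[OF this, of "x \<star> y"]
    have "quotient_norm I (x \<star> y) \<le> nrm ((x - i) \<star> (y - j))"
      by (simp add: ring_simps algebra_simps)
    also have "\<dots> \<le> nrm (x - i) * nrm (y - j)"
      by (intro q_mult) auto
    also have "\<dots> \<le> (?a + \<delta>) * (?b + \<delta>)"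
      using i j ab \<open>\<delta> > 0\<close> by (intro mult_mono) auto
    also have "\<dots> = ?a * ?b + \<delta> * (?a + ?b + \<delta>)" by (simp add: algebra_simps)
    also have "\<dots> \<le> ?a * ?b + \<delta> * (?a + ?b + 1)"
      using \<open>\<delta> > 0\<close> \<open>\<delta> \<le> 1\<close> by (intro add_left_mono mult_left_mono) auto
    finally show "quotient_norm I (x \<star> y) \<le> ?a * ?b + \<epsilon>" using \<delta> by simp
  qed
  show "quotient_norm I (c \<odot> x) \<le> cmod c * quotient_norm I x" if [simp]: "x \<in> A" for x c
  proof (rule field_le_epsilon)
    fix \<epsilon> :: real assume "\<epsilon> > 0"
    define \<delta> where "\<delta> = \<epsilon> / (cmod c + 1)"
    have "\<delta> > 0" using \<open>\<epsilon> > 0\<close> by (auto simp: \<delta>_def add_nonneg_pos)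
    obtain i where i: "i \<in> I" "nrm (x - i) < quotient_norm I x + \<delta>"
      using \<open>\<delta> > 0\<close> by (auto intro: quotient_norm_less[OF I, of x "quotient_norm I x + \<delta>"])
    have "quotient_norm I (c \<odot> x) \<le> nrm (c \<odot> (x - i))"
      using quotient_norm_le[of "c \<odot> i" I "c \<odot> x"] D i by (simp add: sc_diff)
    also have "\<dots> \<le> cmod c * (quotient_norm I x + \<delta>)"
      using i D by (intro order_trans[OF q_sc] mult_left_mono) auto
    also have "\<dots> \<le> cmod c * quotient_norm I x + (cmod c + 1) * \<delta>"
      using \<open>\<delta> > 0\<close> by (simp add: algebra_simps)
    also have "(cmod c + 1) * \<delta> = \<epsilon>"
      using add_nonneg_pos[OF norm_ge_zero[of c] zero_less_one] by (simp add: \<delta>_def)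
    finally show "quotient_norm I (c \<odot> x) \<le> cmod c * quotient_norm I x + \<epsilon>" .
  qed
qed

text \<open>No element of \<open>I\<close> lies within distance less than \<open>1\<close> of
  \<open>e\<close>, so the unit keeps a positive quotient seminorm and some \<open>a - c e\<close>
  has no inverse modulo the null space. An equation \<open>e = i + (a - c e) b\<close> would provide
  such an inverse, hence the ideal generated by \<open>I\<close> and \<open>a - c e\<close> is again
  proper.\<close>

lemma proper_ideal_adjoin:
  assumes I: "proper_ideal I" and a [simp]: "a \<in> A"
  shows "\<exists>c I'. proper_ideal I' \<and> I \<subseteq> I' \<and> a - c \<odot> e \<in> I'"
proof -
  note D = proper_idealD[OF I]
  interpret Q: seminormed_algebra A mult e sc "quotient_norm I"
    by (rule quotient_norm_seminormed[OF I])
  have "0 < quotient_norm I e"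
  proof (rule ccontr)
    assume "\<not> ?thesis"
    then obtain i where i: "i \<in> I" "nrm (e - i) < 1"
      using quotient_norm_less[OF I, of e 1] by force
    with near_e_invertible[of i] obtain y where "y \<in> A" "i \<star> y = e" using D by auto
    then show False using D(4)[OF i(1), of y] D(6) by simp
  qed
  then obtain c where c: "\<And>b. b \<in> A \<Longrightarrow> \<not> Q.eqv ((a - c \<odot> e) \<star> b) e"
    using Q.spectrum_nonempty[OF _ a] by blast
  let ?t = "a - c \<odot> e"
  define I' where "I' = {i + ?t \<star> b | i b. i \<in> I \<and> b \<in> A}"
  have I'I: "i + ?t \<star> b \<in> I'" if "i \<in> I" "b \<in> A" for i b using that by (auto simp: I'_def)
  have "proper_ideal I'"
    unfolding proper_ideal_def
  proof (intro conjI ballI notI)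
    show "I' \<subseteq> A" using D by (auto simp: I'_def)
    show "0 \<in> I'" using I'I[of 0 0] D by simp
  next
    fix x y assume "x \<in> I'" "y \<in> I'"
    then obtain i b j d where *: "x = i + ?t \<star> b" "y = j + ?t \<star> d" "i \<in> I" "j \<in> I" "b \<in> A" "d \<in> A"
      by (auto simp: I'_def)
    then have "x + y = (i + j) + ?t \<star> (b + d)" by (simp add: mult_add algebra_simps)
    then show "x + y \<in> I'" using * D by (simp only:) (rule I'I, auto)
  next
    fix x d assume "x \<in> I'" and d [simp]: "d \<in> A"
    then obtain i b where *: "x = i + ?t \<star> b" "i \<in> I" "b \<in> A"
      by (auto simp: I'_def)
    then have "x \<star> d = i \<star> d + ?t \<star> (b \<star> d)" using D by (simp add: add_mult mult_assoc)
    then show "x \<star> d \<in> I'" using * D by (simp only:) (rule I'I, auto)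
  next
    assume "e \<in> I'"
    then obtain i b where *: "e = i + ?t \<star> b" "i \<in> I" "b \<in> A"
      by (auto simp: I'_def)
    then have "?t \<star> b - e = - i" by (metis add_diff_cancel minus_diff_eq)
    moreover have "quotient_norm I (- i) \<le> 0"
      using quotient_norm_le[of "- i" I "- i"] D * by simp
    ultimately have "Q.eqv (?t \<star> b) e"
      using * quotient_norm_nonneg[OF I, of "- i"] by (auto simp: Q.eqv_def)
    with c[OF *(3)] show False by blast
  qed
  moreover have "I \<subseteq> I'" using I'I[of _ 0] by auto
  moreover have "?t \<in> I'" using I'I[of 0 e] D by simp
  ultimately show ?thesis by blast
qed

text \<open>Relations obtained earlier persist because the ideals increase.\<close>

lemma proper_ideal_adjoin_many:
  fixes x :: "nat \<Rightarrow> 'a"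
  assumes I: "proper_ideal I" and "\<And>i. i < n \<Longrightarrow> x i \<in> A"
  shows "\<exists>c I'. proper_ideal I' \<and> I \<subseteq> I' \<and> (\<forall>i<n. x i - c i \<odot> e \<in> I')"
  using assms(2)
proof (induction n)
  case 0
  then show ?case using I by blast
next
  case (Suc n)
  then obtain c I' where 1: "proper_ideal I'" "I \<subseteq> I'" "\<forall>i<n. x i - c i \<odot> e \<in> I'"
    by (metis less_SucI)
  obtain d I'' where "proper_ideal I''" "I' \<subseteq> I''" "x n - d \<odot> e \<in> I''"
    using proper_ideal_adjoin[OF 1(1), of "x n"] Suc.prems by blast
  with 1 show ?case
    by (intro exI[of _ "c(n := d)"] exI[of _ I'']) (auto simp: less_Suc_eq)
qed

section \<open>Invertibility of a difference from the absence of resonances\<close>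

primrec prod_upto :: "(nat \<Rightarrow> 'a) \<Rightarrow> nat \<Rightarrow> 'a" where
  "prod_upto x 0 = e"
| "prod_upto x (Suc n) = prod_upto x n \<star> x n"

lemma prod_upto_mem [simp]: "(\<And>i. i < n \<Longrightarrow> x i \<in> A) \<Longrightarrow> prod_upto x n \<in> A"
  by (induction n) auto

text \<open>Splitting off the last factor leaves a multiple of the previous error plus a scalar
  multiple of \<open>x n - c n e\<close>.\<close>

lemma prod_upto_cong_scalar:
  assumes I: "proper_ideal I" and "\<And>i. i < n \<Longrightarrow> x i \<in> A"
    and "\<And>i. i < n \<Longrightarrow> x i - c i \<odot> e \<in> I"
  shows "prod_upto x n - (\<Prod>i<n. c i) \<odot> e \<in> I"
  using assms(2,3)
proof (induction n)
  case 0
  then show ?case using proper_idealD(2)[OF I] by simp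
next
  case (Suc n)
  have [simp]: "x n \<in> A" "prod_upto x n \<in> A" using Suc.prems by auto
  have "prod_upto x (Suc n) - (\<Prod>i<Suc n. c i) \<odot> e
     = (prod_upto x n - (\<Prod>i<n. c i) \<odot> e) \<star> x n + (\<Prod>i<n. c i) \<odot> (x n - c n \<odot> e)"
    by (simp add: ring_simps)
  also have "\<dots> \<in> I"
    using Suc by (intro proper_idealD(3,4,8)[OF I]) auto
  finally show ?case .
qed

text \<open>\<open>S\<close> is one set outside of which all resolvents exist, so that it can serve
  operators acting in quite different ways. A proper ideal contains no invertible element, hence
  every scalar found by adjoining lies in \<open>S\<close>.\<close>

theorem diff_prod_invertible:
  assumes y [simp]: "y \<in> A" and x: "\<And>i. i < n \<Longrightarrow> x i \<in> A"
    and y_inv: "\<And>c. c \<notin> S \<Longrightarrow> \<exists>b\<in>A. (y - c \<odot> e) \<star> b = e"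
    and x_inv: "\<And>c i. c \<notin> S \<Longrightarrow> i < n \<Longrightarrow> \<exists>b\<in>A. (x i - c \<odot> e) \<star> b = e"
    and nonres: "\<And>c. (\<And>i. i < n \<Longrightarrow> c i \<in> S) \<Longrightarrow> (\<Prod>i<n. c i) \<notin> S"
  shows "\<exists>b\<in>A. (y - prod_upto x n) \<star> b = e"
proof (rule ccontr)
  let ?t = "y - prod_upto x n"
  assume neg: "\<not> ?thesis"
  have [simp]: "prod_upto x n \<in> A" using x by simp
  define I0 where "I0 = {?t \<star> b | b. b \<in> A}"
  have "proper_ideal I0"
    unfolding proper_ideal_def
  proof (intro conjI ballI notI)
    show "I0 \<subseteq> A" by (auto simp: I0_def)
    have "0 = ?t \<star> 0" by simp
    then show "0 \<in> I0" unfolding I0_def by blast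
    show "u + v \<in> I0" if "u \<in> I0" "v \<in> I0" for u v
    proof -
      obtain b d where *: "u = ?t \<star> b" "v = ?t \<star> d" "b \<in> A" "d \<in> A" using \<open>u \<in> I0\<close> \<open>v \<in> I0\<close> by (auto simp: I0_def)
      then have "u + v = ?t \<star> (b + d)" by (simp add: mult_add)
      then show ?thesis using * unfolding I0_def by blast
    qed
    show "u \<star> d \<in> I0" if "u \<in> I0" and [simp]: "d \<in> A" for u d
    proof -
      obtain b where *: "u = ?t \<star> b" "b \<in> A" using \<open>u \<in> I0\<close> by (auto simp: I0_def)
      then have "u \<star> d = ?t \<star> (b \<star> d)" by (simp add: mult_assoc)
      then show ?thesis using * \<open>d \<in> A\<close> unfolding I0_def by blast
    qed
    show False if "e \<in> I0" using that neg by (auto simp: I0_def)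
  qed
  moreover have "?t \<in> I0" unfolding I0_def by (auto intro!: exI[of _ e])
  \<comment> \<open>\<open>y\<close> takes the index \<open>0\<close> and the factors are shifted by
    one, so that a single use of \<open>proper_ideal_adjoin_many\<close> treats them all.\<close>
  moreover have "\<And>i. i < Suc n \<Longrightarrow> (case i of 0 \<Rightarrow> y | Suc j \<Rightarrow> x j) \<in> A"
    using x by (auto split: nat.split)
  ultimately obtain c I where I: "proper_ideal I" "?t \<in> I" and
    c: "\<And>i. i < Suc n \<Longrightarrow> (case i of 0 \<Rightarrow> y | Suc j \<Rightarrow> x j) - c i \<odot> e \<in> I"
    using proper_ideal_adjoin_many[of I0 "Suc n" "\<lambda>i. case i of 0 \<Rightarrow> y | Suc j \<Rightarrow> x j"] by blast
  note D = proper_idealD[OF I(1)]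
  have cy: "y - c 0 \<odot> e \<in> I" using c[of 0] by simp
  have cx: "x i - c (Suc i) \<odot> e \<in> I" if "i < n" for i using c[of "Suc i"] that by simp
  have S0: "c 0 \<in> S"
    using y_inv[of "c 0"] cy D(4,6) by metis
  have Si: "c (Suc i) \<in> S" if "i < n" for i
    using x_inv[of "c (Suc i)" i] cx[OF that] D(4,6) that by metis
  let ?p = "\<Prod>i<n. c (Suc i)"
  have "prod_upto x n - ?p \<odot> e \<in> I"
    by (rule prod_upto_cong_scalar[OF I(1) x cx])
  \<comment> \<open>In \<open>?t - (y - c 0 e) + (prod_upto x n - ?p e)\<close> both algebra
    elements cancel and a scalar remains; a nonzero one would put the unit into
    \<open>I\<close>.\<close>
  from D(3)[OF D(9)[OF I(2) cy] this] have "(c 0 - ?p) \<odot> e \<in> I"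
    by (simp add: sc_diff_left)
  from D(8)[OF this, of "1 / (c 0 - ?p)"] have "c 0 = ?p"
    using D(6) by (cases "c 0 = ?p") (auto simp: sc_sc)
  with nonres[of "\<lambda>i. c (Suc i)"] S0 Si show False by auto
qed

end

section \<open>Commuting operators on a complex Banach space\<close>

text \<open>Completeness is stated for series with geometrically decreasing terms, the form that the
  Neumann series uses and that is verified for maps with decay. The carrier accommodates those maps,
  a subset of a function type.\<close>

locale complex_banach =
  fixes E :: "'e::ab_group_add set"
    and scl :: "complex \<Rightarrow> 'e \<Rightarrow> 'e"
    and nE :: "'e \<Rightarrow> real"
  assumes zero_E [simp, intro]: "0 \<in> E"
    and diff_E [simp, intro]: "x \<in> E \<Longrightarrow> y \<in> E \<Longrightarrow> x - y \<in> E"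
    and scl_E [simp, intro]: "x \<in> E \<Longrightarrow> scl c x \<in> E"
    and scl_diff: "x \<in> E \<Longrightarrow> y \<in> E \<Longrightarrow> scl c (x - y) = scl c x - scl c y"
    and scl_diff_left: "x \<in> E \<Longrightarrow> scl (c - d) x = scl c x - scl d x"
    and scl_scl: "x \<in> E \<Longrightarrow> scl c (scl d x) = scl (c * d) x"
    and scl_one [simp]: "x \<in> E \<Longrightarrow> scl 1 x = x"
    and nE_nonneg [simp]: "0 \<le> nE x"
    and nE_eq_0: "x \<in> E \<Longrightarrow> nE x = 0 \<Longrightarrow> x = 0"
    and nE_add: "x \<in> E \<Longrightarrow> y \<in> E \<Longrightarrow> nE (x + y) \<le> nE x + nE y"
    and nE_scl: "x \<in> E \<Longrightarrow> nE (scl c x) \<le> cmod c * nE x"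
    and complete: "(\<And>n. f n \<in> E) \<Longrightarrow> (\<And>n. nE (f n) \<le> C * t ^ n) \<Longrightarrow> 0 \<le> t \<Longrightarrow> t < 1 \<Longrightarrow>
      \<exists>s\<in>E. (\<lambda>n. nE (s - (\<Sum>i<n. f i))) \<longlonglongrightarrow> 0"
begin

lemma uminus_E [simp, intro]: "x \<in> E \<Longrightarrow> - x \<in> E"
  using diff_E[of 0 x] by simp

lemma add_E [simp, intro]: "x \<in> E \<Longrightarrow> y \<in> E \<Longrightarrow> x + y \<in> E"
  using diff_E[of x "- y"] by simp

lemma sum_E [simp, intro]: "(\<And>i. i \<in> I \<Longrightarrow> f i \<in> E) \<Longrightarrow> sum f I \<in> E"
  by (induction I rule: infinite_finite_induct) auto

lemma scl_zero_left [simp]: "x \<in> E \<Longrightarrow> scl 0 x = 0"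
  using scl_diff_left[of x 0 0] by simp

lemma scl_zero [simp]: "scl c 0 = 0"
  using scl_diff[of 0 0 c] by simp

lemma scl_minus: "x \<in> E \<Longrightarrow> scl c (- x) = - scl c x"
  using scl_diff[of 0 x c] by simp

lemma scl_add: "x \<in> E \<Longrightarrow> y \<in> E \<Longrightarrow> scl c (x + y) = scl c x + scl c y"
  using scl_diff[of x "- y" c] by (simp add: scl_minus)

lemma nE_minus [simp]: "x \<in> E \<Longrightarrow> nE (- x) = nE x"
proof -
  have *: "nE (- x) \<le> nE x" if "x \<in> E" for x
    using nE_scl[of x "0 - 1"] scl_diff_left[of x 0 1] that by simp
  show "x \<in> E \<Longrightarrow> nE (- x) = nE x"
    using *[of x] *[of "- x"] by auto
qed

text \<open>Operators are normalized to vanish outside \<open>E\<close>. Equality of functions is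
  then equality of operators on \<open>E\<close>, and \<open>id_E\<close> is a unit for
  composition.\<close>

definition bounded_ops :: "('e \<Rightarrow> 'e) set" where
  "bounded_ops = {T. (\<forall>x. x \<notin> E \<longrightarrow> T x = 0) \<and> (\<forall>x\<in>E. T x \<in> E) \<and>
     (\<forall>x\<in>E. \<forall>y\<in>E. T (x - y) = T x - T y) \<and> (\<forall>c. \<forall>x\<in>E. T (scl c x) = scl c (T x)) \<and>
     (\<exists>C. \<forall>x\<in>E. nE (T x) \<le> C * nE x)}"

lemma bounded_opsD:
  assumes "T \<in> bounded_ops"
  shows "x \<notin> E \<Longrightarrow> T x = 0" "T x \<in> E" "x \<in> E \<Longrightarrow> y \<in> E \<Longrightarrow> T (x - y) = T x - T y"
    "x \<in> E \<Longrightarrow> T (scl c x) = scl c (T x)" "T 0 = 0" "x \<in> E \<Longrightarrow> y \<in> E \<Longrightarrow> T (x + y) = T x + T y"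
    "(\<And>i. i \<in> I \<Longrightarrow> f i \<in> E) \<Longrightarrow> T (sum f I) = (\<Sum>i\<in>I. T (f i))"
proof -
  show *: "x \<notin> E \<Longrightarrow> T x = 0" "T x \<in> E" "x \<in> E \<Longrightarrow> y \<in> E \<Longrightarrow> T (x - y) = T x - T y"
    "x \<in> E \<Longrightarrow> T (scl c x) = scl c (T x)" for x y
    using assms by (cases "x \<in> E"; auto simp: bounded_ops_def)+
  show 0: "T 0 = 0" using *(3)[of 0 0] by simp
  show add: "x \<in> E \<Longrightarrow> y \<in> E \<Longrightarrow> T (x + y) = T x + T y" for x y
    using *(3)[of x "- y"] *(3)[of 0 y] 0 by simp
  show "(\<And>i. i \<in> I \<Longrightarrow> f i \<in> E) \<Longrightarrow> T (sum f I) = (\<Sum>i\<in>I. T (f i))"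
    by (induction I rule: infinite_finite_induct) (simp_all add: 0 add sum_E)
qed

text \<open>The default \<open>0\<close> makes \<open>op_norm\<close> nonnegative on all functions,
  as \<open>q_nonneg\<close> demands without a membership condition.\<close>

definition op_norm :: "('e \<Rightarrow> 'e) \<Rightarrow> real" where
  "op_norm T = (if T \<in> bounded_ops then Inf {C. 0 \<le> C \<and> (\<forall>x\<in>E. nE (T x) \<le> C * nE x)} else 0)"

lemma op_norm_le: "0 \<le> C \<Longrightarrow> (\<And>x. x \<in> E \<Longrightarrow> nE (T x) \<le> C * nE x) \<Longrightarrow> op_norm T \<le> C"
  unfolding op_norm_def by (simp, intro impI cInf_lower CollectI conjI ballI bdd_belowI[of _ 0]) auto

lemma op_norm:
  assumes "T \<in> bounded_ops"
  shows "0 \<le> op_norm T" "x \<in> E \<Longrightarrow> nE (T x) \<le> op_norm T * nE x"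
proof -
  let ?S = "{C. 0 \<le> C \<and> (\<forall>x\<in>E. nE (T x) \<le> C * nE x)}"
  obtain C where C: "\<And>x. x \<in> E \<Longrightarrow> nE (T x) \<le> C * nE x"
    using assms by (force simp: bounded_ops_def)
  have "nE (T x) \<le> max 0 C * nE x" if "x \<in> E" for x
    using C[OF that] by (rule order_trans) (intro mult_right_mono, auto)
  then have ne: "max 0 C \<in> ?S" by auto
  show "0 \<le> op_norm T"
    unfolding op_norm_def if_P[OF assms] by (rule cInf_greatest) (use ne in blast, simp)
  show "nE (T x) \<le> op_norm T * nE x" if "x \<in> E"
  proof (cases "nE x = 0")
    case True
    then show ?thesis using C[OF that] by simp
  next
    case False
    then have "nE x > 0" using nE_nonneg[of x] by linarith
    have "nE (T x) / nE x \<le> op_norm T"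
      unfolding op_norm_def if_P[OF assms]
      by (rule cInf_greatest) (use ne in blast, use \<open>nE x > 0\<close> that in \<open>auto simp: pos_divide_le_eq\<close>)
    then show ?thesis using \<open>nE x > 0\<close> by (simp add: pos_divide_le_eq)
  qed
qed

definition id_E :: "'e \<Rightarrow> 'e" where "id_E x = (if x \<in> E then x else 0)"

definition op_scl :: "complex \<Rightarrow> ('e \<Rightarrow> 'e) \<Rightarrow> 'e \<Rightarrow> 'e" where
  "op_scl c T = (\<lambda>x. scl c (T x))"

lemma bounded_opsI:
  assumes "\<And>x. x \<notin> E \<Longrightarrow> T x = 0" "\<And>x. x \<in> E \<Longrightarrow> T x \<in> E"
    "\<And>x y. x \<in> E \<Longrightarrow> y \<in> E \<Longrightarrow> T (x - y) = T x - T y"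
    "\<And>x c. x \<in> E \<Longrightarrow> T (scl c x) = scl c (T x)" "\<And>x. x \<in> E \<Longrightarrow> nE (T x) \<le> C * nE x"
  shows "T \<in> bounded_ops"
  unfolding bounded_ops_def
  by (intro CollectI conjI allI impI ballI exI[of _ C] assms)

lemma id_E_bounded: "id_E \<in> bounded_ops"
  by (rule bounded_opsI[where C = 1]) (simp_all add: id_E_def)

lemma nE_diff_op:
  assumes "S \<in> bounded_ops" "T \<in> bounded_ops" "x \<in> E"
  shows "nE ((S - T) x) \<le> (op_norm S + op_norm T) * nE x"
proof -
  have "nE ((S - T) x) \<le> nE (S x) + nE (- T x)"
    using nE_add[of "S x" "- T x"] bounded_opsD(2)[OF assms(1)] bounded_opsD(2)[OF assms(2)] by simp
  then show ?thesis
    using op_norm(2)[OF assms(1,3)] op_norm(2)[OF assms(2,3)] bounded_opsD(2)[OF assms(2)]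
    by (simp add: algebra_simps)
qed

lemma diff_bounded:
  assumes "S \<in> bounded_ops" "T \<in> bounded_ops"
  shows "S - T \<in> bounded_ops"
proof (rule bounded_opsI[OF _ _ _ _ nE_diff_op[OF assms]])
  note D = bounded_opsD[OF assms(1)] bounded_opsD[OF assms(2)]
  show "x \<notin> E \<Longrightarrow> (S - T) x = 0" "x \<in> E \<Longrightarrow> (S - T) x \<in> E"
    "x \<in> E \<Longrightarrow> (S - T) (scl c x) = scl c ((S - T) x)" for x c
    by (simp_all add: D scl_diff)
  show "x \<in> E \<Longrightarrow> y \<in> E \<Longrightarrow> (S - T) (x - y) = (S - T) x - (S - T) y" for x y
    by (simp add: D)
qed

lemma nE_comp_op:
  assumes "S \<in> bounded_ops" "T \<in> bounded_ops" "x \<in> E"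
  shows "nE ((S \<circ> T) x) \<le> (op_norm S * op_norm T) * nE x"
proof -
  have "nE ((S \<circ> T) x) \<le> op_norm S * nE (T x)"
    using op_norm(2)[OF assms(1) bounded_opsD(2)[OF assms(2)], of x] by simp
  also have "\<dots> \<le> op_norm S * (op_norm T * nE x)"
    by (rule mult_left_mono[OF op_norm(2)[OF assms(2,3)] op_norm(1)[OF assms(1)]])
  finally show ?thesis by (simp add: mult_ac)
qed

lemma comp_bounded:
  assumes "S \<in> bounded_ops" "T \<in> bounded_ops"
  shows "S \<circ> T \<in> bounded_ops"
proof (rule bounded_opsI[OF _ _ _ _ nE_comp_op[OF assms]])
  note D = bounded_opsD[OF assms(1)] bounded_opsD[OF assms(2)]
  show "x \<notin> E \<Longrightarrow> (S \<circ> T) x = 0" "x \<in> E \<Longrightarrow> (S \<circ> T) x \<in> E"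
    "x \<in> E \<Longrightarrow> (S \<circ> T) (scl c x) = scl c ((S \<circ> T) x)" for x c
    by (simp_all add: D)
  show "x \<in> E \<Longrightarrow> y \<in> E \<Longrightarrow> (S \<circ> T) (x - y) = (S \<circ> T) x - (S \<circ> T) y" for x y
    by (simp add: D)
qed

lemma nE_scl_op:
  assumes "T \<in> bounded_ops" "x \<in> E"
  shows "nE (op_scl c T x) \<le> (cmod c * op_norm T) * nE x"
proof -
  have "nE (op_scl c T x) \<le> cmod c * nE (T x)"
    unfolding op_scl_def by (rule nE_scl[OF bounded_opsD(2)[OF assms(1)]])
  also have "\<dots> \<le> cmod c * (op_norm T * nE x)"
    by (rule mult_left_mono[OF op_norm(2)[OF assms] norm_ge_zero])
  finally show ?thesis by (simp add: mult_ac)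
qed

lemma scl_bounded:
  assumes "T \<in> bounded_ops"
  shows "op_scl c T \<in> bounded_ops"
proof (rule bounded_opsI[OF _ _ _ _ nE_scl_op[OF assms]])
  note D = bounded_opsD[OF assms(1)]
  show "x \<notin> E \<Longrightarrow> op_scl c T x = 0" "x \<in> E \<Longrightarrow> op_scl c T x \<in> E"
    "x \<in> E \<Longrightarrow> op_scl c T (scl d x) = scl d (op_scl c T x)" for x d
    by (simp_all add: D op_scl_def scl_scl mult.commute)
  show "x \<in> E \<Longrightarrow> y \<in> E \<Longrightarrow> op_scl c T (x - y) = op_scl c T x - op_scl c T y" for x y
    by (simp add: D op_scl_def scl_diff)
qed

lemma comp_id_E:
  "T \<in> bounded_ops \<Longrightarrow> T \<circ> id_E = T" "T \<in> bounded_ops \<Longrightarrow> id_E \<circ> T = T"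
  using bounded_opsD(1,2,5)[of T] by (auto simp: fun_eq_iff id_E_def)

section \<open>Commutants\<close>

definition commutant :: "('e \<Rightarrow> 'e) set \<Rightarrow> ('e \<Rightarrow> 'e) set" where
  "commutant X = {T \<in> bounded_ops. \<forall>S\<in>X. T \<circ> S = S \<circ> T}"

lemma commutant_comp: "T \<in> commutant X \<Longrightarrow> S \<in> X \<Longrightarrow> T (S x) = S (T x)"
  unfolding commutant_def by (auto simp: fun_eq_iff)

lemma commutantD: "T \<in> commutant X \<Longrightarrow> S \<in> X \<Longrightarrow> T \<circ> S = S \<circ> T"
  by (simp add: commutant_def)

lemma commutant_antimono: "X \<subseteq> Y \<Longrightarrow> commutant Y \<subseteq> commutant X"
  unfolding commutant_def by blast

lemma commutant_bounded: "T \<in> commutant X \<Longrightarrow> T \<in> bounded_ops"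
  by (simp add: commutant_def)

lemma commutantI: "T \<in> bounded_ops \<Longrightarrow> (\<And>S x. S \<in> X \<Longrightarrow> x \<in> E \<Longrightarrow> T (S x) = S (T x)) \<Longrightarrow>
    X \<subseteq> bounded_ops \<Longrightarrow> T \<in> commutant X"
  unfolding commutant_def
proof (intro CollectI conjI ballI ext)
  fix S x
  assume T: "T \<in> bounded_ops" and comm: "\<And>S x. S \<in> X \<Longrightarrow> x \<in> E \<Longrightarrow> T (S x) = S (T x)"
    and "X \<subseteq> bounded_ops" "S \<in> X"
  then have S: "S \<in> bounded_ops" by auto
  show "(T \<circ> S) x = (S \<circ> T) x"
    using comm[OF \<open>S \<in> X\<close>, of x] bounded_opsD(1,5)[OF S] bounded_opsD(1,5)[OF T]
    by (cases "x \<in> E") auto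
qed

section \<open>Norm convergence and the Neumann series\<close>

definition converges :: "(nat \<Rightarrow> 'e) \<Rightarrow> 'e \<Rightarrow> bool" where
  "converges f s \<longleftrightarrow> (\<lambda>n. nE (s - f n)) \<longlonglongrightarrow> 0"

lemma converges_unique:
  assumes "converges f s" "converges f t" "\<And>n. f n \<in> E" "s \<in> E" "t \<in> E"
  shows "s = t"
proof -
  have "(\<lambda>n. nE (s - f n) + nE (t - f n)) \<longlonglongrightarrow> 0 + 0"
    using assms(1,2) unfolding converges_def by (rule tendsto_add)
  moreover have "nE (s - t) \<le> nE (s - f n) + nE (t - f n)" for n
    using nE_add[of "s - f n" "- (t - f n)"] nE_minus[of "t - f n"] assms by simp
  ultimately have "nE (s - t) \<le> 0 + 0"
    by (intro LIMSEQ_le_const) auto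
  then have "nE (s - t) = 0" using nE_nonneg[of "s - t"] by linarith
  then show ?thesis using nE_eq_0[of "s - t"] assms by simp
qed

lemma converges_diff:
  assumes "converges f s" "converges g t" "\<And>n. f n \<in> E" "\<And>n. g n \<in> E" "s \<in> E" "t \<in> E"
  shows "converges (\<lambda>n. f n - g n) (s - t)"
  unfolding converges_def
proof (rule tendsto_sandwich[OF _ _ tendsto_const])
  show "(\<lambda>n. nE (s - f n) + nE (t - g n)) \<longlonglongrightarrow> 0"
    using tendsto_add[OF assms(1,2)[unfolded converges_def]] by simp
  have "nE (s - t - (f n - g n)) \<le> nE (s - f n) + nE (t - g n)" for n
    using nE_add[of "s - f n" "- (t - g n)"] nE_minus[of "t - g n"] assms
    by (simp add: algebra_simps)
  then show "\<forall>\<^sub>F n in sequentially. nE (s - t - (f n - g n)) \<le> nE (s - f n) + nE (t - g n)"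
    by simp
qed simp

lemma converges_op:
  assumes "converges f s" "T \<in> bounded_ops" "\<And>n. f n \<in> E" "s \<in> E"
  shows "converges (\<lambda>n. T (f n)) (T s)"
  unfolding converges_def
proof (rule tendsto_sandwich[OF _ _ tendsto_const])
  show "(\<lambda>n. op_norm T * nE (s - f n)) \<longlonglongrightarrow> 0"
    using tendsto_mult_left[OF assms(1)[unfolded converges_def]] by simp
  show "\<forall>\<^sub>F n in sequentially. nE (T s - T (f n)) \<le> op_norm T * nE (s - f n)"
    using op_norm(2)[OF assms(2), of "s - f _"] assms bounded_opsD(3)[OF assms(2)] by simp
qed simp

lemma converges_scl:
  assumes "converges f s" "\<And>n. f n \<in> E" "s \<in> E"
  shows "converges (\<lambda>n. scl c (f n)) (scl c s)"
  using converges_op[OF assms(1) scl_bounded[OF id_E_bounded, of c]] assms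
  by (simp add: op_scl_def id_E_def)

text \<open>The powers of \<open>S = id_E - T\<close> are summed at each vector, so
  \<open>complete\<close> is applied in \<open>E\<close> and not in a space of operators. Linearity
  passes from the partial sums to the limit by uniqueness of limits; the bound
  \<open>1 / (1 - c)\<close> comes from \<open>Y x = T (Y x) + S (Y x)\<close>.\<close>

lemma neumann:
  assumes T: "T \<in> bounded_ops" and "op_norm (id_E - T) < 1"
  obtains Y where "Y \<in> bounded_ops" "T \<circ> Y = id_E" "Y \<circ> T = id_E"
proof -
  define S where "S = id_E - T"
  define c where "c = op_norm S"
  have S: "S \<in> bounded_ops" unfolding S_def by (intro diff_bounded id_E_bounded T)
  have c: "0 \<le> c" "c < 1" using op_norm(1)[OF S] assms by (auto simp: c_def S_def)
  note SD = bounded_opsD[OF S] and TD = bounded_opsD[OF T]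
  have it_E [simp]: "(S ^^ n) x \<in> E" if "x \<in> E" for n x
    using that by (cases n) (auto simp: SD)
  have it_le: "nE ((S ^^ n) x) \<le> nE x * c ^ n" if "x \<in> E" for n x
  proof (induction n)
    case (Suc n)
    have "nE ((S ^^ Suc n) x) \<le> c * nE ((S ^^ n) x)"
      using op_norm(2)[OF S, of "(S ^^ n) x"] that by (simp add: c_def)
    also have "\<dots> \<le> c * (nE x * c ^ n)" using Suc c by (intro mult_left_mono)
    finally show ?case by (simp add: mult_ac)
  qed simp
  define P where "P x n = (\<Sum>i<n. (S ^^ i) x)" for x n
  have P_E [simp]: "P x n \<in> E" if "x \<in> E" for x n
    using that by (auto simp: P_def)
  have "\<exists>s\<in>E. converges (P x) s" if "x \<in> E" for x
    unfolding converges_def P_def using that it_le[OF that] c by (intro complete[where t = c]) auto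
  then obtain Y0 where Y0: "\<And>x. x \<in> E \<Longrightarrow> Y0 x \<in> E" "\<And>x. x \<in> E \<Longrightarrow> converges (P x) (Y0 x)"
    by metis
  define Y where "Y x = (if x \<in> E then Y0 x else 0)" for x
  have Y: "Y x \<in> E" "converges (P x) (Y x)" if "x \<in> E" for x
    using Y0 that by (auto simp: Y_def)
  have it_diff: "(S ^^ i) (x - y) = (S ^^ i) x - (S ^^ i) y" if "x \<in> E" "y \<in> E" for x y i
    using that by (induction i) (auto simp: SD)
  have it_scl: "(S ^^ i) (scl d x) = scl d ((S ^^ i) x)" if "x \<in> E" for x d i
    using that by (induction i) (auto simp: SD)
  have scl_sum: "scl d (sum f {..<n}) = (\<Sum>i<n. scl d (f i))" if "\<And>i. f i \<in> E" for f d and n :: nat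
    using that by (induction n) (auto simp: scl_add)
  have P_diff: "P (x - y) n = P x n - P y n" if "x \<in> E" "y \<in> E" for x y n
    using that by (simp add: P_def it_diff sum_subtractf)
  have P_scl: "P (scl d x) n = scl d (P x n)" if "x \<in> E" for x d n
    using that by (simp add: P_def it_scl scl_sum)
  have TP: "T (P x n) = x - (S ^^ n) x" if "x \<in> E" for x n
  proof -
    have *: "T y = y - S y" if "y \<in> E" for y using that by (simp add: S_def id_E_def)
    have "T (P x n) = (\<Sum>i<n. T ((S ^^ i) x))"
      unfolding P_def using that by (intro TD(7)) simp
    also have "\<dots> = (\<Sum>i<n. (S ^^ i) x - (S ^^ Suc i) x)"
      using that by (simp add: *)
    finally have "T (P x n) = (\<Sum>i<n. (S ^^ i) x - (S ^^ Suc i) x)" .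
    then show ?thesis using sum_lessThan_telescope'[of "\<lambda>i. (S ^^ i) x" n] by simp
  qed
  have PT: "P (T x) n = T (P x n)" if "x \<in> E" for x n
  proof -
    have "S (T y) = T (S y)" if "y \<in> E" for y
      using that by (simp add: S_def id_E_def TD)
    then have "(S ^^ i) (T x) = T ((S ^^ i) x)" for i
      using \<open>x \<in> E\<close> by (induction i) auto
    then show ?thesis using that by (simp add: P_def TD)
  qed
  have cx: "converges (\<lambda>n. T (P x n)) x" if "x \<in> E" for x
    unfolding converges_def
  proof (rule tendsto_sandwich[OF _ _ tendsto_const])
    show "(\<lambda>n. nE x * c ^ n) \<longlonglongrightarrow> 0"
      using tendsto_mult_left[OF LIMSEQ_power_zero, of c "nE x"] c by simp
    show "\<forall>\<^sub>F n in sequentially. nE (x - T (P x n)) \<le> nE x * c ^ n"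
      using it_le that by (simp add: TP)
  qed simp
  have TY: "T (Y x) = x" if "x \<in> E" for x
    using that by (intro converges_unique[OF converges_op[OF Y(2) T] cx]) (auto simp: Y TD)
  have YT: "Y (T x) = x" if "x \<in> E" for x
  proof (rule converges_unique[OF _ cx[OF that]])
    show "converges (\<lambda>n. T (P x n)) (Y (T x))"
      using Y(2)[OF TD(2), of x] unfolding PT[OF that, abs_def] .
  qed (use that Y(1) TD in auto)
  have Y_diff: "Y (x - y) = Y x - Y y" if xy: "x \<in> E" "y \<in> E" for x y
  proof (rule converges_unique)
    show "converges (P (x - y)) (Y (x - y))" using xy by (intro Y) auto
    show "converges (P (x - y)) (Y x - Y y)"
      unfolding P_diff[OF xy, abs_def] using xy by (intro converges_diff Y) auto
  qed (use xy Y in auto)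
  have Y_scl: "Y (scl d x) = scl d (Y x)" if x: "x \<in> E" for x d
  proof (rule converges_unique)
    show "converges (P (scl d x)) (Y (scl d x))" using x by (intro Y) auto
    show "converges (P (scl d x)) (scl d (Y x))"
      unfolding P_scl[OF x, abs_def] using x by (intro converges_scl Y) auto
  qed (use x Y in auto)
  have Y_le: "nE (Y x) \<le> 1 / (1 - c) * nE x" if x: "x \<in> E" for x
  proof -
    have "nE (Y x) \<le> nE (T (Y x)) + nE (S (Y x))"
      using nE_add[of "T (Y x)" "S (Y x)"] Y(1)[OF x] TD(2) SD(2) by (simp add: S_def id_E_def)
    also have "\<dots> \<le> nE x + c * nE (Y x)"
      using op_norm(2)[OF S Y(1)[OF x]] x by (simp add: TY c_def)
    finally show ?thesis using c by (simp add: field_simps)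
  qed
  have "Y \<in> bounded_ops"
    by (rule bounded_opsI[OF _ _ Y_diff Y_scl Y_le]) (auto simp: Y(1), simp add: Y_def)
  then show thesis
  proof (rule that)
    have "Y x = 0" if "x \<notin> E" for x using that by (simp add: Y_def)
    moreover have "Y 0 = 0" using YT[of 0] by (simp add: TD)
    ultimately show "T \<circ> Y = id_E" "Y \<circ> T = id_E"
      using TY YT TD(1,5) by (auto simp: fun_eq_iff id_E_def) 
  qed
qed

text \<open>The source of inverse closedness: an inverse found among all bounded operators lies in
  every commutant that contains the operator, in particular in the bicommutant.\<close>

lemma commutant_inverse:
  assumes T: "T \<in> commutant X" and Y: "Y \<in> bounded_ops" "T \<circ> Y = id_E" "Y \<circ> T = id_E"
    and X: "X \<subseteq> bounded_ops"
  shows "Y \<in> commutant X"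
proof (rule commutantI[OF Y(1) _ X])
  fix R x assume R: "R \<in> X" and x: "x \<in> E"
  have RB: "R \<in> bounded_ops" using R X by auto
  have TY: "T (Y z) = z" "Y (T z) = z" if "z \<in> E" for z
    using fun_cong[OF Y(2), of z] fun_cong[OF Y(3), of z] that by (auto simp: id_E_def)
  have "Y (R x) = Y (R (T (Y x)))" using x by (simp add: TY)
  also have "\<dots> = Y (T (R (Y x)))" using commutant_comp[OF T R] by simp
  also have "\<dots> = R (Y x)" using bounded_opsD(2)[OF RB] by (simp add: TY)
  finally show "Y (R x) = R (Y x)" .
qed

text \<open>\<open>y_inv\<close> and \<open>x_inv\<close> provide inverses among the bounded
  operators, and \<open>commutant_inverse\<close> moves them into the bicommutant of
  \<open>y\<close> and the \<open>x i\<close>. \<open>P\<close> is the product in unfolded form, so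
  that it can be given by a formula on vectors.\<close>

theorem commuting_diff_prod_surj:
  assumes y: "y \<in> bounded_ops" and x: "\<And>i. i < n \<Longrightarrow> x i \<in> bounded_ops"
    and yx: "\<And>i v. i < n \<Longrightarrow> v \<in> E \<Longrightarrow> y (x i v) = x i (y v)"
    and xx: "\<And>i j v. i < n \<Longrightarrow> j < n \<Longrightarrow> v \<in> E \<Longrightarrow> x i (x j v) = x j (x i v)"
    and y_inv: "\<And>c. c \<notin> S \<Longrightarrow> \<exists>b\<in>bounded_ops. \<forall>v\<in>E. b (y v - scl c v) = v \<and> y (b v) - scl c (b v) = v"
    and x_inv: "\<And>c i. c \<notin> S \<Longrightarrow> i < n \<Longrightarrow>
      \<exists>b\<in>bounded_ops. \<forall>v\<in>E. b (x i v - scl c v) = v \<and> x i (b v) - scl c (b v) = v"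
    and nonres: "\<And>c. (\<And>i. i < n \<Longrightarrow> c i \<in> S) \<Longrightarrow> (\<Prod>i<n. c i) \<notin> S"
    and P0: "\<And>v. v \<in> E \<Longrightarrow> P 0 v = v" and PS: "\<And>i v. i < n \<Longrightarrow> v \<in> E \<Longrightarrow> P (Suc i) v = P i (x i v)"
    and w: "w \<in> E"
  shows "\<exists>v\<in>E. y v - P n v = w"
proof -
  define X where "X = insert y (x ` {..<n})"
  define \<A> where "\<A> = commutant (commutant X)"
  have XB: "X \<subseteq> bounded_ops" using y x by (auto simp: X_def)
  have CB: "commutant X \<subseteq> bounded_ops" using commutant_bounded by blast
  have AB: "T \<in> bounded_ops" if "T \<in> \<A>" for T
    using that unfolding \<A>_def by (rule commutant_bounded)
  have XC: "X \<subseteq> commutant X"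
  proof
    fix T assume T: "T \<in> X"
    show "T \<in> commutant X"
    proof (rule commutantI[OF subsetD[OF XB T] _ XB])
      show "T (R v) = R (T v)" if "R \<in> X" "v \<in> E" for R v
        using T that(1) unfolding X_def by (auto simp: yx[OF _ that(2)] xx[OF _ _ that(2)])
    qed
  qed
  have XA: "X \<subseteq> \<A>"
  proof
    fix T assume T: "T \<in> X"
    show "T \<in> \<A>"
      unfolding \<A>_def
      by (rule commutantI[OF subsetD[OF XB T] sym[OF commutant_comp[OF _ T]] CB])
  qed
  \<comment> \<open>Since the generators commute, \<open>X\<close> lies in its commutant. Taking
    commutants reverses the inclusion, and so \<open>\<A>\<close> is commutative.\<close>
  have AC: "\<A> \<subseteq> commutant X"
    unfolding \<A>_def by (rule commutant_antimono[OF XC])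
  have comm: "S \<circ> T = T \<circ> S" if "S \<in> \<A>" "T \<in> \<A>" for S T
    using that(1) subsetD[OF AC that(2)] unfolding \<A>_def by (rule commutantD)
  have inv: "Y \<in> \<A>" if "T \<in> \<A>" "Y \<in> bounded_ops" "T \<circ> Y = id_E" "Y \<circ> T = id_E" for T Y
    using that CB unfolding \<A>_def by (rule commutant_inverse)
  have diffA: "S - T \<in> \<A>" if "S \<in> \<A>" "T \<in> \<A>" for S T
    unfolding \<A>_def
  proof (rule commutantI[OF diff_bounded _ CB])
    fix R v assume R: "R \<in> commutant X" and v: "v \<in> E"
    have RB: "R \<in> bounded_ops" using R CB by auto
    show "(S - T) (R v) = R ((S - T) v)"
      using that R v bounded_opsD(2)[OF AB, of S v] bounded_opsD(2)[OF AB, of T v] commutant_comp[of S "commutant X" R] commutant_comp[of T "commutant X" R]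
      by (simp add: \<A>_def[symmetric] bounded_opsD(3)[OF RB])
  qed (use that AB in auto)
  have compA: "S \<circ> T \<in> \<A>" if "S \<in> \<A>" "T \<in> \<A>" for S T
    unfolding \<A>_def
  proof (rule commutantI[OF comp_bounded _ CB])
    fix R v assume R: "R \<in> commutant X" and v: "v \<in> E"
    show "(S \<circ> T) (R v) = R ((S \<circ> T) v)"
      using that R commutant_comp[of S "commutant X" R] commutant_comp[of T "commutant X" R]
      by (simp add: \<A>_def[symmetric])
  qed (use that AB in auto)
  have sclA: "op_scl c T \<in> \<A>" if "T \<in> \<A>" for c T
    unfolding \<A>_def
  proof (rule commutantI[OF scl_bounded _ CB])
    fix R v assume R: "R \<in> commutant X" and v: "v \<in> E"
    have RB: "R \<in> bounded_ops" using R CB by auto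
    show "op_scl c T (R v) = R (op_scl c T v)"
      using that R bounded_opsD(2)[OF AB, of T v] commutant_comp[of T "commutant X" R]
      by (simp add: \<A>_def[symmetric] bounded_opsD(4)[OF RB] op_scl_def)
  qed (use that AB in auto)
  have idA: "id_E \<in> \<A>"
    unfolding \<A>_def
  proof (rule commutantI[OF id_E_bounded _ CB])
    fix R v assume "R \<in> commutant X" "v \<in> E"
    then show "id_E (R v) = R (id_E v)"
      using bounded_opsD(2)[OF subsetD[OF CB], of R] by (simp add: id_E_def)
  qed
  interpret inverse_closed_algebra \<A> "(\<circ>)" id_E op_scl op_norm
  proof unfold_locales
    fix R S T c d assume R: "R \<in> \<A>" and S: "S \<in> \<A>" and T: "T \<in> \<A>"
    note D = bounded_opsD[OF AB[OF R]] bounded_opsD[OF AB[OF S]] bounded_opsD[OF AB[OF T]]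
    show "R \<circ> (S - T) = (R \<circ> S) - (R \<circ> T)" by (auto simp: fun_eq_iff D)
    show "op_scl c R \<circ> S = op_scl c (R \<circ> S)" by (auto simp: fun_eq_iff op_scl_def)
    show "op_scl c (R - S) = op_scl c R - op_scl c S"
      by (auto simp: fun_eq_iff op_scl_def D scl_diff)
    show "op_scl (c - d) R = op_scl c R - op_scl d R"
      by (auto simp: fun_eq_iff op_scl_def D scl_diff_left)
    show "op_scl c (op_scl d R) = op_scl (c * d) R" "op_scl 1 R = R"
      by (auto simp: fun_eq_iff op_scl_def D scl_scl)
  next
    fix S assume S: "S \<in> \<A>" and "op_norm (id_E - S) < 1"
    then show "\<exists>T\<in>\<A>. S \<circ> T = id_E"
      using neumann[OF AB[OF S]] inv by metis
  next
    show "0 \<le> op_norm T" for T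
      using op_norm(1)[of T] by (cases "T \<in> bounded_ops") (auto simp: op_norm_def)
  next
    fix S T c assume ST: "S \<in> \<A>" "T \<in> \<A>"
    note B = ST[THEN AB]
    show "op_norm (S + T) \<le> op_norm S + op_norm T"
    proof (rule op_norm_le)
      fix v assume "v \<in> E"
      then show "nE ((S + T) v) \<le> (op_norm S + op_norm T) * nE v"
        using nE_add[of "S v" "T v"] op_norm(2)[OF B(1), of v] op_norm(2)[OF B(2), of v]
          bounded_opsD(2)[OF B(1), of v] bounded_opsD(2)[OF B(2), of v]
        by (simp add: algebra_simps)
    qed (intro add_nonneg_nonneg op_norm(1) B)
    show "op_norm (S \<circ> T) \<le> op_norm S * op_norm T"
      by (intro op_norm_le nE_comp_op mult_nonneg_nonneg op_norm(1) B)
    show "op_norm (op_scl c S) \<le> cmod c * op_norm S"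
      by (intro op_norm_le nE_scl_op mult_nonneg_nonneg op_norm(1) B) auto
  qed (use comm in \<open>simp_all add: diffA compA sclA idA comp_assoc comp_id_E AB\<close>)
  have inv': "\<exists>b\<in>\<A>. (T - op_scl c id_E) \<circ> b = id_E"
    if T: "T \<in> \<A>" and ex: "\<exists>b\<in>bounded_ops. \<forall>v\<in>E. b (T v - scl c v) = v \<and> T (b v) - scl c (b v) = v" for T c
  proof -
    obtain b where b: "b \<in> bounded_ops" "\<And>v. v \<in> E \<Longrightarrow> b (T v - scl c v) = v"
      "\<And>v. v \<in> E \<Longrightarrow> T (b v) - scl c (b v) = v"
      using ex by blast
    have "(T - op_scl c id_E) \<circ> b = id_E" "b \<circ> (T - op_scl c id_E) = id_E"
      using b(2,3) bounded_opsD(1,2,5)[OF b(1)] bounded_opsD(1,2,5)[OF AB[OF T]]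
      by (simp_all add: fun_eq_iff op_scl_def id_E_def)
    then show ?thesis
      using inv[OF diffA[OF T sclA[OF idA]] b(1)] by blast
  qed
  have yA: "y \<in> \<A>" and xA: "\<And>i. i < n \<Longrightarrow> x i \<in> \<A>"
    using XA by (auto simp: X_def)
  have "\<exists>b\<in>\<A>. (y - prod_upto x n) \<circ> b = id_E"
  proof (rule diff_prod_invertible[where S = S])
    show "\<exists>b\<in>\<A>. (y - op_scl c id_E) \<circ> b = id_E" if "c \<notin> S" for c
      by (rule inv'[OF yA y_inv[OF that]])
    show "\<exists>b\<in>\<A>. (x i - op_scl c id_E) \<circ> b = id_E" if "c \<notin> S" "i < n" for c i
      by (rule inv'[OF xA[OF that(2)] x_inv[OF that]])
    show "(\<Prod>i<n. c i) \<notin> S" if "\<And>i. i < n \<Longrightarrow> c i \<in> S" for c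
      by (rule nonres[OF that])
  qed (rule yA, rule xA)
  then obtain b where b: "b \<in> \<A>" "(y - prod_upto x n) \<circ> b = id_E"
    by blast
  \<comment> \<open>New factors of \<open>prod_upto\<close> enter on the right and act first, in
    agreement with \<open>PS\<close>; therefore the vector varies in the induction.\<close>
  have "prod_upto x k v = P k v" if "k \<le> n" "v \<in> E" for k v
    using that
  proof (induction k arbitrary: v)
    case (Suc k)
    then have k: "k < n" "k \<le> n" by auto
    have "prod_upto x (Suc k) v = prod_upto x k (x k v)"
      by (rule trans[OF fun_cong[OF prod_upto.simps(2)] comp_apply])
    also have "\<dots> = P k (x k v)"
      by (rule Suc.IH[OF k(2) bounded_opsD(2)[OF x[OF k(1)]]])
    also have "\<dots> = P (Suc k) v"
      by (rule PS[OF k(1) Suc.prems(2), symmetric])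
    finally show ?case .
  next
    case 0
    have "prod_upto x 0 v = id_E v" by (rule fun_cong[OF prod_upto.simps(1)])
    also have "\<dots> = P 0 v" using 0 by (simp add: id_E_def P0)
    finally show ?case .
  qed
  then have "y (b w) - P n (b w) = w"
    using fun_cong[OF b(2), of w] bounded_opsD(2)[OF AB[OF b(1)], of w] w by (simp add: id_E_def)
  then show ?thesis
    using bounded_opsD(2)[OF AB[OF b(1)], of w] by blast
qed

end

section \<open>Bounds for multilinear maps\<close>

lemma apply_sum_linf:
  fixes f :: "'k \<Rightarrow> ('m::finite, 'v::real_normed_vector) linf"
  shows "sum f S i = (\<Sum>k\<in>S. f k i)"
  by (induction S rule: infinite_finite_induct) auto

definition single :: "int ^ 'm::finite \<Rightarrow> 'v::real_normed_vector \<Rightarrow> ('m, 'v) linf" where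
  "single k v = Bcontfun (\<lambda>i. if i = k then v else 0)"

lemma apply_single: "single k v i = (if i = k then v else 0)"
  unfolding single_def
  by (subst apply_Bcontfun_lattice) (auto simp: bounded_iff intro!: exI[of _ "norm v"])

lemma supported_at_single: "supported_at k (single k v)"
  by (simp add: supported_at_def apply_single)

lemma norm_single_le: "norm (single k v) \<le> norm v"
  by (rule norm_bound) (simp add: apply_single)

lemma decay_functionD:
  assumes "decay_function \<Gamma>"
  shows "0 < \<Gamma> k" "finite S \<Longrightarrow> sum \<Gamma> S \<le> 1"
    "finite S \<Longrightarrow> (\<Sum>k\<in>S. \<Gamma> (i - k) * \<Gamma> (k - j)) \<le> \<Gamma> (i - j)"
proof -
  show pos: "0 < \<Gamma> k" for k using assms by (simp add: decay_function_def)
  show "sum \<Gamma> S \<le> 1" if "finite S"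
  proof -
    have "sum \<Gamma> S \<le> (\<Sum>\<^sub>\<infinity>k. \<Gamma> k)"
      using assms that pos by (intro finite_sum_le_infsum) (auto simp: decay_function_def less_imp_le)
    then show ?thesis using assms by (simp add: decay_function_def)
  qed
  show "(\<Sum>k\<in>S. \<Gamma> (i - k) * \<Gamma> (k - j)) \<le> \<Gamma> (i - j)" if "finite S"
  proof -
    have "(\<Sum>k\<in>S. \<Gamma> (i - k) * \<Gamma> (k - j)) \<le> (\<Sum>\<^sub>\<infinity>k. \<Gamma> (i - k) * \<Gamma> (k - j))"
      using assms that pos by (intro finite_sum_le_infsum) (auto simp: decay_function_def less_imp_le)
    also have "\<dots> \<le> \<Gamma> (i - j)" using assms by (simp add: decay_function_def)
    finally show ?thesis .
  qed
qed

text \<open>Each index counted contributes at least \<open>\<delta>\<close> to a sum bounded by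
  \<open>1\<close>, so finite subsets have at most \<open>1 / \<delta>\<close> elements.\<close>

lemma finite_decay_ge:
  assumes "decay_function \<Gamma>" "0 < \<delta>"
  shows "finite {k. \<delta> \<le> \<Gamma> (k - l)}"
proof (rule conjunct1[OF finite_if_finite_subsets_card_bdd])
  fix F assume F: "F \<subseteq> {k. \<delta> \<le> \<Gamma> (k - l)}" "finite F"
  have "real (card F) * \<delta> = (\<Sum>k\<in>F. \<delta>)" by simp
  also have "\<dots> \<le> (\<Sum>k\<in>F. \<Gamma> (k - l))" using F by (intro sum_mono) auto
  also have "\<dots> = sum \<Gamma> ((\<lambda>k. k - l) ` F)" by (subst sum.reindex) (auto simp: inj_on_def)
  also have "\<dots> \<le> 1" using F by (intro decay_functionD(2)[OF assms(1)]) auto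
  finally have "real (card F) \<le> 1 / \<delta>" using assms by (simp add: field_simps)
  then show "card F \<le> nat \<lceil>1 / \<delta>\<rceil>" by linarith
qed

text \<open>
  A linear map on bounded families is not determined by its values on families with finite support;
  here it is because \<open>u\<close> is a norm limit of its truncations.
\<close>

lemma decay_apply:
  fixes \<phi> :: "('m::finite, 'a::real_normed_vector) linf \<Rightarrow> ('m, 'b::real_normed_vector) linf"
    and u :: "('m, 'a) linf"
  assumes \<Gamma>: "decay_function \<Gamma>" and "linear \<phi>" and M: "0 \<le> M" "\<And>u. norm (\<phi> u) \<le> M * norm u"
    and MG: "\<And>k w i. supported_at k w \<Longrightarrow> norm (\<phi> w i) \<le> M * \<Gamma> (i - k) * norm w"
    and c: "0 \<le> c" "\<And>k. norm (u k) \<le> c * \<Gamma> (k - l)"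
  shows "norm (\<phi> u i) \<le> M * c * \<Gamma> (i - l)"
proof (rule field_le_epsilon)
  fix \<epsilon> :: real assume "\<epsilon> > 0"
  note \<Gamma>D = decay_functionD[OF \<Gamma>]
  interpret linear \<phi> by fact
  \<comment> \<open>Outside \<open>S\<close> the family is at most
    \<open>(c + 1) * \<delta>\<close>, so the truncation costs at most
    \<open>(M + 1) * ((c + 1) * \<delta>) = \<epsilon>\<close> in the image.\<close>
  define \<delta> where "\<delta> = \<epsilon> / ((M + 1) * (c + 1))"
  have "\<delta> > 0" using \<open>\<epsilon> > 0\<close> M c by (simp add: \<delta>_def)
  define S where "S = {k. \<delta> \<le> \<Gamma> (k - l)}"
  have S: "finite S" unfolding S_def by (rule finite_decay_ge[OF \<Gamma> \<open>\<delta> > 0\<close>])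
  define t where "t = (\<Sum>k\<in>S. single k (u k))"
  have t: "t i = (if i \<in> S then u i else 0)" for i
    using S by (simp add: t_def apply_sum_linf apply_single)
  have "norm ((u - t) i) \<le> (c + 1) * \<delta>" for i
  proof (cases "i \<in> S")
    case False
    then have "\<Gamma> (i - l) \<le> \<delta>" by (simp add: S_def)
    then have "c * \<Gamma> (i - l) \<le> (c + 1) * \<delta>"
      using c \<Gamma>D(1)[of "i - l"] by (intro mult_mono) auto
    then show ?thesis using c(2)[of i] False by (simp add: t)
  qed (use \<open>\<delta> > 0\<close> c in \<open>simp add: t\<close>)
  then have ut: "norm (u - t) \<le> (c + 1) * \<delta>" by (rule norm_bound)
  have "norm (\<phi> (u - t) i) \<le> M * ((c + 1) * \<delta>)"
    using norm_bounded[of "\<phi> (u - t)" i] M(2)[of "u - t"] mult_left_mono[OF ut M(1)] by linarith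
  also have "\<dots> \<le> (M + 1) * ((c + 1) * \<delta>)"
    using c \<open>\<delta> > 0\<close> by (intro mult_right_mono) auto
  also have "\<dots> = \<epsilon>" using M c by (simp add: \<delta>_def)
  finally have 1: "norm (\<phi> (u - t) i) \<le> \<epsilon>" .
  have "norm (\<phi> t i) = norm (\<Sum>k\<in>S. \<phi> (single k (u k)) i)"
    by (simp add: t_def sum apply_sum_linf)
  also have "\<dots> \<le> (\<Sum>k\<in>S. norm (\<phi> (single k (u k)) i))" by (rule norm_sum)
  also have "\<dots> \<le> (\<Sum>k\<in>S. M * c * (\<Gamma> (i - k) * \<Gamma> (k - l)))"
  proof (rule sum_mono)
    fix k
    have "norm (\<phi> (single k (u k)) i) \<le> M * \<Gamma> (i - k) * norm (single k (u k))"
      by (rule MG[OF supported_at_single])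
    also have "\<dots> \<le> M * \<Gamma> (i - k) * (c * \<Gamma> (k - l))"
      using M(1) \<Gamma>D(1)[of "i - k"] order_trans[OF norm_single_le c(2)]
      by (intro mult_left_mono mult_nonneg_nonneg) auto
    finally show "norm (\<phi> (single k (u k)) i) \<le> M * c * (\<Gamma> (i - k) * \<Gamma> (k - l))"
      by (simp add: mult_ac)
  qed
  \<comment> \<open>The convolution inequality of the decay function, on a finite set.\<close>
  also have "\<dots> \<le> M * c * \<Gamma> (i - l)"
    unfolding sum_distrib_left [symmetric] using M c S by (intro mult_left_mono \<Gamma>D(3)) auto
  finally have 2: "norm (\<phi> t i) \<le> M * c * \<Gamma> (i - l)" .
  have "\<phi> u i = \<phi> t i + \<phi> (u - t) i" by (simp add: diff)
  then show "norm (\<phi> u i) \<le> M * c * \<Gamma> (i - l) + \<epsilon>"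
    using norm_triangle_ineq[of "\<phi> t i" "\<phi> (u - t) i"] 1 2 by simp
qed

abbreviation norms :: "'a::real_normed_vector list \<Rightarrow> real" where
  "norms vs \<equiv> prod_list (map norm vs)"

lemma norms_nonneg: "0 \<le> norms vs"
  by (induction vs) auto

lemma norms_le: "(\<And>v. v \<in> set vs \<Longrightarrow> norm v \<le> b) \<Longrightarrow> norms vs \<le> b ^ length vs"
  by (induction vs) (auto intro!: mult_mono norms_nonneg intro: order_trans[OF norm_ge_zero])

lemma norms_split: "norms vs = norms (take p vs) * (norms (take j (drop p vs)) * norms (drop (p + j) vs))"
proof -
  have "vs = take p vs @ take j (drop p vs) @ drop (p + j) vs"
    by (metis append_take_drop_id add.commute drop_drop)
  then show ?thesis by (metis map_append prod_list.append)
qed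

text \<open>A single constant covers the operator norm and the decay, in homogeneous form and for
  the norm of the type. Arguments and values may have different types, which admits complex values
  of real arguments.\<close>

definition decay_bound :: "(int ^ 'm::finite \<Rightarrow> real) \<Rightarrow> nat \<Rightarrow>
  (('m, 'a::real_normed_vector) linf list \<Rightarrow> ('m, 'b::real_normed_vector) linf) \<Rightarrow> real \<Rightarrow> bool" where
  "decay_bound \<Gamma> k K C \<longleftrightarrow> 0 \<le> C \<and> (\<forall>vs. length vs = k \<longrightarrow> norm (K vs) \<le> C * norms vs) \<and>
     (\<forall>vs p l i. length vs = k \<longrightarrow> p < k \<longrightarrow> supported_at l (vs ! p) \<longrightarrow>
        norm (K vs i) \<le> C * \<Gamma> (i - l) * norms vs)"

definition decay_multilinear :: "(int ^ 'm::finite \<Rightarrow> real) \<Rightarrow> nat \<Rightarrow>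
  (('m, 'a::real_normed_vector) linf list \<Rightarrow> ('m, 'b::real_normed_vector) linf) \<Rightarrow> bool" where
  "decay_multilinear \<Gamma> k K \<longleftrightarrow> multilinear k K \<and> (\<exists>C. decay_bound \<Gamma> k K C)"

lemma decay_boundD:
  fixes K :: "('m::finite, 'a::real_normed_vector) linf list \<Rightarrow> ('m, 'b::real_normed_vector) linf"
  assumes "decay_bound \<Gamma> k K C"
  shows "0 \<le> C" "length vs = k \<Longrightarrow> norm (K vs) \<le> C * norms vs"
    "length vs = k \<Longrightarrow> p < k \<Longrightarrow> supported_at l (vs ! p) \<Longrightarrow> norm (K vs i) \<le> C * \<Gamma> (i - l) * norms vs"
  using assms unfolding decay_bound_def by blast+

lemma decay_boundI:
  fixes K :: "('m::finite, 'a::real_normed_vector) linf list \<Rightarrow> ('m, 'b::real_normed_vector) linf"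
  assumes "0 \<le> C" "\<And>vs. length vs = k \<Longrightarrow> norm (K vs) \<le> C * norms vs"
    "\<And>vs p l i. length vs = k \<Longrightarrow> p < k \<Longrightarrow> supported_at l (vs ! p) \<Longrightarrow>
      norm (K vs i) \<le> C * \<Gamma> (i - l) * norms vs"
  shows "decay_bound \<Gamma> k K C"
  using assms unfolding decay_bound_def by blast

lemma multilinearD: "multilinear k K \<Longrightarrow> length vs = k \<Longrightarrow> i < k \<Longrightarrow> linear (\<lambda>v. K (vs[i := v]))"
  by (simp add: multilinear_def)

lemma multilinear_zero:
  assumes "multilinear k K" "length vs = k" "0 \<in> set vs"
  shows "K vs = 0"
proof -
  obtain i where i: "i < k" "vs ! i = 0" using assms by (auto simp: in_set_conv_nth)
  then have "K (vs[i := 0]) = 0"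
    using linear_0[OF multilinearD[OF assms(1,2), of i]] by simp
  then show ?thesis using i by (metis list_update_id)
qed

text \<open>The factor may depend on the vector, which allows each argument to be normalized by its
  own length. The induction is on the number of entries already scaled.\<close>

lemma multilinear_scale:
  assumes K: "multilinear k K" and vs: "length vs = k"
  shows "K (map (\<lambda>v. f v *\<^sub>R v) vs) = prod_list (map f vs) *\<^sub>R K vs"
proof -
  let ?g = "\<lambda>v. f v *\<^sub>R v"
  have "K (map ?g (take p vs) @ drop p vs) = prod_list (map f (take p vs)) *\<^sub>R K vs" if "p \<le> k" for p
    using that
  proof (induction p)
    case (Suc p)
    let ?X = "map ?g (take p vs) @ drop p vs"
    have p: "p < length vs" using Suc vs by simp
    have len: "length ?X = k" using p vs by simp
    have dr: "drop p vs = vs ! p # drop (Suc p) vs" using p by (rule Cons_nth_drop_Suc[symmetric])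
    have "map ?g (take (Suc p) vs) @ drop (Suc p) vs = ?X[p := f (vs ! p) *\<^sub>R vs ! p]"
      using p by (simp add: take_Suc_conv_app_nth list_update_append dr)
    also have "K \<dots> = f (vs ! p) *\<^sub>R K (?X[p := vs ! p])"
      using p vs by (intro linear_scale[OF multilinearD[OF K len]]) simp
    also have "?X[p := vs ! p] = ?X"
      using p by (simp add: list_update_append dr)
    finally show ?case using Suc p by (simp add: take_Suc_conv_app_nth)
  qed simp
  from this[of k] show ?thesis using vs by simp
qed

lemma multilinear_compose_linear:
  assumes "linear \<psi>" "multilinear k K"
  shows "multilinear k (\<lambda>vs. \<psi> (K vs))"
  using assms linear_compose[of _ \<psi>] by (auto simp: multilinear_def o_def)

lemma decay_multilinear_postcompose:
  fixes \<phi> :: "('m::finite, 'b::real_normed_vector) linf \<Rightarrow> ('m, 'c::real_normed_vector) linf"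
    and K :: "('m, 'a::real_normed_vector) linf list \<Rightarrow> ('m, 'b) linf"
  assumes \<Gamma>: "decay_function \<Gamma>" and \<phi>: "linear \<phi>" and M: "0 \<le> M" "\<And>u. norm (\<phi> u) \<le> M * norm u"
    and MG: "\<And>k w i. supported_at k w \<Longrightarrow> norm (\<phi> w i) \<le> M * \<Gamma> (i - k) * norm w"
    and K: "decay_bound \<Gamma> k K C"
  shows "decay_bound \<Gamma> k (\<lambda>vs. \<phi> (K vs)) (M * C)"
proof (rule decay_boundI)
  note KD = decay_boundD[OF K]
  show "0 \<le> M * C" using M KD by simp
  fix vs :: "('m, 'a) linf list" assume vs: "length vs = k"
  show "norm (\<phi> (K vs)) \<le> M * C * norms vs"
    using order_trans[OF M(2) mult_left_mono[OF KD(2)[OF vs] M(1)]] by (simp add: mult_ac)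
  fix p l i assume p: "p < k" "supported_at l (vs ! p)"
  have "norm (\<phi> (K vs) i) \<le> M * (C * norms vs) * \<Gamma> (i - l)"
    using KD(1) KD(3)[OF vs p] norms_nonneg[of vs]
    by (intro decay_apply[OF \<Gamma> \<phi> M MG]) (auto simp: mult_ac)
  then show "norm (\<phi> (K vs) i) \<le> M * C * \<Gamma> (i - l) * norms vs" by (simp add: mult_ac)
qed

section \<open>Composition in one argument\<close>

text \<open>Partial composition of multilinear maps, as in an operad: \<open>B\<close> consumes the
  block of \<open>j\<close> arguments that begins at position \<open>p\<close>.\<close>

definition slot :: "nat \<Rightarrow> nat \<Rightarrow> ('b list \<Rightarrow> 'c) \<Rightarrow> ('b list \<Rightarrow> 'b) \<Rightarrow> 'b list \<Rightarrow> 'c" where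
  "slot p j G B vs = G (take p vs @ B (take j (drop p vs)) # drop (p + j) vs)"

text \<open>Position \<open>q\<close> lies before, inside or after the block. After it, the block of
  length \<open>j\<close> counts as one argument, which shifts the index to
  \<open>Suc q - j\<close>.\<close>

lemma slot_update:
  fixes B :: "'b list \<Rightarrow> 'b" and vs :: "'b list"
  assumes vs: "length vs = k + j" and p: "p \<le> k" and q: "q < k + j"
  shows "slot p j G B (vs[q := v]) =
    (let ws = take p vs @ B (take j (drop p vs)) # drop (p + j) vs in
     if q < p then G (ws[q := v])
     else if q < p + j then G (ws[p := B ((take j (drop p vs))[q - p := v])])
     else G (ws[Suc q - j := v]))"
proof -
  consider "q < p" | "p \<le> q" "q < p + j" | "p + j \<le> q" by linarith
  then show ?thesis
  proof cases
    case 1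
    then show ?thesis
      using assms by (simp add: slot_def take_update_swap list_update_append)
  next
    case 2
    have "take j (drop p (vs[q := v])) = (take j (drop p vs))[q - p := v]"
      using 2 by (simp add: drop_update_swap take_update_swap)
    then show ?thesis
      using assms 2 by (simp add: slot_def list_update_append)
  next
    case 3
    have "take j (drop p (vs[q := v])) = take j (drop p vs)"
      using 3 by (simp add: drop_update_swap)
    moreover have "drop (p + j) (vs[q := v]) = (drop (p + j) vs)[q - (p + j) := v]"
      using 3 by (simp add: drop_update_swap)
    moreover have "Suc q - j - p = Suc (q - (p + j))" using 3 by simp
    moreover have "\<not> Suc q - j < p" "\<not> q < p" "\<not> q < p + j" using 3 by auto
    ultimately show ?thesis
      using assms by (simp add: slot_def list_update_append)
  qed
qed

text \<open>A localized argument inside the block makes the value of \<open>B\<close> decay away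
  from \<open>l\<close>, and \<open>decay_apply\<close> convolves this with the decay of
  \<open>G\<close> in position \<open>p\<close>. A localized argument outside the block is already
  an argument of \<open>G\<close>.\<close>

lemma decay_bound_slot:
  fixes G :: "('m::finite, 'a::real_normed_vector) linf list \<Rightarrow> ('m, 'b::real_normed_vector) linf"
  assumes \<Gamma>: "decay_function \<Gamma>" and G: "multilinear (Suc k) G" "decay_bound \<Gamma> (Suc k) G C"
    and B: "decay_bound \<Gamma> j B C'" and p: "p \<le> k"
  shows "decay_bound \<Gamma> (k + j) (slot p j G B) (C * C')"
proof (rule decay_boundI)
  note GD = decay_boundD[OF G(2)] and BD = decay_boundD[OF B]
  show "0 \<le> C * C'" using GD(1) BD(1) by simp
  fix vs :: "('m, 'a) linf list" assume vs: "length vs = k + j"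
  let ?u = "take p vs" and ?w = "take j (drop p vs)" and ?v = "drop (p + j) vs"
  let ?ws = "?u @ B ?w # ?v"
  have len: "length ?w = j" "length ?ws = Suc k" using vs p by auto
  have ns: "norms vs = norms ?u * (norms ?w * norms ?v)" by (rule norms_split)
  have "norms ?ws = norms ?u * norms ?v * norm (B ?w)" by simp
  also have "\<dots> \<le> norms ?u * norms ?v * (C' * norms ?w)"
    using BD(2)[OF len(1)] norms_nonneg by (intro mult_left_mono mult_nonneg_nonneg) auto
  finally have nws: "norms ?ws \<le> C' * norms vs" by (simp add: ns mult_ac)
  show "norm (slot p j G B vs) \<le> C * C' * norms vs"
    using order_trans[OF GD(2)[OF len(2)] mult_left_mono[OF nws GD(1)]]
    by (simp add: slot_def mult_ac)
  fix q l i assume q: "q < k + j" "supported_at l (vs ! q)"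
  have \<Gamma>0: "0 \<le> C * \<Gamma> (i - l)" using GD(1) decay_functionD(1)[OF \<Gamma>, of "i - l"] by simp
  show "norm (slot p j G B vs i) \<le> C * C' * \<Gamma> (i - l) * norms vs"
  proof (cases "p \<le> q \<and> q < p + j")
    case False
    define q' where "q' = (if q < p then q else Suc q - j)"
    have "q' < Suc k" using q p by (auto simp: q'_def)
    have "?ws ! q' = vs ! q"
      using False q vs p by (auto simp: q'_def nth_append nth_Cons' Suc_diff_le)
    with q \<open>q' < Suc k\<close> have "norm (G ?ws i) \<le> C * \<Gamma> (i - l) * norms ?ws"
      by (intro GD(3)[OF len(2)]) auto
    also have "\<dots> \<le> C * \<Gamma> (i - l) * (C' * norms vs)"
      using nws \<Gamma>0 by (rule mult_left_mono)
    finally show ?thesis by (simp add: slot_def mult_ac)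
  next
    case True
    let ?\<phi> = "\<lambda>v. G (?ws[p := v])"
    let ?M = "C * (norms ?u * norms ?v)"
    have upd: "norms (?ws[p := v]) = norms ?u * norms ?v * norm v" for v
      using vs p by (simp add: list_update_append)
    have "norm (?\<phi> (B ?w) i) \<le> ?M * (C' * norms ?w) * \<Gamma> (i - l)"
    proof (rule decay_apply[OF \<Gamma>, where \<phi> = ?\<phi> and u = "B ?w" and M = ?M])
      show "linear ?\<phi>" using G(1) len(2) p by (intro multilinearD) auto
      show "0 \<le> ?M" using GD(1) norms_nonneg by (intro mult_nonneg_nonneg) auto
      show "norm (?\<phi> v) \<le> ?M * norm v" for v
        using GD(2)[of "?ws[p := v]"] len(2) unfolding upd by (simp add: mult_ac)
      show "norm (?\<phi> v i') \<le> ?M * \<Gamma> (i' - k') * norm v" if "supported_at k' v" for k' v i'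
        using GD(3)[of "?ws[p := v]" p k' i'] len p that unfolding upd by (simp add: mult_ac)
      show "0 \<le> C' * norms ?w" using BD(1) norms_nonneg by (intro mult_nonneg_nonneg) auto
      show "norm (B ?w k') \<le> C' * norms ?w * \<Gamma> (k' - l)" for k'
      proof -
        have "q - p < j" using True by linarith
        then show ?thesis
          using BD(3)[OF len(1), of "q - p" l k'] q True vs by (simp add: mult_ac)
      qed
    qed
    moreover have "?ws[p := B ?w] = ?ws" using vs p by (simp add: list_update_append)
    ultimately show ?thesis by (simp add: slot_def ns mult_ac)
  qed
qed

lemma multilinear_slot:
  assumes G: "multilinear (Suc k) G" and B: "multilinear j B" and p: "p \<le> k"
  shows "multilinear (k + j) (slot p j G B)"
  unfolding multilinear_def
proof (intro allI impI)
  fix vs :: "'a list" and q assume vs: "length vs = k + j" and q: "q < k + j"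
  let ?ws = "take p vs @ B (take j (drop p vs)) # drop (p + j) vs"
  have len: "length ?ws = Suc k" using vs p by simp
  consider "q < p" | "p \<le> q" "q < p + j" | "p + j \<le> q" by linarith
  then show "linear (\<lambda>v. slot p j G B (vs[q := v]))"
  proof cases
    case 1
    then show ?thesis
      using multilinearD[OF G len, of q] p by (simp add: slot_update[OF vs p q] Let_def)
  next
    case 2
    have "linear ((\<lambda>v. G (?ws[p := v])) \<circ> (\<lambda>v. B ((take j (drop p vs))[q - p := v])))"
      using vs p 2 by (intro linear_compose multilinearD[OF G len] multilinearD[OF B]) auto
    then show ?thesis
      using 2 by (simp add: slot_update[OF vs p q] Let_def o_def)
  next
    case 3
    then show ?thesis
      using multilinearD[OF G len, of "Suc q - j"] q by (simp add: slot_update[OF vs p q] Let_def)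
  qed
qed

lemma decay_multilinear_slot:
  assumes "decay_function \<Gamma>" "decay_multilinear \<Gamma> (Suc k) G" "decay_multilinear \<Gamma> j B" "p \<le> k"
  shows "decay_multilinear \<Gamma> (k + j) (slot p j G B)"
  using assms decay_bound_slot multilinear_slot unfolding decay_multilinear_def by metis

section \<open>Comparison with the norms of the definitions\<close>

lemma ereal_less_inftyE:
  assumes "(x :: ereal) < \<infinity>"
  obtains M where "0 \<le> M" "x \<le> ereal M"
proof (cases x)
  case (real r)
  then show ?thesis using that[of "max 0 r"] by simp
qed (use that[of 0] assms in auto)

text \<open>Suprema over unit balls of \<open>N\<close> are compared with homogeneous bounds for the
  norm of the type. Scaling by \<open>1 / (C1 * norm v)\<close> brings an argument into the unit
  ball; lists with a zero entry cannot be scaled and are covered by \<open>multilinear_zero\<close>.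
  \<open>c0\<close> and \<open>C0\<close> compare the norms at one site, \<open>c1\<close> and
  \<open>C1\<close> the supremum norms.\<close>

lemma mlin_decay_norm_finite_iff:
  fixes A :: "('m::finite, 'v::euclidean_space) linf list \<Rightarrow> ('m, 'v) linf"
  assumes N: "is_norm N" and \<Gamma>: "decay_function \<Gamma>" and A: "multilinear k A"
  shows "mlin_decay_norm N \<Gamma> k A < \<infinity> \<longleftrightarrow> (\<exists>C. decay_bound \<Gamma> k A C)"
proof
  obtain c0 C0 where c0: "0 < c0" "0 < C0" "\<And>x. c0 * norm x \<le> N x" "\<And>x. N x \<le> C0 * norm x"
    using is_norm_equiv[OF N] by metis
  obtain c1 C1 where c1: "0 < c1" "0 < C1" "\<And>x :: ('m, 'v) linf. c1 * norm x \<le> linf_norm N x"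
    "\<And>x :: ('m, 'v) linf. linf_norm N x \<le> C1 * norm x"
    using linf_norm_equiv[OF N] by metis
  note \<Gamma>0 = decay_functionD(1)[OF \<Gamma>]
  {
    assume "mlin_decay_norm N \<Gamma> k A < \<infinity>"
    then obtain M where M: "0 \<le> M" "mlin_decay_norm N \<Gamma> k A \<le> ereal M"
      by (rule ereal_less_inftyE)
    have M1: "linf_norm N (A vs) \<le> M" if "length vs = k" "\<forall>v\<in>set vs. linf_norm N v \<le> 1" for vs
    proof -
      have "ereal (linf_norm N (A vs)) \<le> mlin_norm N k A"
        unfolding mlin_norm_def using that by (intro SUP_upper) auto
      also have "\<dots> \<le> mlin_decay_norm N \<Gamma> k A" by (simp add: mlin_decay_norm_def)
      also have "\<dots> \<le> ereal M" by (rule M)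
      finally show ?thesis by simp
    qed
    have M2: "N (A vs i) \<le> M * \<Gamma> (i - l)"
      if vs: "length vs = k" "\<forall>v\<in>set vs. linf_norm N v \<le> 1" and p: "p < k" "supported_at l (vs ! p)"
      for vs i l p
    proof -
      let ?vs = "take p vs @ drop (Suc p) vs"
      \<comment> \<open>Position \<open>p\<close> is removed and put back, to match the way
        \<open>mlin_gamma\<close> inserts the localized argument.\<close>
      have eq: "take p ?vs @ vs ! p # drop p ?vs = vs"
        using p vs by (simp add: id_take_nth_drop[symmetric])
      have mem: "(?vs, vs ! p) \<in> {(vs, w). length vs = k - 1 \<and> (\<forall>v\<in>set vs. linf_norm N v \<le> 1)
          \<and> linf_norm N w \<le> 1 \<and> supported_at l w}"
        using vs p by (auto dest: in_set_takeD in_set_dropD)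
      have "ereal (N (A vs i) * inverse (\<Gamma> (i - l))) \<le> mlin_gamma N \<Gamma> k A"
        unfolding mlin_gamma_def
        by (rule SUP_upper2[of p], use p in simp, rule SUP_upper2[of i UNIV], simp,
            rule SUP_upper2[of l UNIV], simp, rule SUP_upper2[OF mem], simp only: eq prod.case order_refl)
      also have "\<dots> \<le> mlin_decay_norm N \<Gamma> k A" by (simp add: mlin_decay_norm_def)
      also have "\<dots> \<le> ereal M" by (rule M)
      finally have "N (A vs i) * inverse (\<Gamma> (i - l)) \<le> M" by simp
      then show ?thesis using \<Gamma>0[of "i - l"] by (simp add: field_simps)
    qed
    \<comment> \<open>\<open>M / c0\<close> is for the decay, measured at one site,
      \<open>M / c1\<close> for the supremum norm, and \<open>C1 ^ k\<close> undoes the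
      scaling.\<close>
    define C where "C = (M / c0 + M / c1) * C1 ^ k"
    have C0: "0 \<le> M / c0" "0 \<le> M / c1" using M(1) c0 c1 by auto
    have scaled: "C1 ^ k * norms vs > 0 \<and>
        A vs = (C1 ^ k * norms vs) *\<^sub>R A (map (\<lambda>v. (1 / (C1 * norm v)) *\<^sub>R v) vs) \<and>
        (\<forall>v\<in>set (map (\<lambda>v. (1 / (C1 * norm v)) *\<^sub>R v) vs). linf_norm N v \<le> 1)"
      if vs: "length vs = k" "0 \<notin> set vs" for vs
    proof -
      have n0: "norms vs > 0"
        using vs(2) by (induction vs) auto
      have "prod_list (map (\<lambda>v. 1 / (C1 * norm v)) vs) = 1 / (C1 ^ length vs * norms vs)"
        by (induction vs) auto
      moreover have "linf_norm N ((1 / (C1 * norm v)) *\<^sub>R v) \<le> 1" if "v \<in> set vs" for v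
      proof -
        have "v \<noteq> 0" using that vs by auto
        then show ?thesis
          using c1(4)[of "(1 / (C1 * norm v)) *\<^sub>R v"] c1(2) by simp
      qed
      ultimately show ?thesis
        using n0 c1(2) vs(1) by (simp add: multilinear_scale[OF A vs(1)])
    qed
    have "decay_bound \<Gamma> k A C"
    proof (rule decay_boundI)
      show "0 \<le> C" using C0 c1 by (simp add: C_def)
      fix vs :: "('m, 'v) linf list" assume vs: "length vs = k"
      let ?ws = "map (\<lambda>v. (1 / (C1 * norm v)) *\<^sub>R v) vs"
      let ?s = "C1 ^ k * norms vs"
      show "norm (A vs) \<le> C * norms vs"
      proof (cases "0 \<in> set vs")
        case False
        have s: "?s > 0" "A vs = ?s *\<^sub>R A ?ws" "\<forall>v\<in>set ?ws. linf_norm N v \<le> 1"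
          using scaled[OF vs False] by blast+
        have "c1 * norm (A ?ws) \<le> M"
          using order_trans[OF c1(3) M1[OF _ s(3)]] vs by simp
        then have "norm (A ?ws) \<le> M / c1"
          using c1(1) by (simp add: field_simps)
        then have "norm (A ?ws) \<le> M / c0 + M / c1"
          using C0 by linarith
        then have "?s * norm (A ?ws) \<le> ?s * (M / c0 + M / c1)"
          using s(1) by (intro mult_left_mono) auto
        moreover have "norm (A vs) = ?s * norm (A ?ws)"
          using arg_cong[OF s(2), of norm] by (simp only: norm_scaleR abs_of_pos[OF s(1)])
        ultimately show ?thesis by (simp add: C_def mult_ac)
      qed (use multilinear_zero[OF A vs] \<open>0 \<le> C\<close> norms_nonneg[of vs] in auto)
      fix p l i assume p: "p < k" "supported_at l (vs ! p)"
      show "norm (A vs i) \<le> C * \<Gamma> (i - l) * norms vs"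
      proof (cases "0 \<in> set vs")
        case False
        have s: "?s > 0" "A vs = ?s *\<^sub>R A ?ws" "\<forall>v\<in>set ?ws. linf_norm N v \<le> 1"
          using scaled[OF vs False] by blast+
        have "supported_at l (?ws ! p)"
          using p vs by (auto simp: supported_at_def)
        then have "c0 * norm (A ?ws i) \<le> M * \<Gamma> (i - l)"
          using order_trans[OF c0(3) M2[OF _ s(3) p(1)]] vs by simp
        then have "norm (A ?ws i) \<le> M / c0 * \<Gamma> (i - l)"
          using c0(1) by (simp add: field_simps)
        also have "\<dots> \<le> (M / c0 + M / c1) * \<Gamma> (i - l)"
          using C0 \<Gamma>0[of "i - l"] by (intro mult_right_mono) auto
        finally have "?s * norm (A ?ws i) \<le> ?s * ((M / c0 + M / c1) * \<Gamma> (i - l))"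
          using s(1) by (intro mult_left_mono) auto
        moreover have "norm (A vs i) = ?s * norm (A ?ws i)"
          using arg_cong[OF s(2), of "\<lambda>x. norm (x i)"]
          by (simp only: norm_scaleR abs_of_pos[OF s(1)] scaleR_bcontfun.rep_eq)
        ultimately show ?thesis by (simp add: C_def mult_ac)
      qed (use multilinear_zero[OF A vs] \<open>0 \<le> C\<close> norms_nonneg[of vs] \<Gamma>0[of "i - l"] in auto)
    qed
    then show "\<exists>C. decay_bound \<Gamma> k A C" ..
  }
  {
    assume "\<exists>C. decay_bound \<Gamma> k A C"
    then obtain C where C: "decay_bound \<Gamma> k A C" ..
    note CD = decay_boundD[OF C]
    have nv: "norms vs \<le> (1 / c1) ^ length vs" if "\<forall>v\<in>set vs. linf_norm N v \<le> 1" for vs :: "('m, 'v) linf list"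
    proof (rule norms_le)
      fix v assume "v \<in> set vs"
      then show "norm v \<le> 1 / c1" using that c1(3)[of v] c1(1) by (auto simp: field_simps intro: order_trans)
    qed
    define M where "M = (C0 + C1) * (C * (1 / c1) ^ k)"
    have M1: "mlin_norm N k A \<le> ereal M"
      unfolding mlin_norm_def
    proof (rule SUP_least, clarsimp)
      fix vs :: "('m, 'v) linf list" assume vs: "\<forall>v\<in>set vs. linf_norm N v \<le> 1" "k = length vs"
      have "linf_norm N (A vs) \<le> C1 * norm (A vs)" by (rule c1)
      also have "\<dots> \<le> (C0 + C1) * (C * norms vs)"
        using CD(1) CD(2)[of vs] c0 c1 vs by (intro mult_mono) auto
      also have "\<dots> \<le> M"
        unfolding M_def using CD(1) c0 c1 nv[OF vs(1)] vs by (intro mult_left_mono) auto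
      finally show "linf_norm N (A vs) \<le> M" .
    qed
    have M2: "mlin_gamma N \<Gamma> k A \<le> ereal M"
      unfolding mlin_gamma_def
    proof (intro SUP_least, clarsimp)
      fix p and i l :: "int ^ 'm" and vs :: "('m, 'v) linf list" and w :: "('m, 'v) linf"
      assume p: "p < k" and vs: "length vs = k - Suc 0" "\<forall>v\<in>set vs. linf_norm N v \<le> 1"
        and w: "linf_norm N w \<le> 1" "supported_at l w"
      let ?ws = "take p vs @ w # drop p vs"
      have len: "length ?ws = k" using p vs by simp
      have nth: "?ws ! p = w" using p vs by (simp add: nth_append)
      have "\<forall>v\<in>set ?ws. linf_norm N v \<le> 1" using vs w by (auto dest: in_set_takeD in_set_dropD)
      from nv[OF this] have nws: "norms ?ws \<le> (1 / c1) ^ k" unfolding len .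
      have "N (A ?ws i) \<le> C0 * norm (A ?ws i)" by (rule c0)
      also have "\<dots> \<le> (C0 + C1) * (C * \<Gamma> (i - l) * norms ?ws)"
        using CD(3)[OF len p, of l i] c0 c1 w(2) nth by (intro mult_mono) auto
      also have "\<dots> \<le> (C0 + C1) * (C * \<Gamma> (i - l) * (1 / c1) ^ k)"
        using CD(1) c0 c1 nws \<Gamma>0[of "i - l"] by (intro mult_left_mono) auto
      also have "\<dots> = M * \<Gamma> (i - l)" by (simp add: M_def mult_ac)
      finally show "N (A ?ws i) * inverse (\<Gamma> (i - l)) \<le> M"
        using \<Gamma>0[of "i - l"] by (simp add: field_simps)
    qed
    show "mlin_decay_norm N \<Gamma> k A < \<infinity>"
      by (rule le_less_trans[of _ "ereal M"]) (use M1 M2 in \<open>simp_all add: mlin_decay_norm_def\<close>)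
  }
qed

lemma Lk_decay_iff:
  assumes "is_norm N" "decay_function \<Gamma>"
  shows "A \<in> Lk_decay N \<Gamma> k \<longleftrightarrow> decay_multilinear \<Gamma> k A"
  using mlin_decay_norm_finite_iff[OF assms] by (auto simp: Lk_decay_def decay_multilinear_def)

section \<open>The complexified space of multilinear maps with decay\<close>

lemma decay_bound_mono:
  assumes \<Gamma>: "decay_function \<Gamma>" and K: "decay_bound \<Gamma> k K C" and "C \<le> C'"
  shows "decay_bound \<Gamma> k K C'"
proof (rule decay_boundI)
  note KD = decay_boundD[OF K]
  show "0 \<le> C'" using KD(1) assms by simp
  show "norm (K vs) \<le> C' * norms vs" if "length vs = k" for vs
    by (rule order_trans[OF KD(2)[OF that]]) (intro mult_right_mono assms norms_nonneg)
  show "norm (K vs i) \<le> C' * \<Gamma> (i - l) * norms vs"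
    if "length vs = k" "p < k" "supported_at l (vs ! p)" for vs p l i
    by (rule order_trans[OF KD(3)[OF that]])
      (intro mult_right_mono assms norms_nonneg less_imp_le[OF decay_functionD(1)[OF \<Gamma>]])
qed

lemma decay_bound_add:
  assumes \<Gamma>: "decay_function \<Gamma>" and K: "decay_bound \<Gamma> k K C" and L: "decay_bound \<Gamma> k L C'"
  shows "decay_bound \<Gamma> k (\<lambda>vs. K vs + L vs) (C + C')"
proof (rule decay_boundI)
  note KD = decay_boundD[OF K] and LD = decay_boundD[OF L]
  show "0 \<le> C + C'" using KD(1) LD(1) by simp
  show "norm (K vs + L vs) \<le> (C + C') * norms vs" if "length vs = k" for vs
    using norm_triangle_ineq[of "K vs" "L vs"] KD(2)[OF that] LD(2)[OF that]
    by (simp add: algebra_simps)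
  show "norm ((K vs + L vs) i) \<le> (C + C') * \<Gamma> (i - l) * norms vs"
    if "length vs = k" "p < k" "supported_at l (vs ! p)" for vs p l i
    using norm_triangle_ineq[of "K vs i" "L vs i"] KD(3)[OF that, of i] LD(3)[OF that, of i]
    by (simp add: algebra_simps)
qed

lemma decay_bound_map:
  fixes \<psi> :: "('m::finite, 'b::real_normed_vector) linf \<Rightarrow> ('m, 'c::real_normed_vector) linf"
    and K :: "('m, 'a::real_normed_vector) linf list \<Rightarrow> ('m, 'b) linf"
  assumes K: "decay_bound \<Gamma> k K C" and M: "0 \<le> M" "\<And>z i. norm (\<psi> z i) \<le> M * norm (z i)"
  shows "decay_bound \<Gamma> k (\<lambda>vs. \<psi> (K vs)) (M * C)"
proof (rule decay_boundI)
  note KD = decay_boundD[OF K]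
  show "0 \<le> M * C" using KD(1) M by simp
  have "norm (\<psi> z) \<le> M * norm z" for z
    by (rule norm_bound) (rule order_trans[OF M(2) mult_left_mono[OF norm_bounded M(1)]])
  then show "norm (\<psi> (K vs)) \<le> M * C * norms vs" if "length vs = k" for vs
    using mult_left_mono[OF KD(2)[OF that] M(1)] by (metis mult.assoc order_trans)
  show "norm (\<psi> (K vs) i) \<le> M * C * \<Gamma> (i - l) * norms vs"
    if "length vs = k" "p < k" "supported_at l (vs ! p)" for vs p l i
    using order_trans[OF M(2) mult_left_mono[OF KD(3)[OF that] M(1)]] by (simp add: mult_ac)
qed

lemma decay_bound_cong:
  assumes "decay_bound \<Gamma> k K C" "\<And>vs. length vs = k \<Longrightarrow> L vs = K vs"
  shows "decay_bound \<Gamma> k L C"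
  using assms unfolding decay_bound_def by simp

lemma multilinear_cong:
  assumes "multilinear k K" "\<And>vs. length vs = k \<Longrightarrow> L vs = K vs"
  shows "multilinear k L"
  using assms unfolding multilinear_def by simp

lemma multilinear_add:
  assumes "multilinear k K" "multilinear k L"
  shows "multilinear k (\<lambda>vs. K vs + L vs)"
  using assms unfolding multilinear_def by (auto intro: linear_compose_add)

lemma norm_vector_smult: "norm (c *s v) = cmod c * norm (v :: complex ^ 'n)"
  by (simp add: norm_vec_def norm_mult L2_set_right_distrib)

lemma cscale_simps:
  "cscale c (z + w) = cscale c z + cscale c w" "cscale c (z - w) = cscale c z - cscale c w"
  "cscale (c - d) z = cscale c z - cscale d z" "cscale c (cscale d z) = cscale (c * d) z"
  "cscale 1 z = z" "cscale c (r *\<^sub>R z) = r *\<^sub>R cscale c z" "cscale c 0 = 0" "cscale (of_real r) z = r *\<^sub>R z"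
  "cscale (c + d) z = cscale c z + cscale d z" "cscale 0 z = 0"
  "cscale (- 1) z = - z"
  by (auto intro!: bcontfun_eqI simp: apply_cscale vec_eq_iff complex_eq_iff algebra_simps)

lemma linear_cscale: "linear (cscale c)"
  by (rule linearI) (simp_all add: cscale_simps)

lemma norm_cscale_apply: "norm (cscale c z i) \<le> cmod c * norm (z i)"
  by (simp add: apply_cscale norm_vector_smult)

lemma geometric_tail:
  fixes f :: "nat \<Rightarrow> 'a::banach"
  assumes "\<And>n. norm (f n) \<le> B * t ^ n" "0 \<le> t" "t < 1"
  shows "summable f" "norm (suminf f - (\<Sum>i<n. f i)) \<le> B * t ^ n / (1 - t)"
proof -
  have g: "summable (\<lambda>i. t ^ i)" using assms by (intro summable_geometric) auto
  show s: "summable f"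
    by (rule summable_comparison_test'[OF summable_mult[OF g, of B], of 0]) (use assms in auto)
  have "norm (\<Sum>i. f (i + n)) \<le> (\<Sum>i. B * t ^ n * t ^ i)"
  proof (rule norm_suminf_le)
    show "norm (f (i + n)) \<le> B * t ^ n * t ^ i" for i
      using assms(1)[of "i + n"] by (simp add: power_add mult_ac)
  qed (rule summable_mult[OF g])
  also have "\<dots> = B * t ^ n / (1 - t)"
    using assms by (simp add: suminf_mult[OF g] suminf_geometric)
  finally show "norm (suminf f - (\<Sum>i<n. f i)) \<le> B * t ^ n / (1 - t)"
    by (simp add: suminf_minus_initial_segment[OF s])
qed

text \<open>The norm that makes the maps with decay a Banach space. The default \<open>0\<close>
  keeps it nonnegative without conditions.\<close>

definition least_bound :: "(int ^ 'm::finite \<Rightarrow> real) \<Rightarrow> nat \<Rightarrow>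
  (('m, 'a::real_normed_vector) linf list \<Rightarrow> ('m, 'b::real_normed_vector) linf) \<Rightarrow> real" where
  "least_bound \<Gamma> k K = (if \<exists>C. decay_bound \<Gamma> k K C then Inf {C. decay_bound \<Gamma> k K C} else 0)"

lemma least_bound_le: "decay_bound \<Gamma> k K C \<Longrightarrow> least_bound \<Gamma> k K \<le> C"
  unfolding least_bound_def by (auto intro!: cInf_lower bdd_belowI[of _ 0] dest: decay_boundD(1))

lemma least_bound_nonneg: "0 \<le> least_bound \<Gamma> k K"
  unfolding least_bound_def by (auto intro!: cInf_greatest dest: decay_boundD(1))

lemma le_Inf_mult:
  fixes S :: "real set"
  assumes "S \<noteq> {}" "\<And>C. C \<in> S \<Longrightarrow> y \<le> C * P" "0 \<le> P"
  shows "y \<le> Inf S * P"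
proof (cases "P = 0")
  case False
  with assms have "y / P \<le> Inf S"
    by (intro cInf_greatest) (auto simp: pos_divide_le_eq)
  with False assms show ?thesis by (simp add: pos_divide_le_eq)
qed (use assms in auto)

text \<open>The infimum is attained, because every inequality in \<open>decay_bound\<close> is
  closed in the constant.\<close>

lemma least_bound:
  assumes \<Gamma>: "decay_function \<Gamma>" and ex: "\<exists>C. decay_bound \<Gamma> k K C"
  shows "decay_bound \<Gamma> k K (least_bound \<Gamma> k K)"
proof (rule decay_boundI[OF least_bound_nonneg])
  let ?S = "{C. decay_bound \<Gamma> k K C}"
  have eq: "least_bound \<Gamma> k K = Inf ?S" and ne: "?S \<noteq> {}" using ex by (auto simp: least_bound_def)
  show "norm (K vs) \<le> least_bound \<Gamma> k K * norms vs" if "length vs = k" for vs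
    unfolding eq using ne decay_boundD(2)[OF _ that] by (intro le_Inf_mult norms_nonneg) auto
  show "norm (K vs i) \<le> least_bound \<Gamma> k K * \<Gamma> (i - l) * norms vs"
    if "length vs = k" "p < k" "supported_at l (vs ! p)" for vs p l i
    unfolding eq mult.assoc
    using ne decay_boundD(3)[OF _ that] norms_nonneg[of vs] less_imp_le[OF decay_functionD(1)[OF \<Gamma>]]
    by (intro le_Inf_mult mult_nonneg_nonneg) (auto simp: mult.assoc)
qed

text \<open>Only maps vanishing on lists of the wrong length are kept, so that \<^const>\<open>least_bound\<close> is definite.\<close>

definition decay_maps :: "(int ^ 'm::finite \<Rightarrow> real) \<Rightarrow> nat \<Rightarrow>
  (('m, 'a::real_normed_vector) linf list \<Rightarrow> ('m, 'b::real_normed_vector) linf) set" where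
  "decay_maps \<Gamma> k = {K. decay_multilinear \<Gamma> k K \<and> (\<forall>vs. length vs \<noteq> k \<longrightarrow> K vs = 0)}"

lemma decay_maps_bound:
  "decay_function \<Gamma> \<Longrightarrow> K \<in> decay_maps \<Gamma> k \<Longrightarrow> decay_bound \<Gamma> k K (least_bound \<Gamma> k K)"
  by (rule least_bound) (auto simp: decay_maps_def decay_multilinear_def)

lemma decay_mapsI:
  "multilinear k K \<Longrightarrow> decay_bound \<Gamma> k K C \<Longrightarrow> (\<And>vs. length vs \<noteq> k \<Longrightarrow> K vs = 0) \<Longrightarrow>
    K \<in> decay_maps \<Gamma> k"
  by (auto simp: decay_maps_def decay_multilinear_def)

lemma decay_mapsD:
  assumes "K \<in> decay_maps \<Gamma> k"
  shows "multilinear k K" "\<And>vs. length vs \<noteq> k \<Longrightarrow> K vs = 0"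
  using assms by (auto simp: decay_maps_def decay_multilinear_def)

lemma sum_fun_apply: "sum f S x = (\<Sum>i\<in>S. f i x)" for f :: "'k \<Rightarrow> 'a \<Rightarrow> 'b::ab_group_add"
  by (induction S rule: infinite_finite_induct) auto

text \<open>The series is summed at each lattice site, where values lie in a Banach space. One
  geometric tail estimate, uniform in the site, controls the norm; the same estimate with weight
  \<open>\<Gamma> (j - l)\<close> controls the decay. The tail after zero terms is the bound for the
  limit itself.\<close>

lemma decay_maps_complete:
  fixes f :: "nat \<Rightarrow> ('m::finite, 'a::real_normed_vector) linf list \<Rightarrow> ('m, 'b::banach) linf"
  assumes \<Gamma>: "decay_function \<Gamma>" and f: "\<And>n. f n \<in> decay_maps \<Gamma> k"
    and le: "\<And>n. least_bound \<Gamma> k (f n) \<le> C * t ^ n" and t: "0 \<le> t" "t < 1"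
  shows "\<exists>s\<in>decay_maps \<Gamma> k. (\<lambda>n. least_bound \<Gamma> k (s - (\<Sum>i<n. f i))) \<longlonglongrightarrow> 0"
proof -
  have b: "decay_bound \<Gamma> k (f n) (C * t ^ n)" for n
    by (rule decay_bound_mono[OF \<Gamma> decay_maps_bound[OF \<Gamma> f] le])
  have C: "0 \<le> C" using decay_boundD(1)[OF b[of 0]] by simp
  note D = decay_mapsD[OF f]
  have bn: "norm (f n vs j) \<le> C * norms vs * t ^ n" if "length vs = k" for n vs j
    using order_trans[OF norm_bounded decay_boundD(2)[OF b that]] by (simp add: mult_ac)
  have tl: "summable (\<lambda>n. f n vs j)"
    "norm ((\<Sum>n. f n vs j) - (\<Sum>i<n. f i vs j)) \<le> C * norms vs * t ^ n / (1 - t)"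
    if "length vs = k" for n vs j
    using geometric_tail[where f = "\<lambda>n. f n vs j", OF bn[OF that] t] by blast+
  define s where "s vs = Bcontfun (\<lambda>j. \<Sum>n. f n vs j)" for vs
  have s: "s vs j = (\<Sum>n. f n vs j)" for vs j
  proof -
    have "\<exists>B. \<forall>j. norm (\<Sum>n. f n vs j) \<le> B"
    proof (cases "length vs = k")
      case True
      have "norm (\<Sum>n. f n vs j) \<le> C * norms vs / (1 - t)" for j
        using tl(2)[OF True, of j 0] by simp
      then show ?thesis by blast
    qed (auto simp: D(2))
    then show ?thesis
      unfolding s_def by (subst apply_Bcontfun_lattice) (auto simp: bounded_iff)
  qed
  have tail: "decay_bound \<Gamma> k (s - (\<Sum>i<n. f i)) (C * t ^ n / (1 - t))" for n
  proof (rule decay_boundI)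
    show "0 \<le> C * t ^ n / (1 - t)" using C t by simp
    show "norm ((s - (\<Sum>i<n. f i)) vs) \<le> C * t ^ n / (1 - t) * norms vs" if "length vs = k" for vs
      by (rule norm_bound)
        (use tl(2)[OF that] in \<open>simp add: s sum_fun_apply apply_sum_linf mult_ac\<close>)
    show "norm ((s - (\<Sum>i<n. f i)) vs j) \<le> C * t ^ n / (1 - t) * \<Gamma> (j - l) * norms vs"
      if "length vs = k" "p < k" "supported_at l (vs ! p)" for vs p l j
    proof -
      have "norm (f n vs j) \<le> C * \<Gamma> (j - l) * norms vs * t ^ n" for n
        using decay_boundD(3)[OF b that, of n j] by (simp add: mult_ac)
      from geometric_tail(2)[OF this t, of n] show ?thesis
        by (simp add: s sum_fun_apply apply_sum_linf mult_ac)
    qed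
  qed
  have "multilinear k s"
    unfolding multilinear_def
  proof (intro allI impI)
    fix vs :: "('m, 'a) linf list" and i assume vs: "length vs = k" and i: "i < k"
    note lin = multilinearD[OF D(1) vs i]
    have sm: "summable (\<lambda>n. f n (vs[i := v]) j)" for v j using vs by (intro tl(1)) simp
    show "linear (\<lambda>v. s (vs[i := v]))"
      by (rule linearI; rule bcontfun_eqI)
        (simp_all add: s linear_add[OF lin] linear_scale[OF lin] suminf_add[OF sm sm]
          suminf_scaleR_right[OF sm])
  qed
  moreover have "decay_bound \<Gamma> k s (C / (1 - t))"
    using tail[of 0] by simp
  ultimately have "s \<in> decay_maps \<Gamma> k"
    by (rule decay_mapsI) (auto intro!: bcontfun_eqI simp: s D(2))
  moreover have "(\<lambda>n. least_bound \<Gamma> k (s - (\<Sum>i<n. f i))) \<longlonglongrightarrow> 0"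
  proof (rule tendsto_sandwich[OF _ _ tendsto_const])
    show "(\<lambda>n. C * t ^ n / (1 - t)) \<longlonglongrightarrow> 0"
      using tendsto_mult_right[OF LIMSEQ_power_zero, of t "C / (1 - t)"] t by (simp add: mult_ac)
  qed (simp_all add: least_bound_nonneg least_bound_le tail)
  ultimately show ?thesis by blast
qed

definition map_scale :: "complex \<Rightarrow> ('a list \<Rightarrow> ('m::finite, complex ^ 'n) linf) \<Rightarrow>
    'a list \<Rightarrow> ('m, complex ^ 'n) linf" where
  "map_scale c K vs = cscale c (K vs)"

lemma map_scale_bound:
  "decay_bound \<Gamma> k K C \<Longrightarrow> decay_bound \<Gamma> k (map_scale c K) (cmod c * C)"
  unfolding map_scale_def by (rule decay_bound_map) (auto intro: norm_cscale_apply)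

lemma map_scale_decay_maps:
  assumes "decay_function \<Gamma>" "K \<in> decay_maps \<Gamma> k"
  shows "map_scale c K \<in> decay_maps \<Gamma> k"
  using map_scale_bound[OF decay_maps_bound[OF assms], of c] decay_mapsD[OF assms(2)]
  by (intro decay_mapsI)
    (auto simp: map_scale_def[abs_def] cscale_simps intro: multilinear_compose_linear[OF linear_cscale])

lemma add_decay_maps:
  fixes K L :: "('m::finite, 'a::real_normed_vector) linf list \<Rightarrow> ('m, 'b::real_normed_vector) linf"
  assumes \<Gamma>: "decay_function \<Gamma>" and KL: "K \<in> decay_maps \<Gamma> k" "L \<in> decay_maps \<Gamma> k"
  shows "K + L \<in> decay_maps \<Gamma> k"
  using decay_bound_add[OF \<Gamma> decay_maps_bound[OF \<Gamma> KL(1)] decay_maps_bound[OF \<Gamma> KL(2)]]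
    multilinear_add[OF decay_mapsD(1)[OF KL(1)] decay_mapsD(1)[OF KL(2)]]
    decay_mapsD(2)[OF KL(1)] decay_mapsD(2)[OF KL(2)]
  by (intro decay_mapsI) (auto simp: plus_fun_def)

text \<open>The complex structure comes from the values alone. The arguments will be real families,
  so complex multilinearity does not enter.\<close>

lemma complex_banach_decay_maps:
  fixes \<Gamma> :: "int ^ 'm::finite \<Rightarrow> real"
  assumes \<Gamma>: "decay_function \<Gamma>"
  shows "complex_banach (decay_maps \<Gamma> k :: (('m, 'a::real_normed_vector) linf list \<Rightarrow> ('m, complex ^ 'n) linf) set)
    map_scale (least_bound \<Gamma> k)"
proof
  note bnd = decay_maps_bound[OF \<Gamma>]
  let ?E = "decay_maps \<Gamma> k :: (('m, 'a) linf list \<Rightarrow> ('m, complex ^ 'n) linf) set"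
  show "0 \<in> ?E"
    by (rule decay_mapsI[where C = 0])
      (auto simp: multilinear_def zero_fun_def decay_bound_def intro: linear_zero)
  fix K L :: "('m, 'a) linf list \<Rightarrow> ('m, complex ^ 'n) linf" and c d :: complex
  assume K: "K \<in> ?E"
  show "map_scale c K \<in> ?E" by (rule map_scale_decay_maps[OF \<Gamma> K])
  show "least_bound \<Gamma> k (map_scale c K) \<le> cmod c * least_bound \<Gamma> k K"
    by (rule least_bound_le[OF map_scale_bound[OF bnd[OF K]]])
  show "map_scale (c - d) K = map_scale c K - map_scale d K"
    "map_scale c (map_scale d K) = map_scale (c * d) K" "map_scale 1 K = K"
    by (auto simp: fun_eq_iff map_scale_def cscale_simps)
  show "K = 0" if "least_bound \<Gamma> k K = 0"
  proof
    fix vs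
    show "K vs = 0 vs"
      using decay_boundD(2)[OF bnd[OF K], of vs] decay_mapsD(2)[OF K, of vs] that
      by (cases "length vs = k") auto
  qed
  assume L: "L \<in> ?E"
  show "least_bound \<Gamma> k (K + L) \<le> least_bound \<Gamma> k K + least_bound \<Gamma> k L"
    using decay_bound_add[OF \<Gamma> bnd[OF K] bnd[OF L]] by (intro least_bound_le) (simp add: plus_fun_def)
  have "K - L = K + map_scale (- 1) L"
    by (auto simp: fun_eq_iff map_scale_def cscale_simps)
  then show "K - L \<in> ?E"
    using add_decay_maps[OF \<Gamma> K map_scale_decay_maps[OF \<Gamma> L]] by metis
  show "map_scale c (K - L) = map_scale c K - map_scale c L"
    by (auto simp: fun_eq_iff map_scale_def cscale_simps)
next
  show "0 \<le> least_bound \<Gamma> k K" for K by (rule least_bound_nonneg)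
next
  fix f :: "nat \<Rightarrow> ('m, 'a) linf list \<Rightarrow> ('m, complex ^ 'n) linf" and C t :: real
  assume "\<And>n. f n \<in> decay_maps \<Gamma> k" "\<And>n. least_bound \<Gamma> k (f n) \<le> C * t ^ n" "0 \<le> t" "t < 1"
  then show "\<exists>s\<in>decay_maps \<Gamma> k. (\<lambda>n. least_bound \<Gamma> k (s - (\<Sum>i<n. f i))) \<longlonglongrightarrow> 0"
    by (rule decay_maps_complete[OF \<Gamma>])
qed


section \<open>Operators on multilinear maps\<close>

text \<open>A linear map is read as a map on lists of length one, so that the results on multilinear
  maps and slots apply to it.\<close>

definition decay_linear :: "(int ^ 'm::finite \<Rightarrow> real) \<Rightarrow>
  (('m, 'a::real_normed_vector) linf \<Rightarrow> ('m, 'b::real_normed_vector) linf) \<Rightarrow> bool" where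
  "decay_linear \<Gamma> \<phi> \<longleftrightarrow> decay_multilinear \<Gamma> 1 (\<lambda>vs. \<phi> (hd vs))"

lemma decay_linearI:
  fixes \<phi> :: "('m::finite, 'a::real_normed_vector) linf \<Rightarrow> ('m, 'b::real_normed_vector) linf"
  assumes "linear \<phi>" "0 \<le> M" "\<And>u. norm (\<phi> u) \<le> M * norm u"
    and "\<And>l w i. supported_at l w \<Longrightarrow> norm (\<phi> w i) \<le> M * \<Gamma> (i - l) * norm w"
  shows "decay_linear \<Gamma> \<phi>"
  unfolding decay_linear_def decay_multilinear_def
proof (intro conjI exI)
  show "multilinear 1 (\<lambda>vs. \<phi> (hd vs))"
    using assms(1) by (auto simp: multilinear_def length_Suc_conv)
  show "decay_bound \<Gamma> 1 (\<lambda>vs. \<phi> (hd vs)) M"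
    using assms(2-) by (intro decay_boundI) (auto simp: length_Suc_conv)
qed

lemma decay_linearE:
  fixes \<phi> :: "('m::finite, 'a::real_normed_vector) linf \<Rightarrow> ('m, 'b::real_normed_vector) linf"
  assumes "decay_linear \<Gamma> \<phi>"
  obtains M where "linear \<phi>" "0 \<le> M" "\<And>u. norm (\<phi> u) \<le> M * norm u"
    "\<And>l w i. supported_at l w \<Longrightarrow> norm (\<phi> w i) \<le> M * \<Gamma> (i - l) * norm w"
    "decay_bound \<Gamma> 1 (\<lambda>vs. \<phi> (hd vs)) M"
proof -
  obtain M where M: "decay_bound \<Gamma> 1 (\<lambda>vs. \<phi> (hd vs)) M" and ml: "multilinear 1 (\<lambda>vs. \<phi> (hd vs))"
    using assms by (auto simp: decay_linear_def decay_multilinear_def)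
  show thesis
  proof (rule that[OF _ _ _ _ M])
    show "linear \<phi>" using multilinearD[OF ml, of "[0]" 0] by simp
    show "0 \<le> M" using decay_boundD(1)[OF M] .
    show "norm (\<phi> u) \<le> M * norm u" for u using decay_boundD(2)[OF M, of "[u]"] by simp
    show "norm (\<phi> w i) \<le> M * \<Gamma> (i - l) * norm w" if "supported_at l w" for l w i
      using decay_boundD(3)[OF M, of "[w]" 0 l i] that by simp
  qed
qed

text \<open>\<open>\<psi>\<close> and \<open>\<theta>\<close> act site by site without increasing
  norms, as real part, imaginary part and inclusion into complex families do; hence they spoil
  neither supports nor decay.\<close>

lemma decay_linear_compose_pointwise:
  fixes \<phi> :: "('m::finite, 'b::real_normed_vector) linf \<Rightarrow> ('m, 'c::real_normed_vector) linf"
    and \<psi> :: "('m, 'a::real_normed_vector) linf \<Rightarrow> ('m, 'b) linf"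
    and \<theta> :: "('m, 'c) linf \<Rightarrow> ('m, 'd::real_normed_vector) linf"
  assumes \<phi>: "decay_linear \<Gamma> \<phi>" and \<psi>: "linear \<psi>" "\<And>z i. norm (\<psi> z i) \<le> norm (z i)"
    and \<theta>: "linear \<theta>" "\<And>z i. norm (\<theta> z i) \<le> norm (z i)"
    and \<Gamma>: "decay_function \<Gamma>"
  shows "decay_linear \<Gamma> (\<lambda>z. \<theta> (\<phi> (\<psi> z)))"
proof -
  obtain M where M: "linear \<phi>" "0 \<le> M" "\<And>u. norm (\<phi> u) \<le> M * norm u"
    "\<And>l w i. supported_at l w \<Longrightarrow> norm (\<phi> w i) \<le> M * \<Gamma> (i - l) * norm w"
    using decay_linearE[OF \<phi>] by metis
  have n\<psi>: "norm (\<psi> z) \<le> norm z" for z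
    by (rule norm_bound) (rule order_trans[OF \<psi>(2) norm_bounded])
  have n\<theta>: "norm (\<theta> z) \<le> norm z" for z
    by (rule norm_bound) (rule order_trans[OF \<theta>(2) norm_bounded])
  show ?thesis
  proof (rule decay_linearI[OF _ M(2)])
    show "linear (\<lambda>z. \<theta> (\<phi> (\<psi> z)))"
      using linear_compose[OF linear_compose[OF \<psi>(1) M(1)] \<theta>(1)] by (simp add: o_def)
    show "norm (\<theta> (\<phi> (\<psi> u))) \<le> M * norm u" for u
      using order_trans[OF n\<theta> M(3)] mult_left_mono[OF n\<psi> M(2)] by (rule order_trans)
    show "norm (\<theta> (\<phi> (\<psi> w)) i) \<le> M * \<Gamma> (i - l) * norm w" if "supported_at l w" for l w i
    proof -
      have "supported_at l (\<psi> w)"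
        using that \<psi>(2)[of w] by (auto simp: supported_at_def) (metis norm_le_zero_iff norm_zero)
      from order_trans[OF \<theta>(2) M(4)[OF this]] show ?thesis
        by (rule order_trans)
          (intro mult_left_mono n\<psi> mult_nonneg_nonneg M(2) less_imp_le[OF decay_functionD(1)[OF \<Gamma>]])
    qed
  qed
qed

lemma decay_linear_add:
  assumes "decay_linear \<Gamma> \<phi>" "decay_linear \<Gamma> \<psi>" "decay_function \<Gamma>"
  shows "decay_linear \<Gamma> (\<lambda>z. \<phi> z + \<psi> z)"
  using assms decay_bound_add multilinear_add unfolding decay_linear_def decay_multilinear_def
  by blast

definition postcomp :: "('b \<Rightarrow> 'b) \<Rightarrow> ('a list \<Rightarrow> 'b) \<Rightarrow> 'a list \<Rightarrow> 'b" where
  "postcomp \<phi> K vs = \<phi> (K vs)"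

definition precomp_arg :: "nat \<Rightarrow> ('a \<Rightarrow> 'a) \<Rightarrow> ('a list \<Rightarrow> 'b) \<Rightarrow> 'a list \<Rightarrow> 'b" where
  "precomp_arg i \<phi> K vs = K (vs[i := \<phi> (vs ! i)])"

lemma postcomp_decay_maps:
  fixes \<phi> :: "('m::finite, 'b::real_normed_vector) linf \<Rightarrow> ('m, 'b) linf"
  assumes \<Gamma>: "decay_function \<Gamma>" and \<phi>: "decay_linear \<Gamma> \<phi>"
  obtains M where "\<And>K :: ('m, 'a::real_normed_vector) linf list \<Rightarrow> _. K \<in> decay_maps \<Gamma> k \<Longrightarrow>
    postcomp \<phi> K \<in> decay_maps \<Gamma> k \<and> least_bound \<Gamma> k (postcomp \<phi> K) \<le> M * least_bound \<Gamma> k K"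
proof -
  obtain M where M: "linear \<phi>" "0 \<le> M" "\<And>u. norm (\<phi> u) \<le> M * norm u"
    "\<And>l w i. supported_at l w \<Longrightarrow> norm (\<phi> w i) \<le> M * \<Gamma> (i - l) * norm w"
    using decay_linearE[OF \<phi>] by metis
  show thesis
  proof (rule that)
    fix K :: "('m, 'a) linf list \<Rightarrow> ('m, 'b) linf" assume K: "K \<in> decay_maps \<Gamma> k"
    have b: "decay_bound \<Gamma> k (postcomp \<phi> K) (M * least_bound \<Gamma> k K)"
      unfolding postcomp_def [abs_def]
      by (rule decay_multilinear_postcompose[OF \<Gamma> M decay_maps_bound[OF \<Gamma> K]])
    have "postcomp \<phi> K \<in> decay_maps \<Gamma> k"
      using multilinear_compose_linear[OF M(1) decay_mapsD(1)[OF K]] decay_mapsD(2)[OF K]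
      by (intro decay_mapsI[OF _ b]) (auto simp: postcomp_def [abs_def] linear_0[OF M(1)])
    then show "postcomp \<phi> K \<in> decay_maps \<Gamma> k \<and> least_bound \<Gamma> k (postcomp \<phi> K) \<le> M * least_bound \<Gamma> k K"
      using least_bound_le[OF b] by blast
  qed
qed

text \<open>On lists of length \<open>k\<close>, composition in one argument is a slot with a block
  of length one.\<close>

lemma precomp_arg_decay_maps:
  fixes \<phi> :: "('m::finite, 'a::real_normed_vector) linf \<Rightarrow> ('m, 'a) linf"
  assumes \<Gamma>: "decay_function \<Gamma>" and \<phi>: "decay_linear \<Gamma> \<phi>" and i: "i < k"
  obtains M where "\<And>K :: _ \<Rightarrow> ('m, 'b::real_normed_vector) linf. K \<in> decay_maps \<Gamma> k \<Longrightarrow>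
    precomp_arg i \<phi> K \<in> decay_maps \<Gamma> k \<and> least_bound \<Gamma> k (precomp_arg i \<phi> K) \<le> M * least_bound \<Gamma> k K"
proof -
  obtain M where M: "linear \<phi>" "decay_bound \<Gamma> 1 (\<lambda>vs. \<phi> (hd vs)) M"
    using decay_linearE[OF \<phi>] by metis
  have ml: "multilinear 1 (\<lambda>vs. \<phi> (hd vs))"
    using \<phi> by (auto simp: decay_linear_def decay_multilinear_def)
  obtain k' where k': "k = Suc k'" "i \<le> k'" using i by (cases k) auto
  show thesis
  proof (rule that)
    fix K :: "('m, 'a) linf list \<Rightarrow> ('m, 'b) linf" assume K: "K \<in> decay_maps \<Gamma> k"
    have eq: "precomp_arg i \<phi> K vs = slot i 1 K (\<lambda>vs. \<phi> (hd vs)) vs" if "length vs = k" for vs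
      using that i by (simp add: precomp_arg_def slot_def upd_conv_take_nth_drop hd_drop_conv_nth)
    have "decay_bound \<Gamma> (k' + 1) (slot i 1 K (\<lambda>vs. \<phi> (hd vs))) (least_bound \<Gamma> k K * M)"
      using K M k' decay_mapsD(1)[OF K] decay_maps_bound[OF \<Gamma> K]
      by (intro decay_bound_slot[OF \<Gamma>]) auto
    then have b: "decay_bound \<Gamma> k (precomp_arg i \<phi> K) (M * least_bound \<Gamma> k K)"
      using k'(1) by (intro decay_bound_cong[OF _ eq]) (auto simp: mult.commute)
    have "multilinear (k' + 1) (slot i 1 K (\<lambda>vs. \<phi> (hd vs)))"
      using decay_mapsD(1)[OF K] k' by (intro multilinear_slot ml) auto
    then have "multilinear k (precomp_arg i \<phi> K)"
      using k'(1) by (intro multilinear_cong[OF _ eq]) auto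
    then have "precomp_arg i \<phi> K \<in> decay_maps \<Gamma> k"
      using decay_mapsD(2)[OF K] by (intro decay_mapsI[OF _ b]) (auto simp: precomp_arg_def)
    then show "precomp_arg i \<phi> K \<in> decay_maps \<Gamma> k \<and> least_bound \<Gamma> k (precomp_arg i \<phi> K) \<le> M * least_bound \<Gamma> k K"
      using least_bound_le[OF b] by blast
  qed
qed

section \<open>The complexified linear maps\<close>

text \<open>The real part of a rotated vector is no longer than the vector, so the supremum in
  \<open>complex_norm\<close> runs over a bounded set.\<close>

lemma complex_norm_le:
  fixes N :: "real ^ 'n \<Rightarrow> real"
  assumes "is_norm N"
  shows "N (\<chi> k. Re (cis t * z $ k)) \<le> complex_norm N z"
proof -
  obtain C where C: "0 < C" "\<And>x. N x \<le> C * norm x" using is_norm_equiv[OF assms] by metis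
  have "N (\<chi> k. Re (cis t * z $ k)) \<le> C * norm z" for t
  proof -
    have "norm (\<chi> k. Re (cis t * z $ k)) \<le> norm z"
      unfolding norm_vec_def
    proof (rule L2_set_mono)
      show "norm ((\<chi> k. Re (cis t * z $ k)) $ k) \<le> norm (z $ k)" for k
        using abs_Re_le_cmod[of "cis t * z $ k"] by (simp add: norm_mult)
    qed simp
    then show ?thesis using C(2)[of "\<chi> k. Re (cis t * z $ k)"] C(1)
      by (meson less_imp_le mult_left_mono order_trans)
  qed
  then show ?thesis
    unfolding complex_norm_def by (intro cSUP_upper bdd_aboveI2) auto
qed

lemma is_norm_complex_norm:
  fixes N :: "real ^ 'n \<Rightarrow> real"
  assumes N: "is_norm N"
  shows "is_norm (complex_norm N)"
proof -
  note le = complex_norm_le[OF N]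
  have N0: "N x = 0 \<longleftrightarrow> x = 0" and Ns: "N (c *\<^sub>R x) = \<bar>c\<bar> * N x" and Nt: "N (x + y) \<le> N x + N y" for x y c
    using N by (auto simp: is_norm_def)
  have least: "complex_norm N z \<le> b" if "\<And>t. N (\<chi> k. Re (cis t * z $ k)) \<le> b" for z b
    unfolding complex_norm_def using that by (intro cSUP_least) auto
  \<comment> \<open>Equality follows later by using this inequality for \<open>1 / c\<close> as
    well.\<close>
  have sc: "complex_norm N (c *\<^sub>R z) \<le> \<bar>c\<bar> * complex_norm N z" for c z
  proof (rule least)
    fix t
    have "(\<chi> k. Re (cis t * (c *\<^sub>R z) $ k)) = c *\<^sub>R (\<chi> k. Re (cis t * z $ k))"
      by (simp add: vec_eq_iff algebra_simps)
    then show "N (\<chi> k. Re (cis t * (c *\<^sub>R z) $ k)) \<le> \<bar>c\<bar> * complex_norm N z"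
      using le[of t z] by (simp only: Ns) (simp add: mult_left_mono)
  qed
  have zero: "complex_norm N 0 = 0"
  proof (rule antisym)
    have "(\<chi> k. Re (cis t * (0 :: complex ^ 'n) $ k)) = 0" for t by (simp add: vec_eq_iff)
    then show "complex_norm N 0 \<le> 0" using N0[of 0] by (intro least) (simp del: zero_index)
    show "0 \<le> complex_norm N 0"
      using le[of 0 0] is_norm_nonneg[OF N] by (meson order_trans)
  qed
  show ?thesis
    unfolding is_norm_def
  proof (intro conjI allI)
    fix z :: "complex ^ 'n"
    show "complex_norm N z = 0 \<longleftrightarrow> z = 0"
    proof
      assume z: "complex_norm N z = 0"
      have "(\<chi> k. Re (cis t * z $ k)) = 0" for t
        using le[of t z] is_norm_nonneg[OF N, of "\<chi> k. Re (cis t * z $ k)"] z N0 by (metis antisym)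
      then have *: "Re (cis t * z $ k) = 0" for t k
        by (metis vec_lambda_beta zero_index)
      \<comment> \<open>The rotations by \<open>0\<close> and \<open>pi/2\<close> give the real part
        and minus the imaginary part.\<close>
      have "z $ k = 0" for k
        using *[of 0 k] *[of "pi/2" k] by (simp add: complex_eq_iff cis.code)
      then show "z = 0" by (simp add: vec_eq_iff)
    qed (simp add: zero)
    fix c :: real
    show "complex_norm N (c *\<^sub>R z) = \<bar>c\<bar> * complex_norm N z"
    proof (cases "c = 0")
      case False
      have "complex_norm N z \<le> \<bar>1 / c\<bar> * complex_norm N (c *\<^sub>R z)"
        using sc[of "1 / c" "c *\<^sub>R z"] False by simp
      then have "\<bar>c\<bar> * complex_norm N z \<le> complex_norm N (c *\<^sub>R z)"
        using False by (simp add: field_simps)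
      then show ?thesis using sc[of c z] by simp
    qed (simp add: zero)
    fix w :: "complex ^ 'n"
    show "complex_norm N (z + w) \<le> complex_norm N z + complex_norm N w"
    proof (rule least)
      fix t
      have "(\<chi> k. Re (cis t * (z + w) $ k)) = (\<chi> k. Re (cis t * z $ k)) + (\<chi> k. Re (cis t * w $ k))"
        by (simp add: vec_eq_iff algebra_simps)
      then show "N (\<chi> k. Re (cis t * (z + w) $ k)) \<le> complex_norm N z + complex_norm N w"
        using Nt[of "\<chi> k. Re (cis t * z $ k)" "\<chi> k. Re (cis t * w $ k)"] le[of t z] le[of t w] by simp
    qed
  qed
qed

lemma linear_re_linf: "linear re_linf" and linear_im_linf: "linear im_linf"
  by (rule linearI; rule bcontfun_eqI; simp add: apply_re_linf apply_im_linf vec_eq_iff)+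

lemma linear_complex_linf: "linear (\<lambda>x. complex_linf x 0)"
  by (rule linearI; rule bcontfun_eqI; simp add: apply_complex_linf vec_eq_iff complex_eq_iff)

lemma complex_linf_eq: "complex_linf x y = complex_linf x 0 + cscale \<i> (complex_linf y 0)"
  by (rule bcontfun_eqI) (simp add: apply_complex_linf apply_cscale vec_eq_iff complex_eq_iff)

lemma re_im_complex_linf [simp]: "re_linf (complex_linf x y) = x" "im_linf (complex_linf x y) = y"
  by (rule bcontfun_eqI; simp add: apply_re_linf apply_im_linf apply_complex_linf vec_eq_iff)+

lemma complex_re_im_linf [simp]: "complex_linf (re_linf z) (im_linf z) = z"
  by (rule bcontfun_eqI) (simp add: apply_re_linf apply_im_linf apply_complex_linf vec_eq_iff)

lemma re_im_cscale:
  "re_linf (cscale c z) = Re c *\<^sub>R re_linf z - Im c *\<^sub>R im_linf z"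
  "im_linf (cscale c z) = Re c *\<^sub>R im_linf z + Im c *\<^sub>R re_linf z"
  by (rule bcontfun_eqI; simp add: apply_re_linf apply_im_linf apply_cscale vec_eq_iff)+

lemma norm_re_im_linf: "norm (re_linf z i) \<le> norm (z i)" "norm (im_linf z i) \<le> norm (z i)"
  unfolding norm_vec_def
  by (auto intro!: L2_set_mono simp: apply_re_linf apply_im_linf abs_Re_le_cmod abs_Im_le_cmod)

lemma norm_complex_linf: "norm (complex_linf x 0 i) \<le> norm (x i)"
proof -
  have "cmod (Complex a 0) = \<bar>a\<bar>" for a by (simp add: cmod_def)
  then show ?thesis by (simp add: norm_vec_def apply_complex_linf)
qed

lemma decay_linear_complexify:
  assumes \<Gamma>: "decay_function \<Gamma>" and A: "decay_linear \<Gamma> A"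
  shows "decay_linear \<Gamma> (complexify A)"
proof -
  have "decay_linear \<Gamma> (\<lambda>z. complex_linf (A (re_linf z)) 0)"
    by (rule decay_linear_compose_pointwise[OF A linear_re_linf norm_re_im_linf(1)
          linear_complex_linf norm_complex_linf \<Gamma>])
  moreover have "linear (\<lambda>x. cscale \<i> (complex_linf x 0))"
    using linear_compose[OF linear_complex_linf linear_cscale] by (simp add: o_def)
  then have "decay_linear \<Gamma> (\<lambda>z. cscale \<i> (complex_linf (A (im_linf z)) 0))"
    by (rule decay_linear_compose_pointwise[OF A linear_im_linf norm_re_im_linf(2) _ _ \<Gamma>])
      (rule order_trans[OF norm_cscale_apply], simp add: norm_complex_linf)
  ultimately have "decay_linear \<Gamma>
      (\<lambda>z. complex_linf (A (re_linf z)) 0 + cscale \<i> (complex_linf (A (im_linf z)) 0))"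
    by (rule decay_linear_add[OF _ _ \<Gamma>])
  moreover have "complexify A =
      (\<lambda>z. complex_linf (A (re_linf z)) 0 + cscale \<i> (complex_linf (A (im_linf z)) 0))"
    unfolding complexify_def by (rule ext) (rule complex_linf_eq)
  ultimately show ?thesis by simp
qed

lemma complexify_cscale:
  assumes "linear A"
  shows "complexify A (cscale c z) = cscale c (complexify A z)"
  unfolding complexify_def re_im_cscale linear_diff[OF assms] linear_add[OF assms] linear_scale[OF assms]
  by (rule bcontfun_eqI) (simp add: apply_complex_linf apply_cscale vec_eq_iff complex_eq_iff)

text \<open>One-element lists reduce the two linear norms to the multilinear ones, and
  \<open>mlin_decay_norm_finite_iff\<close> applies with \<open>complex_norm N\<close> as the norm
  on complex vectors.\<close>

lemma CL_decay_linear: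
  assumes N: "is_norm N" and \<Gamma>: "decay_function \<Gamma>" and B: "B \<in> CL_decay N \<Gamma>"
  shows "decay_linear \<Gamma> B" "clinear B"
proof -
  show cl: "clinear B" using B by (simp add: CL_decay_def)
  have "linear B"
    using cl unfolding clinear_def by (intro linearI) (auto simp flip: cscale_simps(8))
  then have ml: "multilinear 1 (\<lambda>vs. B (hd vs))"
    by (auto simp: multilinear_def length_Suc_conv)
  let ?N = "complex_norm N"
  have "mlin_norm ?N 1 (\<lambda>vs. B (hd vs)) \<le> lin_norm ?N B"
    unfolding mlin_norm_def lin_norm_def
    by (rule SUP_least) (auto simp: length_Suc_conv intro!: SUP_upper)
  moreover have "mlin_gamma ?N \<Gamma> 1 (\<lambda>vs. B (hd vs)) \<le> lin_gamma ?N \<Gamma> B"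
    unfolding mlin_gamma_def
  proof (intro SUP_least, clarsimp)
    fix i l and w :: "('b, complex ^ 'a) linf" assume w: "linf_norm ?N w \<le> 1" "supported_at l w"
    show "ereal (?N (B w i) * inverse (\<Gamma> (i - l))) \<le> lin_gamma ?N \<Gamma> B"
      unfolding lin_gamma_def
      by (rule SUP_upper2[of i UNIV], simp, rule SUP_upper2[of l UNIV], simp,
          rule SUP_upper2[of w]) (use w in auto)
  qed
  ultimately have "mlin_decay_norm ?N \<Gamma> 1 (\<lambda>vs. B (hd vs)) \<le> lin_decay_norm ?N \<Gamma> B"
    unfolding mlin_decay_norm_def lin_decay_norm_def by (rule max.mono)
  also have "\<dots> < \<infinity>" using B by (simp add: CL_decay_def)
  finally show "decay_linear \<Gamma> B"
    using mlin_decay_norm_finite_iff[OF is_norm_complex_norm[OF N] \<Gamma> ml] ml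
    by (simp add: decay_linear_def decay_multilinear_def)
qed


section \<open>The cohomological equation\<close>

text \<open>On real families the resolvent \<open>B\<close> is \<open>B1 + \<i> B2\<close>; so it can be put into a single argument of a real map.\<close>

lemma resolvent:
  fixes A :: "('m::finite, real ^ 'n) linf \<Rightarrow> ('m, real ^ 'n) linf"
  assumes N: "is_norm N" and \<Gamma>: "decay_function \<Gamma>" and A: "decay_linear \<Gamma> A"
    and c: "c \<notin> Spec_decay N \<Gamma> A"
  shows "\<exists>B B1 B2. decay_linear \<Gamma> B \<and> clinear B \<and>
    (\<forall>z. B (complexify A z - cscale c z) = z \<and> complexify A (B z) - cscale c (B z) = z) \<and>
    decay_linear \<Gamma> B1 \<and> decay_linear \<Gamma> B2 \<and>
    (\<forall>v. B1 (A v) - Re c *\<^sub>R B1 v + Im c *\<^sub>R B2 v = v \<and>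
      B2 (A v) - Re c *\<^sub>R B2 v - Im c *\<^sub>R B1 v = 0) \<and>
    (\<forall>v. A (B1 v) - Re c *\<^sub>R B1 v + Im c *\<^sub>R B2 v = v \<and>
      A (B2 v) - Re c *\<^sub>R B2 v - Im c *\<^sub>R B1 v = 0)"
proof -
  obtain B where B: "B \<in> CL_decay N \<Gamma>"
    and inv: "B \<circ> (\<lambda>z. complexify A z - cscale c z) = id" "(\<lambda>z. complexify A z - cscale c z) \<circ> B = id"
    using c unfolding Spec_decay_def by (auto simp: Let_def)
  note BD = CL_decay_linear[OF N \<Gamma> B]
  have inv1: "B (complexify A z - cscale c z) = z" and inv2: "complexify A (B z) - cscale c (B z) = z" for z
    using fun_cong[OF inv(1), of z] fun_cong[OF inv(2), of z] by auto
  obtain M where linA: "linear A" using decay_linearE[OF A] by metis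
  have Badd: "B (z + w) = B z + B w" and Bsc: "B (cscale d z) = cscale d (B z)" for z w d
    using BD(2) by (auto simp: clinear_def)
  define B1 where "B1 v = re_linf (B (complex_linf v 0))" for v
  define B2 where "B2 v = im_linf (B (complex_linf v 0))" for v
  have "decay_linear \<Gamma> B1" "decay_linear \<Gamma> B2"
    unfolding B1_def [abs_def] B2_def [abs_def]
    by (rule decay_linear_compose_pointwise[OF BD(1) linear_complex_linf norm_complex_linf _ _ \<Gamma>];
        rule linear_re_linf linear_im_linf norm_re_im_linf)+
  then obtain lin1: "linear B1" and lin2: "linear B2" using decay_linearE by metis
  \<comment> \<open>On real families \<open>B\<close> is \<open>B1 + \<i> B2\<close>; complex
    linearity extends this to all families.\<close>
  have Bv: "B (complex_linf x y) = complex_linf (B1 x - B2 y) (B2 x + B1 y)" for x y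
  proof -
    have "B (complex_linf x y) = B (complex_linf x 0) + cscale \<i> (B (complex_linf y 0))"
      by (subst complex_linf_eq) (simp add: Badd Bsc)
    also have "\<dots> = complex_linf (B1 x) (B2 x) + cscale \<i> (complex_linf (B1 y) (B2 y))"
      by (simp add: B1_def B2_def)
    also have "\<dots> = complex_linf (B1 x - B2 y) (B2 x + B1 y)"
      by (rule bcontfun_eqI) (simp add: apply_complex_linf apply_cscale vec_eq_iff complex_eq_iff)
    finally show ?thesis .
  qed
  have cs: "complexify A (complex_linf x y) - cscale c (complex_linf x y)
      = complex_linf (A x - (Re c *\<^sub>R x - Im c *\<^sub>R y)) (A y - (Re c *\<^sub>R y + Im c *\<^sub>R x))" for x y
    unfolding complexify_def re_im_complex_linf
    by (rule bcontfun_eqI) (simp add: apply_complex_linf apply_cscale vec_eq_iff complex_eq_iff)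
  have inj: "x = x'" "y = y'" if "complex_linf x y = complex_linf x' y'" for x y x' y'
    using arg_cong[OF that, of re_linf] arg_cong[OF that, of im_linf] by simp_all
  note lins = linear_diff[OF lin1] linear_diff[OF lin2] linear_add[OF lin1] linear_add[OF lin2]
    linear_scale[OF lin1] linear_scale[OF lin2] linear_0[OF linA] linear_0[OF lin1] linear_0[OF lin2]
    linear_neg[OF lin1] linear_neg[OF lin2]
  \<comment> \<open>Real and imaginary parts of the two inverse relations, taken on real
    families.\<close>
  have 1: "B1 (A v) - Re c *\<^sub>R B1 v + Im c *\<^sub>R B2 v = v" "B2 (A v) - Re c *\<^sub>R B2 v - Im c *\<^sub>R B1 v = 0" for v
    using inj[OF inv1[of "complex_linf v 0", unfolded cs Bv]] by (simp_all add: lins algebra_simps)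
  have 2: "A (B1 v) - Re c *\<^sub>R B1 v + Im c *\<^sub>R B2 v = v" "A (B2 v) - Re c *\<^sub>R B2 v - Im c *\<^sub>R B1 v = 0" for v
    using inj[OF inv2[of "complex_linf v 0", unfolded cs Bv]] by (simp_all add: lins algebra_simps)
  show ?thesis
    by (intro exI[of _ B] exI[of _ B1] exI[of _ B2] conjI allI BD inv1 inv2 1 2
        \<open>decay_linear \<Gamma> B1\<close> \<open>decay_linear \<Gamma> B2\<close>)
qed

text \<open>The equation is solved for maps of real arguments with complex values, and the real part
  of the solution is taken at the end. That real part is a solution because
  \<open>complexify A\<close> acts on real parts as \<open>A\<close> and the right-hand side is
  real.\<close>

theorem cohomological_equation:
  fixes A :: "('m::finite, real ^ 'n) linf \<Rightarrow> ('m, real ^ 'n) linf"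
  assumes N: "is_norm N" and \<Gamma>: "decay_function \<Gamma>" and A: "decay_linear \<Gamma> A"
    and nonres: "set_power (Spec_decay N \<Gamma> A) k \<inter> Spec_decay N \<Gamma> A = {}"
    and Q: "decay_multilinear \<Gamma> k Q"
  shows "\<exists>K. decay_multilinear \<Gamma> k K \<and> (\<forall>vs. length vs = k \<longrightarrow> A (K vs) - K (map A vs) = Q vs)"
proof -
  let ?E = "decay_maps \<Gamma> k :: (('m, real ^ 'n) linf list \<Rightarrow> ('m, complex ^ 'n) linf) set"
  let ?S = "Spec_decay N \<Gamma> A"
  interpret complex_banach ?E map_scale "least_bound \<Gamma> k"
    by (rule complex_banach_decay_maps[OF \<Gamma>])
  obtain linA: "linear A" using decay_linearE[OF A] by metis
  note AC = decay_linear_complexify[OF \<Gamma> A]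
  obtain linAC: "linear (complexify A)" using decay_linearE[OF AC] by metis
  \<comment> \<open>Restriction to \<open>?E\<close> with value \<open>0\<close> elsewhere, the
    normalization of \<open>bounded_ops\<close>.\<close>
  define ext where "ext T K = (if K \<in> ?E then T K else 0)" 
    for T :: "_ \<Rightarrow> ('m, real ^ 'n) linf list \<Rightarrow> ('m, complex ^ 'n) linf" and K
  have extI: "ext T \<in> bounded_ops"
    if "\<And>K. K \<in> ?E \<Longrightarrow> T K \<in> ?E \<and> least_bound \<Gamma> k (T K) \<le> M * least_bound \<Gamma> k K"
      "\<And>K L. K \<in> ?E \<Longrightarrow> L \<in> ?E \<Longrightarrow> T (K - L) = T K - T L"
      "\<And>K c. K \<in> ?E \<Longrightarrow> T (map_scale c K) = map_scale c (T K)" for T M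
    by (rule bounded_opsI[where C = M]) (use that in \<open>simp_all add: ext_def\<close>)
  have postcomp_ops: "ext (postcomp \<phi>) \<in> bounded_ops"
    if \<phi>: "decay_linear \<Gamma> \<phi>" and sc: "\<And>c z. \<phi> (cscale c z) = cscale c (\<phi> z)" for \<phi>
  proof -
    obtain lin: "linear \<phi>" using decay_linearE[OF \<phi>] by metis
    obtain M where "\<And>K. K \<in> ?E \<Longrightarrow> postcomp \<phi> K \<in> ?E \<and> least_bound \<Gamma> k (postcomp \<phi> K) \<le> M * least_bound \<Gamma> k K"
      using postcomp_decay_maps[OF \<Gamma> \<phi>] by metis
    then show ?thesis
      by (rule extI) (auto simp: fun_eq_iff postcomp_def map_scale_def sc linear_diff[OF lin])
  qed
  have precomp_ops: "ext (precomp_arg i \<phi>) \<in> bounded_ops" if \<phi>: "decay_linear \<Gamma> \<phi>" and i: "i < k" for i \<phi>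
  proof -
    obtain M where "\<And>K. K \<in> ?E \<Longrightarrow> precomp_arg i \<phi> K \<in> ?E \<and> least_bound \<Gamma> k (precomp_arg i \<phi> K) \<le> M * least_bound \<Gamma> k K"
      using precomp_arg_decay_maps[OF \<Gamma> \<phi> i] by metis
    then show ?thesis
      by (rule extI) (auto simp: fun_eq_iff precomp_arg_def map_scale_def)
  qed
  let ?y = "ext (postcomp (complexify A))" and ?x = "\<lambda>i. ext (precomp_arg i A)"
  have y: "?y \<in> bounded_ops" by (rule postcomp_ops[OF AC complexify_cscale[OF linA]])
  have x: "?x i \<in> bounded_ops" if "i < k" for i by (rule precomp_ops[OF A that])
  have ev: "ext T K vs = T K vs" if "K \<in> ?E" for T K vs using that by (simp add: ext_def)
  have mem: "postcomp (complexify A) K \<in> ?E" if "K \<in> ?E" for K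
    using bounded_opsD(2)[OF y, of K] that by (simp add: ext_def)
  have mem': "precomp_arg i A K \<in> ?E" if "K \<in> ?E" "i < k" for K i
    using bounded_opsD(2)[OF x[OF that(2)], of K] that by (simp add: ext_def)
  define QC where "QC vs = (if length vs = k then complex_linf (Q vs) 0 else 0)" for vs
  have QC: "QC \<in> ?E"
  proof -
    obtain C where C: "decay_bound \<Gamma> k Q C" and ml: "multilinear k Q"
      using Q by (auto simp: decay_multilinear_def)
    have "decay_bound \<Gamma> k (\<lambda>vs. complex_linf (Q vs) 0) (1 * C)"
      by (rule decay_bound_map[OF C]) (simp_all add: norm_complex_linf)
    then have "decay_bound \<Gamma> k QC (1 * C)"
      by (rule decay_bound_cong) (simp add: QC_def)
    moreover have "multilinear k QC"
      by (rule multilinear_cong[OF multilinear_compose_linear[OF linear_complex_linf ml]])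
        (simp add: QC_def)
    ultimately show ?thesis by (intro decay_mapsI) (auto simp: QC_def)
  qed
  \<comment> \<open>\<open>A\<close> is applied to the first \<open>i\<close> arguments; on lists of
    length \<open>k\<close> the case \<open>i = k\<close> is composition with \<open>A\<close> in
    all of them.\<close>
  define P where "P i K = (\<lambda>vs. K (map A (take i vs) @ drop i vs))"
    for i and K :: "('m, real ^ 'n) linf list \<Rightarrow> ('m, complex ^ 'n) linf"
  have "\<exists>K\<in>?E. ?y K - P k K = QC"
  proof (rule commuting_diff_prod_surj[OF y x])
    show "?y (?x i K) = ?x i (?y K)" if "i < k" "K \<in> ?E" for i K
      using that by (simp add: ext_def mem mem') (simp add: fun_eq_iff postcomp_def precomp_arg_def)
    show "?x i (?x j K) = ?x j (?x i K)" if "i < k" "j < k" "K \<in> ?E" for i j K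
      using that by (cases "i = j") (simp_all add: ext_def mem' fun_eq_iff precomp_arg_def list_update_swap)
    show "\<exists>b\<in>bounded_ops. \<forall>K\<in>?E. b (?y K - map_scale c K) = K \<and> ?y (b K) - map_scale c (b K) = K"
      if c: "c \<notin> ?S" for c
    proof -
      obtain B where B: "decay_linear \<Gamma> B" "clinear B"
        "\<And>z. B (complexify A z - cscale c z) = z" "\<And>z. complexify A (B z) - cscale c (B z) = z"
        using resolvent[OF N \<Gamma> A c] by blast
      have b: "ext (postcomp B) \<in> bounded_ops"
        using B(2) by (intro postcomp_ops B(1)) (simp add: clinear_def)
      show ?thesis
      proof (intro bexI[OF _ b] ballI conjI)
        fix K assume K: "K \<in> ?E"
        have "postcomp B K \<in> ?E" using bounded_opsD(2)[OF b, of K] K by (simp add: ext_def)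
        with K show "ext (postcomp B) (?y K - map_scale c K) = K"
          "?y (ext (postcomp B) K) - map_scale c (ext (postcomp B) K) = K"
          using diff_E[OF mem[OF K] scl_E[OF K, of c]]
          by (simp_all add: ext_def fun_eq_iff postcomp_def map_scale_def B(3,4))
      qed
    qed
    show "\<exists>b\<in>bounded_ops. \<forall>K\<in>?E. b (?x i K - map_scale c K) = K \<and> ?x i (b K) - map_scale c (b K) = K"
      if c: "c \<notin> ?S" and i: "i < k" for c i
    proof -
      obtain B1 B2 where B: "decay_linear \<Gamma> B1" "decay_linear \<Gamma> B2"
        "\<And>v. B1 (A v) - Re c *\<^sub>R B1 v + Im c *\<^sub>R B2 v = v"
        "\<And>v. B2 (A v) - Re c *\<^sub>R B2 v - Im c *\<^sub>R B1 v = 0"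
        "\<And>v. A (B1 v) - Re c *\<^sub>R B1 v + Im c *\<^sub>R B2 v = v"
        "\<And>v. A (B2 v) - Re c *\<^sub>R B2 v - Im c *\<^sub>R B1 v = 0"
        using resolvent[OF N \<Gamma> A c] by blast
      \<comment> \<open>The resolvent \<open>B1 + \<i> B2\<close> put into argument
        \<open>i\<close>, with the factor \<open>\<i>\<close> moved to the value. Subtracting the
        multiple by \<open>- \<i>\<close> is a sum written as a difference, to fit
        \<open>diff_bounded\<close>.\<close>
      define \<beta> where "\<beta> = ext (precomp_arg i B1) - op_scl (- \<i>) (ext (precomp_arg i B2))"
      have b: "\<beta> \<in> bounded_ops"
        unfolding \<beta>_def by (intro diff_bounded scl_bounded precomp_ops B i)
      \<comment> \<open>The hypotheses are the real and imaginary parts of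
        \<open>(w1 + \<i> w2) - c (v1 + \<i> v2) = vs ! i\<close>. Linearity in argument
        \<open>i\<close> gives the claim, which serves both orders of \<open>A\<close> and its
        resolvent.\<close>
      have key: "K (vs[i := w1]) + cscale \<i> (K (vs[i := w2]))
          - cscale c (K (vs[i := v1]) + cscale \<i> (K (vs[i := v2]))) = K vs"
        if K: "K \<in> ?E" and w: "w1 - Re c *\<^sub>R v1 + Im c *\<^sub>R v2 = vs ! i" "w2 - Re c *\<^sub>R v2 - Im c *\<^sub>R v1 = 0"
          and vs: "length vs = k" for K vs w1 w2 v1 v2
      proof -
        note lin = multilinearD[OF decay_mapsD(1)[OF K] vs i]
        have "K (vs[i := w1]) + cscale \<i> (K (vs[i := w2]))
            - cscale c (K (vs[i := v1]) + cscale \<i> (K (vs[i := v2])))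
          = (K (vs[i := w1]) - Re c *\<^sub>R K (vs[i := v1]) + Im c *\<^sub>R K (vs[i := v2]))
            + cscale \<i> (K (vs[i := w2]) - Re c *\<^sub>R K (vs[i := v2]) - Im c *\<^sub>R K (vs[i := v1]))"
          by (rule bcontfun_eqI) (simp add: apply_cscale vec_eq_iff complex_eq_iff algebra_simps)
        also have "\<dots> = K (vs[i := w1 - Re c *\<^sub>R v1 + Im c *\<^sub>R v2])
            + cscale \<i> (K (vs[i := w2 - Re c *\<^sub>R v2 - Im c *\<^sub>R v1]))"
          by (simp only: linear_add[OF lin] linear_diff[OF lin] linear_scale[OF lin])
        also have "\<dots> = K vs"
          unfolding w using linear_0[OF lin] by (simp add: cscale_simps)
        finally show ?thesis .
      qed
      show ?thesis
      proof (intro bexI[OF _ b] ballI conjI)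
        fix K assume K: "K \<in> ?E"
        have m: "precomp_arg i B1 K \<in> ?E" "precomp_arg i B2 K \<in> ?E"
          using bounded_opsD(2)[OF precomp_ops[OF B(1) i], of K] bounded_opsD(2)[OF precomp_ops[OF B(2) i], of K] K
          by (simp_all add: ext_def)
        have bE: "\<beta> K vs = K (vs[i := B1 (vs ! i)]) + cscale \<i> (K (vs[i := B2 (vs ! i)]))"
          if "K \<in> ?E" for K vs
        proof -
          have "cscale (- \<i>) z = - cscale \<i> z" for z :: "('m, complex ^ 'n) linf"
            using cscale_simps(3)[of 0 \<i> z] by (simp add: cscale_simps)
          then show ?thesis
            using that by (simp add: \<beta>_def ext_def op_scl_def map_scale_def precomp_arg_def)
        qed
        have bK: "\<beta> K \<in> ?E" by (rule bounded_opsD(2)[OF b])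
        have off: "K vs = 0" if "K \<in> ?E" "length vs \<noteq> k" for K vs
          using decay_mapsD(2)[OF that] .
        have d: "?x i K - map_scale c K \<in> ?E"
          using bounded_opsD(2)[OF x[OF i]] K by (intro diff_E scl_E)
        show "\<beta> (?x i K - map_scale c K) = K"
        proof (rule ext)
          fix vs
          show "\<beta> (?x i K - map_scale c K) vs = K vs"
          proof (cases "length vs = k")
            case True
            have "\<beta> (?x i K - map_scale c K) vs
              = K (vs[i := A (B1 (vs ! i))]) + cscale \<i> (K (vs[i := A (B2 (vs ! i))]))
                - cscale c (K (vs[i := B1 (vs ! i)]) + cscale \<i> (K (vs[i := B2 (vs ! i)])))"
              unfolding bE[OF d] using True i K
              by (simp add: ext_def precomp_arg_def map_scale_def cscale_simps mult.commute)
            also have "\<dots> = K vs" by (rule key[OF K B(5,6) True])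
            finally show ?thesis .
          next
            case False
            then show ?thesis using off[OF bounded_opsD(2)[OF b]] off[OF K] by simp
          qed
        qed
        show "?x i (\<beta> K) - map_scale c (\<beta> K) = K"
        proof (rule ext)
          fix vs
          show "(?x i (\<beta> K) - map_scale c (\<beta> K)) vs = K vs"
          proof (cases "length vs = k")
            case True
            have "(?x i (\<beta> K) - map_scale c (\<beta> K)) vs
              = K (vs[i := B1 (A (vs ! i))]) + cscale \<i> (K (vs[i := B2 (A (vs ! i))]))
                - cscale c (K (vs[i := B1 (vs ! i)]) + cscale \<i> (K (vs[i := B2 (vs ! i)])))"
              using True i by (simp add: ext_def map_scale_def precomp_arg_def bK bE[OF K])
            also have "\<dots> = K vs" by (rule key[OF K B(3,4) True])
            finally show ?thesis .
          next
            case False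
            then show ?thesis
              using off[OF diff_E[OF bounded_opsD(2)[OF x[OF i]] scl_E[OF bK]]] off[OF K] by simp
          qed
        qed
      qed
    qed
    show "(\<Prod>i<k. c i) \<notin> ?S" if "\<And>i. i < k \<Longrightarrow> c i \<in> ?S" for c
      using nonres that by (auto simp: set_power_def)
    show "P 0 K = K" for K by (simp add: P_def)
    show "P (Suc i) K = P i (?x i K)" if "i < k" "K \<in> ?E" for i K
    proof (rule ext)
      fix vs
      show "P (Suc i) K vs = P i (?x i K) vs"
      proof (cases "length vs = k")
        case True
        then have "drop i vs = vs ! i # drop (Suc i) vs" using that by (simp add: Cons_nth_drop_Suc)
        with True that show ?thesis
          by (simp add: P_def ev precomp_arg_def nth_append take_Suc_conv_app_nth list_update_append)
      next
        case False
        then show ?thesis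
          using that by (simp add: P_def ev precomp_arg_def decay_mapsD(2)[OF that(2)])
      qed
    qed
  qed (simp_all add: QC)
  then obtain K where K: "K \<in> ?E" and eq: "?y K - P k K = QC" by blast
  have "A (re_linf (K vs)) - re_linf (K (map A vs)) = Q vs" if "length vs = k" for vs
  proof -
    have "complexify A (K vs) - K (map A vs) = complex_linf (Q vs) 0"
      using fun_cong[OF eq, of vs] that K by (simp add: ev postcomp_def P_def QC_def)
    from arg_cong[OF this, of re_linf] show ?thesis
      by (simp add: complexify_def linear_diff[OF linear_re_linf])
  qed
  moreover have "decay_multilinear \<Gamma> k (\<lambda>vs. re_linf (K vs))"
    unfolding decay_multilinear_def
    using multilinear_compose_linear[OF linear_re_linf decay_mapsD(1)[OF K]]
      decay_bound_map[OF decay_maps_bound[OF \<Gamma> K], of 1 re_linf] norm_re_im_linf(1) by auto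
  ultimately show ?thesis by blast
qed

section \<open>Taylor expansion\<close>

lemma bounded_linear_apply_linf:
  "bounded_linear (\<lambda>x :: ('m::finite, 'v::real_normed_vector) linf. x i)"
  by (rule bounded_linear_intro[where K = 1]) (auto intro: norm_bounded)

text \<open>
  Using \<^term>\<open>nhds 0\<close> instead of \<^term>\<open>at 0\<close> forces \<open>G 0 = 0\<close> for \<open>d > 0\<close>, which makes \<open>small\<close> stable
  under inner composition.
\<close>

definition small :: "nat \<Rightarrow> ('a::real_normed_vector \<Rightarrow> 'b::real_normed_vector) \<Rightarrow> bool" where
  "small d G \<longleftrightarrow> (\<forall>e>0. \<forall>\<^sub>F x in nhds 0. norm (G x) \<le> e * norm x ^ d)"

lemma mlin_norm_replicate_le:
  fixes N :: "'v::euclidean_space \<Rightarrow> real"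
  assumes "is_norm N"
  obtains c where "0 < c" "\<And>M b x. multilinear k M \<Longrightarrow> mlin_norm N k M \<le> ereal b \<Longrightarrow> 0 \<le> b \<Longrightarrow>
    norm (M (replicate k x) :: ('m::finite, 'v) linf) \<le> c * b * norm x ^ k"
proof -
  obtain c1 C1 where c1: "0 < c1" "0 < C1" "\<And>x :: ('m, 'v) linf. c1 * norm x \<le> linf_norm N x"
    "\<And>x :: ('m, 'v) linf. linf_norm N x \<le> C1 * norm x"
    using linf_norm_equiv[OF assms] by metis
  show thesis
  proof (rule that[of "C1 ^ k / c1"])
    show "0 < C1 ^ k / c1" using c1 by simp
    fix M :: "('m, 'v) linf list \<Rightarrow> ('m, 'v) linf" and b x
    assume M: "multilinear k M" and b: "mlin_norm N k M \<le> ereal b" "0 \<le> b"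
    show "norm (M (replicate k x)) \<le> C1 ^ k / c1 * b * norm x ^ k"
    \<comment> \<open>For \<open>k = 0\<close> the vector \<open>x = 0\<close> belongs to the second
      case, since the value on the empty list may be nonzero.\<close>
    proof (cases "x = 0 \<and> k \<noteq> 0")
      case True
      then have "M (replicate k x) = 0" by (intro multilinear_zero[OF M]) auto
      then show ?thesis using c1 b by simp
    next
      case False
      define s where "s = C1 * norm x"
      have s: "0 < s \<or> k = 0" using False c1 by (auto simp: s_def)
      let ?w = "(1 / s) *\<^sub>R x"
      have "linf_norm N ?w \<le> 1" if "k \<noteq> 0"
        using c1(4)[of ?w] s that c1(2) False by (auto simp: s_def)
      then have "ereal (linf_norm N (M (replicate k ?w))) \<le> mlin_norm N k M"
        unfolding mlin_norm_def by (intro SUP_upper) auto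
      also note b(1)
      finally have "c1 * norm (M (replicate k ?w)) \<le> b"
        using c1(3)[of "M (replicate k ?w)"] by simp
      then have w: "norm (M (replicate k ?w)) \<le> b / c1"
        using c1(1) by (simp add: field_simps)
      have "M (replicate k (s *\<^sub>R ?w)) = s ^ k *\<^sub>R M (replicate k ?w)"
        using multilinear_scale[OF M, of "replicate k ?w" "\<lambda>_. s"] by (simp add: prod_list_replicate)
      moreover have "replicate k (s *\<^sub>R ?w) = replicate k x"
        using s by auto
      ultimately have "norm (M (replicate k x)) = s ^ k * norm (M (replicate k ?w))"
        using s by (auto simp: zero_less_mult_iff power_abs)
      also have "\<dots> \<le> s ^ k * (b / c1)"
        using w s by (intro mult_left_mono) auto
      finally show ?thesis by (simp add: s_def power_mult_distrib mult_ac)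
    qed
  qed
qed

lemma multilinear_diff:
  assumes "multilinear k K" "multilinear k L"
  shows "multilinear k (\<lambda>vs. K vs - L vs)"
  using assms by (auto simp: multilinear_def intro: linear_compose_sub)

lemma multilinear_Cons:
  assumes "multilinear (Suc k) K"
  shows "multilinear k (\<lambda>vs. K (h # vs))"
  unfolding multilinear_def
proof (intro allI impI)
  fix vs :: "'a list" and i assume "length vs = k" "i < k"
  then show "linear (\<lambda>v. K (h # vs[i := v]))"
    using multilinearD[OF assms, of "h # vs" "Suc i"] by simp
qed

lemma multilinear_Cons_scale:
  assumes "multilinear (Suc k) K" "length vs = k"
  shows "K ((c *\<^sub>R x) # vs) = c *\<^sub>R K (x # vs)"
  using linear_scale[OF multilinearD[OF assms(1), of "x # vs" 0], of c x] assms(2) by simp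

text \<open>Along a ray all arguments of the derivatives agree, so their symmetry is not needed.\<close>

lemma ray_derivative:
  fixes x :: "('m::finite, real ^ 'n) linf"
  assumes N: "is_norm N" and Cr: "is_Cr_with_derivs N r U F D" and U: "open U" "t *\<^sub>R x \<in> U"
    and j: "j < r" and x: "x \<noteq> 0"
  shows "((\<lambda>t. D j (t *\<^sub>R x) (replicate j x)) has_vector_derivative
    D (Suc j) (t *\<^sub>R x) (replicate (Suc j) x)) (at t)"
  unfolding has_vector_derivative_def has_derivative_at_alt
proof (intro conjI allI impI)
  let ?y = "t *\<^sub>R x"
  show "bounded_linear (\<lambda>s. s *\<^sub>R D (Suc j) ?y (replicate (Suc j) x))"
    by (rule bounded_linear_scaleR_left)
  fix e :: real assume "e > 0"
  obtain c where c: "0 < c" "\<And>M b x. multilinear j M \<Longrightarrow> mlin_norm N j M \<le> ereal b \<Longrightarrow> 0 \<le> b \<Longrightarrow>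
    norm (M (replicate j x) :: ('m, real ^ 'n) linf) \<le> c * b * norm x ^ j"
    using mlin_norm_replicate_le[OF N] by metis
  obtain c1 C1 where c1: "0 < c1" "0 < C1" "\<And>x :: ('m, real ^ 'n) linf. c1 * norm x \<le> linf_norm N x"
    "\<And>x :: ('m, real ^ 'n) linf. linf_norm N x \<le> C1 * norm x"
    using linf_norm_equiv[OF N] by metis
  \<comment> \<open>\<open>norm x ^ j\<close> comes from the \<open>j\<close> arguments, one more
    factor from \<open>h = (s - t) *\<^sub>R x\<close>, and \<open>c\<close>, \<open>C1\<close> from
    the norm comparisons.\<close>
  define e' where "e' = e / (c * C1 * norm x ^ Suc j)"
  have e': "e' > 0" using \<open>e > 0\<close> c c1 x by (simp add: e'_def)
  let ?M = "\<lambda>h vs. D j (?y + h) vs - D j ?y vs - D (Suc j) ?y (h # vs)"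
  have ml: "multilinear i (D i z)" if "i \<le> r" "z \<in> U" for i z
    using Cr that by (auto simp: is_Cr_with_derivs_def)
  have "\<forall>\<^sub>F h in at 0. mlin_norm N j (?M h) \<le> ereal (e' * linf_norm N h)"
    using Cr j U(2) e' unfolding is_Cr_with_derivs_def by blast
  then obtain d1 where d1: "d1 > 0"
    "\<And>h. h \<noteq> 0 \<Longrightarrow> norm h < d1 \<Longrightarrow> mlin_norm N j (?M h) \<le> ereal (e' * linf_norm N h)"
    by (auto simp: eventually_at)
  obtain d2 where d2: "d2 > 0" "ball ?y d2 \<subseteq> U"
    using U by (meson open_contains_ball)
  show "\<exists>d>0. \<forall>s. norm (s - t) < d \<longrightarrow>
      norm (D j (s *\<^sub>R x) (replicate j x) - D j ?y (replicate j x)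
        - (s - t) *\<^sub>R D (Suc j) ?y (replicate (Suc j) x)) \<le> e * norm (s - t)"
  proof (intro exI[of _ "min d1 d2 / norm x"] conjI allI impI)
    show "0 < min d1 d2 / norm x" using d1 d2 x by simp
    fix s assume "norm (s - t) < min d1 d2 / norm x"
    define h where "h = (s - t) *\<^sub>R x"
    have h3: "norm h = \<bar>s - t\<bar> * norm x" by (simp add: h_def)
    have "\<bar>s - t\<bar> * norm x < min d1 d2"
      using \<open>norm (s - t) < min d1 d2 / norm x\<close> x
        pos_less_divide_eq[of "norm x" "\<bar>s - t\<bar>" "min d1 d2"] by simp
    then have h: "norm h < d1" "norm h < d2" "norm h = \<bar>s - t\<bar> * norm x" using h3 by auto
    have yh: "?y + h = s *\<^sub>R x" by (simp add: h_def algebra_simps)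
    show "norm (D j (s *\<^sub>R x) (replicate j x) - D j ?y (replicate j x)
        - (s - t) *\<^sub>R D (Suc j) ?y (replicate (Suc j) x)) \<le> e * norm (s - t)"
    proof (cases "s = t")
      case False
      then have "h \<noteq> 0" using x by (simp add: h_def)
      have "?y + h \<in> U" using d2 h by (auto simp: subset_iff dist_norm)
      then have mlM: "multilinear j (?M h)"
        using j U(2) by (intro multilinear_diff multilinear_Cons ml) auto
      have "0 \<le> linf_norm N h"
        using c1(3)[of h] c1(1) by (meson less_imp_le mult_nonneg_nonneg norm_ge_zero order_trans)
      then have "norm (?M h (replicate j x)) \<le> c * (e' * linf_norm N h) * norm x ^ j"
        using e' by (intro c(2) mlM d1(2) \<open>h \<noteq> 0\<close> h) auto
      also have "\<dots> \<le> c * (e' * (C1 * norm h)) * norm x ^ j"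
        using c(1) e' c1(4)[of h] by (intro mult_right_mono mult_left_mono) auto
      also have "\<dots> = e * norm (s - t)"
        using c(1) c1(2) x by (simp add: e'_def h field_simps)
      also have "?M h (replicate j x) = D j (s *\<^sub>R x) (replicate j x) - D j ?y (replicate j x)
        - (s - t) *\<^sub>R D (Suc j) ?y (replicate (Suc j) x)"
        unfolding yh using multilinear_Cons_scale[OF ml[OF _ U(2)], of j "replicate j x"] j
        by (simp add: h_def)
      finally show ?thesis .
    qed simp
  qed
qed

text \<open>The Taylor kernel has total mass \<open>1 / fact r\<close>, so the term of order
  \<open>r\<close> at the origin can be moved under the remainder integral.\<close>

lemma taylor_weight_integral:
  fixes c :: "'a::banach"
  assumes "0 < r"
  shows "((\<lambda>s. ((1 - s) ^ (r - 1) / fact (r - 1)) *\<^sub>R c) has_integral (1 / fact r) *\<^sub>R c) {0..1::real}"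
proof -
  obtain q where r: "r = Suc q" using assms by (cases r) auto
  have "((\<lambda>s. ((1 - s) ^ q / fact q) *\<^sub>R c) has_integral
      (- ((1 - 1) ^ Suc q / fact (Suc q))) *\<^sub>R c - (- ((1 - 0) ^ Suc q / fact (Suc q))) *\<^sub>R c) {0..1::real}"
  proof (rule fundamental_theorem_of_calculus)
    fix s :: real
    have "((\<lambda>s. - ((1 - s) ^ Suc q / fact (Suc q))) has_real_derivative
        real (Suc q) * (1 - s) ^ q / fact (Suc q)) (at s within {0..1})"
      by (auto intro!: derivative_eq_intros simp del: fact_Suc of_nat_Suc power_Suc)
    moreover have "real (Suc q) * (1 - s) ^ q / fact (Suc q) = (1 - s) ^ q / fact q"
      by (simp del: of_nat_Suc)
    ultimately have "((\<lambda>s. - ((1 - s) ^ Suc q / fact (Suc q))) has_real_derivative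
        (1 - s) ^ q / fact q) (at s within {0..1})" by simp
    then show "((\<lambda>s. (- ((1 - s) ^ Suc q / fact (Suc q))) *\<^sub>R c) has_vector_derivative
        ((1 - s) ^ q / fact q) *\<^sub>R c) (at s within {0..1})"
      by (rule has_vector_derivative_scaleR[where g = "\<lambda>_. c" and g' = 0, simplified])
  qed simp
  then show ?thesis by (simp add: r)
qed

text \<open>The derivative of order \<open>r\<close> is merely continuous. So Taylor's formula is
  used up to order \<open>r - 1\<close> with integral remainder, and the term of order
  \<open>r\<close> is subtracted under the integral, where continuity at \<open>0\<close> makes the
  difference small. This is done at each lattice site, with a bound independent of the site.\<close>

theorem taylor_small:
  fixes F :: "('m::finite, real ^ 'n) linf \<Rightarrow> ('m, real ^ 'n) linf"
  assumes N: "is_norm N" and Cr: "is_Cr_with_derivs N r U F D" and U: "open U" "0 \<in> U"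
    and F0: "F 0 = 0" and r: "1 \<le> r"
  shows "small r (\<lambda>x. F x - (\<Sum>j=1..r. (1 / fact j) *\<^sub>R D j 0 (replicate j x)))"
  unfolding small_def
proof (intro allI impI)
  fix e :: real assume "e > 0"
  obtain c where c: "0 < c" "\<And>M b x. multilinear r M \<Longrightarrow> mlin_norm N r M \<le> ereal b \<Longrightarrow> 0 \<le> b \<Longrightarrow>
    norm (M (replicate r x) :: ('m, real ^ 'n) linf) \<le> c * b * norm x ^ r"
    using mlin_norm_replicate_le[OF N] by metis
  have ml: "multilinear i (D i z)" if "i \<le> r" "z \<in> U" for i z
    using Cr that by (auto simp: is_Cr_with_derivs_def)
  have D0: "D 0 z [] = F z" if "z \<in> U" for z using Cr that by (auto simp: is_Cr_with_derivs_def)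
  have ec: "e / c > 0" using \<open>e > 0\<close> c by simp
  have "\<forall>\<^sub>F y in at 0 within U. mlin_norm N r (\<lambda>vs. D r y vs - D r 0 vs) \<le> ereal (e / c)"
    using Cr U(2) ec unfolding is_Cr_with_derivs_def by blast
  then obtain d1 where d1: "d1 > 0" "\<And>y. y \<in> U \<Longrightarrow> y \<noteq> 0 \<Longrightarrow> norm y < d1 \<Longrightarrow>
      mlin_norm N r (\<lambda>vs. D r y vs - D r 0 vs) \<le> ereal (e / c)"
    by (auto simp: eventually_at)
  obtain d2 where d2: "d2 > 0" "ball 0 d2 \<subseteq> U"
    using U by (meson open_contains_ball)
  have "norm (F x - (\<Sum>j=1..r. (1 / fact j) *\<^sub>R D j 0 (replicate j x))) \<le> e * norm x ^ r"
    if x: "norm x < min d1 d2" for x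
  proof (cases "x = 0")
    case True
    have "D j 0 (replicate j 0) = 0" if "j \<in> {1..r}" for j
      using that U(2) by (intro multilinear_zero[OF ml]) auto
    then show ?thesis using True \<open>e > 0\<close> F0 by simp
  next
    case False
    have tx: "t *\<^sub>R x \<in> U" "norm (t *\<^sub>R x) < d1" if "t \<in> {0..1}" for t
    proof -
      have "norm (t *\<^sub>R x) \<le> norm x" using that by (simp add: mult_left_le_one_le)
      then show "t *\<^sub>R x \<in> U" "norm (t *\<^sub>R x) < d1" using x d2 by auto
    qed
    have diff: "norm (D r (t *\<^sub>R x) (replicate r x) - D r 0 (replicate r x)) \<le> e * norm x ^ r"
      if t: "t \<in> {0..1}" for t
    proof (cases "t = 0")
      case False
      have "norm (D r (t *\<^sub>R x) (replicate r x) - D r 0 (replicate r x)) \<le> c * (e / c) * norm x ^ r"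
        using tx[OF t] False \<open>x \<noteq> 0\<close> ec U(2)
        by (intro c(2)[where M = "\<lambda>vs. D r (t *\<^sub>R x) vs - D r 0 vs"] multilinear_diff ml d1(2)) auto
      then show ?thesis using c(1) by simp
    qed (use \<open>e > 0\<close> in simp)
    show ?thesis
    proof (rule norm_bound)
      fix i
      define Df where "Df m t = D m (t *\<^sub>R x) (replicate m x) i" for m t
      have der: "(Df m has_vector_derivative Df (Suc m) t) (at t within {0..1})"
        if "m < r" "0 \<le> t" "t \<le> 1" for m t
      proof -
        have tU: "t *\<^sub>R x \<in> U" using tx(1)[of t] that by simp
        show ?thesis
          unfolding Df_def
          by (rule bounded_linear.has_vector_derivative[OF bounded_linear_apply_linf
                has_vector_derivative_at_within[OF ray_derivative[OF N Cr U(1) tU that(1) False]]])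
      qed
      have "((\<lambda>s. ((1 - s) ^ (r - 1) / fact (r - 1)) *\<^sub>R Df r s) has_integral
          Df 0 1 - (\<Sum>m<r. ((1 - 0) ^ m / fact m) *\<^sub>R Df m 0)) {0..1}"
        using r der by (intro Taylor_has_integral) auto
      from has_integral_diff[OF this taylor_weight_integral[of r "Df r 0"]] r
      have "((\<lambda>s. ((1 - s) ^ (r - 1) / fact (r - 1)) *\<^sub>R (Df r s - Df r 0)) has_integral
          Df 0 1 - (\<Sum>m<r. (1 / fact m) *\<^sub>R Df m 0) - (1 / fact r) *\<^sub>R Df r 0) (cbox 0 1)"
        by (simp add: scaleR_diff_right)
      then have "norm (Df 0 1 - (\<Sum>m<r. (1 / fact m) *\<^sub>R Df m 0) - (1 / fact r) *\<^sub>R Df r 0)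
          \<le> (e * norm x ^ r) * measure lborel (cbox 0 (1::real))"
      proof (rule has_integral_bound[rotated])
        show "0 \<le> e * norm x ^ r" using \<open>e > 0\<close> by simp
        fix s :: real assume s: "s \<in> cbox 0 1"
        have w: "0 \<le> (1 - s) ^ (r - 1) / fact (r - 1)" "(1 - s) ^ (r - 1) / fact (r - 1) \<le> 1"
        proof -
          have "(1 - s) ^ (r - 1) \<le> 1" using s by (intro power_le_one) auto
          also have "1 \<le> (fact (r - 1) :: real)" by (rule fact_ge_1)
          finally show "(1 - s) ^ (r - 1) / fact (r - 1) \<le> 1" by simp
        qed (use s in auto)
        have "norm (Df r s - Df r 0) \<le> e * norm x ^ r"
          using order_trans[OF norm_bounded diff[of s], of i] s by (simp add: Df_def)
        with w have "(1 - s) ^ (r - 1) / fact (r - 1) * norm (Df r s - Df r 0) \<le> 1 * (e * norm x ^ r)"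
          by (intro mult_mono) simp_all
        then show "norm (((1 - s) ^ (r - 1) / fact (r - 1)) *\<^sub>R (Df r s - Df r 0)) \<le> e * norm x ^ r"
          by (simp only: norm_scaleR abs_of_nonneg[OF w(1)] mult_1)
      qed
      moreover have "Df 0 1 - (\<Sum>m<r. (1 / fact m) *\<^sub>R Df m 0) - (1 / fact r) *\<^sub>R Df r 0
        = (F x - (\<Sum>j=1..r. (1 / fact j) *\<^sub>R D j 0 (replicate j x))) i"
      proof -
        have "(\<Sum>m<r. (1 / fact m) *\<^sub>R Df m 0) + (1 / fact r) *\<^sub>R Df r 0 = (\<Sum>m\<le>r. (1 / fact m) *\<^sub>R Df m 0)"
          by (simp add: lessThan_Suc_atMost[symmetric])
        also have "\<dots> = Df 0 0 + (\<Sum>j=1..r. (1 / fact j) *\<^sub>R Df j 0)"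
          by (simp add: atMost_atLeast0 sum.atLeast_Suc_atMost)
        finally show ?thesis
          using D0[of x] D0[of 0] tx(1)[of 1] U(2) F0
          by (simp add: Df_def apply_sum_linf algebra_simps)
      qed
      ultimately show "norm ((F x - (\<Sum>j=1..r. (1 / fact j) *\<^sub>R D j 0 (replicate j x))) i) \<le> e * norm x ^ r"
        by simp
    qed
  qed
  then show "\<forall>\<^sub>F x in nhds 0. norm (F x - (\<Sum>j=1..r. (1 / fact j) *\<^sub>R D j 0 (replicate j x))) \<le> e * norm x ^ r"
    unfolding eventually_nhds_metric using d1 d2 by (intro exI[of _ "min d1 d2"]) (auto simp: dist_norm)
qed

section \<open>Polynomial maps with decay\<close>

lemma smallD: "small d G \<Longrightarrow> 0 < e \<Longrightarrow> \<forall>\<^sub>F x in nhds 0. norm (G x) \<le> e * norm x ^ d"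
  by (simp add: small_def)

lemma small_add:
  assumes "small d G" "small d H"
  shows "small d (\<lambda>x. G x + H x)"
  unfolding small_def
proof (intro allI impI)
  fix e :: real assume "e > 0"
  then have half: "0 < e/2" by simp
  have "\<forall>\<^sub>F x in nhds 0. norm (G x) \<le> e/2 * norm x ^ d" "\<forall>\<^sub>F x in nhds 0. norm (H x) \<le> e/2 * norm x ^ d"
    using smallD[OF assms(1) half] smallD[OF assms(2) half] by auto
  then show "\<forall>\<^sub>F x in nhds 0. norm (G x + H x) \<le> e * norm x ^ d"
  proof eventually_elim
    case (elim x)
    then show ?case using norm_triangle_ineq[of "G x" "H x"] by linarith
  qed
qed

lemma small_minus: "small d G \<Longrightarrow> small d (\<lambda>x. - G x)"
  by (simp add: small_def)

lemma small_diff: "small d G \<Longrightarrow> small d H \<Longrightarrow> small d (\<lambda>x. G x - H x)"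
  using small_add[OF _ small_minus, of d G H] by simp

lemma eventually_nhds_norm_le: "0 < c \<Longrightarrow> \<forall>\<^sub>F x in nhds 0. norm (x :: 'a::real_normed_vector) \<le> c"
  unfolding eventually_nhds_metric by (intro exI[of _ c]) auto

lemma small_mono:
  assumes "small d G" "k \<le> d"
  shows "small k G"
  unfolding small_def
proof (intro allI impI)
  fix e :: real assume e: "e > 0"
  show "\<forall>\<^sub>F x in nhds 0. norm (G x) \<le> e * norm x ^ k"
    using smallD[OF assms(1) e] eventually_nhds_norm_le[OF zero_less_one]
  proof eventually_elim
    case (elim x)
    then have "e * norm x ^ d \<le> e * norm x ^ k"
      using e assms(2) by (intro mult_left_mono power_decreasing) auto
    then show ?case using elim by linarith
  qed
qed

lemma small_bigI:
  assumes "\<forall>\<^sub>F x in nhds 0. norm (G x) \<le> C * norm x ^ Suc d"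
  shows "small d G"
  unfolding small_def
proof (intro allI impI)
  fix e :: real assume e: "e > 0"
  have "0 < e / (\<bar>C\<bar> + 1)" using e by simp
  from assms eventually_nhds_norm_le[OF this]
  show "\<forall>\<^sub>F x in nhds 0. norm (G x) \<le> e * norm x ^ d"
  proof eventually_elim
    case (elim x)
    have "C * norm x \<le> (\<bar>C\<bar> + 1) * (e / (\<bar>C\<bar> + 1))"
      using elim(2) by (intro mult_mono) auto
    also have "\<dots> = e" by simp
    finally have "C * norm x * norm x ^ d \<le> e * norm x ^ d" by (intro mult_right_mono) auto
    then show ?case using elim(1) by (simp add: mult_ac)
  qed
qed

lemma small_compose:
  assumes G: "small d G" and K: "\<forall>\<^sub>F x in nhds 0. norm (K x) \<le> C * norm x"
  shows "small d (\<lambda>x. G (K x))"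
  unfolding small_def
proof (intro allI impI)
  fix e :: real assume e: "e > 0"
  define C' where "C' = \<bar>C\<bar> + 1"
  have C': "C' > 0" "C \<le> C'" by (auto simp: C'_def)
  have "e / C' ^ d > 0" using e C' by simp
  from smallD[OF G this] obtain \<delta> where \<delta>: "\<delta> > 0" "\<And>y. norm y < \<delta> \<Longrightarrow> norm (G y) \<le> e / C' ^ d * norm y ^ d"
    unfolding eventually_nhds_metric dist_0_norm dist_commute[of _ 0] by blast
  have "0 < \<delta> / (2 * C')" using \<delta> C' by simp
  from K eventually_nhds_norm_le[OF this]
  show "\<forall>\<^sub>F x in nhds 0. norm (G (K x)) \<le> e * norm x ^ d"
  proof eventually_elim
    case (elim x)
    have Kx: "norm (K x) \<le> C' * norm x"
      using elim(1) mult_right_mono[OF C'(2) norm_ge_zero[of x]] by linarith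
    also have "\<dots> \<le> C' * (\<delta> / (2 * C'))" using elim C' by (intro mult_left_mono) auto
    also have "\<dots> < \<delta>" using \<delta> C' by simp
    finally have "norm (G (K x)) \<le> e / C' ^ d * norm (K x) ^ d" by (rule \<delta>)
    also have "\<dots> \<le> e / C' ^ d * (C' * norm x) ^ d"
      using Kx e C' by (intro mult_left_mono power_mono) auto
    also have "\<dots> = e * norm x ^ d" using C' by (simp add: power_mult_distrib)
    finally show ?case .
  qed
qed

section \<open>Polynomials graded by their lowest degree\<close>

lemma decay_multilinear_zero: "decay_multilinear \<Gamma> k (\<lambda>_. 0)"
  unfolding decay_multilinear_def multilinear_def
  by (intro conjI allI impI exI[of _ 0] linear_zero) (simp add: decay_bound_def)

lemma decay_multilinear_add:
  assumes "decay_function \<Gamma>" "decay_multilinear \<Gamma> k K" "decay_multilinear \<Gamma> k L"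
  shows "decay_multilinear \<Gamma> k (\<lambda>vs. K vs + L vs)"
proof -
  obtain C C' where "decay_bound \<Gamma> k K C" "decay_bound \<Gamma> k L C'"
    using assms by (auto simp: decay_multilinear_def)
  from decay_bound_add[OF assms(1) this] show ?thesis
    using assms(2,3) unfolding decay_multilinear_def by (intro conjI exI multilinear_add) simp_all
qed

lemma decay_multilinear_scaleR:
  fixes K :: "('m::finite, 'a::real_normed_vector) linf list \<Rightarrow> ('m, 'b::real_normed_vector) linf"
  assumes "decay_multilinear \<Gamma> k K"
  shows "decay_multilinear \<Gamma> k (\<lambda>vs. c *\<^sub>R K vs)"
proof -
  obtain C where "decay_bound \<Gamma> k K C" using assms by (auto simp: decay_multilinear_def)
  then have "decay_bound \<Gamma> k (\<lambda>vs. c *\<^sub>R K vs) (\<bar>c\<bar> * C)"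
    by (rule decay_bound_map) auto
  moreover have "multilinear k (\<lambda>vs. c *\<^sub>R K vs)"
    using assms by (simp add: decay_multilinear_def multilinear_compose_linear[OF linear_scaleR, where k = k and K = K])
  ultimately show ?thesis unfolding decay_multilinear_def by blast
qed

text \<open>Polynomials whose terms have degree at least \<open>m\<close>, with no limit on the
  degree from above: composition raises degrees, and the estimates concern the lowest order. The
  inductive form reduces closure properties to monomials.\<close>

inductive poly_decay :: "(int ^ 'm::finite \<Rightarrow> real) \<Rightarrow> nat \<Rightarrow>
    (('m, 'v::real_normed_vector) linf \<Rightarrow> ('m, 'v) linf) \<Rightarrow> bool"
  for \<Gamma> :: "int ^ 'm::finite \<Rightarrow> real" and m where
  monomial: "m \<le> j \<Longrightarrow> decay_multilinear \<Gamma> j p \<Longrightarrow> poly_decay \<Gamma> m (\<lambda>x. p (replicate j x))"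
| zero: "poly_decay \<Gamma> m (\<lambda>_. 0)"
| add: "poly_decay \<Gamma> m P \<Longrightarrow> poly_decay \<Gamma> m Q \<Longrightarrow> poly_decay \<Gamma> m (\<lambda>x. P x + Q x)"

lemma poly_decay_sum: "(\<And>i. i \<in> I \<Longrightarrow> poly_decay \<Gamma> m (P i)) \<Longrightarrow> poly_decay \<Gamma> m (\<lambda>x. \<Sum>i\<in>I. P i x)"
  by (induction I rule: infinite_finite_induct) (simp_all add: poly_decay.zero poly_decay.add)

lemma poly_decay_mono: "poly_decay \<Gamma> m P \<Longrightarrow> k \<le> m \<Longrightarrow> poly_decay \<Gamma> k P"
proof (induction rule: poly_decay.induct)
  case (monomial j p)
  then show ?case by (intro poly_decay.monomial) auto
qed (simp_all add: poly_decay.zero poly_decay.add)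

lemma poly_decay_scaleR: "poly_decay \<Gamma> m P \<Longrightarrow> poly_decay \<Gamma> m (\<lambda>x. c *\<^sub>R P x)"
proof (induction rule: poly_decay.induct)
  case (monomial j p)
  then show ?case using poly_decay.monomial[OF monomial(1) decay_multilinear_scaleR[OF monomial(2), of c]] by simp
qed (simp_all add: scaleR_add_right poly_decay.zero poly_decay.add)

lemma poly_decay_diff:
  assumes "poly_decay \<Gamma> m P" "poly_decay \<Gamma> m Q"
  shows "poly_decay \<Gamma> m (\<lambda>x. P x - Q x)"
  using poly_decay.add[OF assms(1) poly_decay_scaleR[OF assms(2), of "-1"]] by simp

lemma poly_decay_linear: "decay_linear \<Gamma> A \<Longrightarrow> poly_decay \<Gamma> 1 A"
  using poly_decay.monomial[OF order_refl, of \<Gamma> 1 "\<lambda>vs. A (hd vs)"] unfolding decay_linear_def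
  by (simp only: One_nat_def replicate.simps list.sel)

text \<open>The decay bound is an issue at \<open>i = l\<close> only. There
  \<open>\<Gamma> 0\<close> can be less than \<open>1\<close>, so the constant contains
  \<open>1 / \<Gamma> 0\<close>.\<close>

lemma decay_linear_id:
  assumes \<Gamma>: "decay_function \<Gamma>"
  shows "decay_linear \<Gamma> (\<lambda>x :: ('m::finite, 'v::real_normed_vector) linf. x)"
proof -
  define G where "G = 1 / \<Gamma> 0"
  have G: "G > 0" "1 \<le> G * \<Gamma> 0" using decay_functionD(1)[OF \<Gamma>, of 0] by (auto simp: G_def)
  show ?thesis
  proof (rule decay_linearI[where M = "1 + G"])
    show "norm u \<le> (1 + G) * norm u" for u :: "('m, 'v) linf" using G by (simp add: algebra_simps)
    show "norm (w i) \<le> (1 + G) * \<Gamma> (i - l) * norm w" if "supported_at l w" for l i and w :: "('m, 'v) linf"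
    proof (cases "i = l")
      case True
      have "norm (w i) \<le> 1 * norm w" using norm_bounded[of w i] by simp
      also have "\<dots> \<le> (1 + G) * \<Gamma> 0 * norm w"
        using G decay_functionD(1)[OF \<Gamma>, of 0] by (intro mult_right_mono) (auto simp: algebra_simps)
      finally show ?thesis using True by simp
    next
      case False
      then have "w i = 0" using that by (simp add: supported_at_def)
      then show ?thesis using G decay_functionD(1)[OF \<Gamma>, of "i - l"] by simp
    qed
  qed (use G in \<open>simp_all add: linear_id[unfolded id_def]\<close>)
qed

text \<open>The expansion holds for every large \<open>d\<close>, with zero coefficients beyond
  \<open>D\<close>, so that two polynomials can be added with a common upper limit.\<close>

lemma poly_decay_coeffs:
  assumes \<Gamma>: "decay_function \<Gamma>" and "poly_decay \<Gamma> m P"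
  shows "\<exists>p D. (\<forall>j. decay_multilinear \<Gamma> j (p j)) \<and> (\<forall>j x. j < m \<or> D < j \<longrightarrow> p j x = 0) \<and>
    (\<forall>d\<ge>D. \<forall>x. P x = (\<Sum>j=m..d. p j (replicate j x)))"
  using assms(2)
proof (induction rule: poly_decay.induct)
  case (monomial j q)
  define p where "p = (\<lambda>i. if i = j then q else (\<lambda>_. 0))"
  have "(\<Sum>i=m..d. p i (replicate i x)) = q (replicate j x)" if "j \<le> d" for d x
    using monomial(1) that by (subst sum.remove[of _ j]) (auto simp: p_def)
  then show ?case
    using monomial by (intro exI[of _ p] exI[of _ j]) (auto simp: p_def decay_multilinear_zero)
next
  case zero
  show ?case by (intro exI[of _ "\<lambda>_ _. 0"]) (auto simp: decay_multilinear_zero)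
next
  case (add P Q)
  obtain p D where p: "\<And>j. decay_multilinear \<Gamma> j (p j)" "\<And>j x. j < m \<or> D < j \<Longrightarrow> p j x = 0"
    "\<And>d x. d \<ge> D \<Longrightarrow> P x = (\<Sum>j=m..d. p j (replicate j x))" using add.IH(1) by blast
  obtain q D' where q: "\<And>j. decay_multilinear \<Gamma> j (q j)" "\<And>j x. j < m \<or> D' < j \<Longrightarrow> q j x = 0"
    "\<And>d x. d \<ge> D' \<Longrightarrow> Q x = (\<Sum>j=m..d. q j (replicate j x))" using add.IH(2) by blast
  show ?case
    by (intro exI[of _ "\<lambda>j vs. p j vs + q j vs"] exI[of _ "max D D'"] conjI allI impI)
      (use p q in \<open>auto simp: sum.distrib intro!: decay_multilinear_add[OF \<Gamma>]\<close>)
qed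

lemma decay_multilinear_replicate_bound:
  assumes "decay_multilinear \<Gamma> j p"
  obtains C where "0 \<le> C" "\<And>x. norm (p (replicate j x)) \<le> C * norm x ^ j"
proof -
  obtain C where C: "decay_bound \<Gamma> j p C" using assms by (auto simp: decay_multilinear_def)
  have "norm (p (replicate j x)) \<le> C * norm x ^ j" for x
    using decay_boundD(2)[OF C, of "replicate j x"] by (simp add: prod_list_replicate)
  then show thesis using that decay_boundD(1)[OF C] by blast
qed

lemma poly_decay_big:
  assumes "poly_decay \<Gamma> m P"
  obtains C where "0 \<le> C" "\<And>x. norm x \<le> 1 \<Longrightarrow> norm (P x) \<le> C * norm x ^ m"
proof -
  have "\<exists>C\<ge>0. \<forall>x. norm x \<le> 1 \<longrightarrow> norm (P x) \<le> C * norm x ^ m"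
    using assms
  proof (induction rule: poly_decay.induct)
    case (monomial j p)
    obtain C where C: "0 \<le> C" "\<And>x. norm (p (replicate j x)) \<le> C * norm x ^ j"
      using decay_multilinear_replicate_bound[OF monomial(2)] by metis
    have "norm (p (replicate j x)) \<le> C * norm x ^ m" if "norm x \<le> 1" for x
      by (rule order_trans[OF C(2)]) (intro mult_left_mono power_decreasing monomial(1) that C(1) norm_ge_zero)
    then show ?case using C(1) by blast
  next
    case (add P Q)
    then obtain C C' where C: "0 \<le> C" "\<And>x. norm x \<le> 1 \<Longrightarrow> norm (P x) \<le> C * norm x ^ m"
      "0 \<le> C'" "\<And>x. norm x \<le> 1 \<Longrightarrow> norm (Q x) \<le> C' * norm x ^ m" by metis
    have "norm (P x + Q x) \<le> (C + C') * norm x ^ m" if "norm x \<le> 1" for x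
      using norm_triangle_ineq[of "P x" "Q x"] C(2,4)[OF that] by (simp add: algebra_simps)
    then show ?case using C(1,3) by (metis add_nonneg_nonneg)
  qed auto
  then show thesis using that by blast
qed

lemma small_poly_decay:
  assumes "poly_decay \<Gamma> (Suc d) P"
  shows "small d P"
proof -
  obtain C where C: "\<And>x. norm x \<le> 1 \<Longrightarrow> norm (P x) \<le> C * norm x ^ Suc d"
    by (rule poly_decay_big[OF assms]) blast
  have "\<forall>\<^sub>F x in nhds 0. norm (P x) \<le> C * norm x ^ Suc d"
    using eventually_nhds_norm_le[OF zero_less_one] by (rule eventually_mono) (rule C)
  then show ?thesis by (rule small_bigI)
qed

text \<open>The copies of \<open>K x\<close> are expanded one at a time. A monomial
  \<open>p j\<close> of the first copy is absorbed into the multilinear map by \<open>slot\<close>,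
  and its \<open>j\<close> arguments join the block of copies of \<open>x\<close>; as
  \<open>1 \<le> j\<close>, the total degree does not drop below \<open>m\<close>.\<close>

lemma poly_decay_slots:
  assumes \<Gamma>: "decay_function \<Gamma>" and K: "poly_decay \<Gamma> 1 K"
  shows "decay_multilinear \<Gamma> (s + k) G \<Longrightarrow> m \<le> s + k \<Longrightarrow>
    poly_decay \<Gamma> m (\<lambda>x. G (replicate s x @ replicate k (K x)))"
proof (induction k arbitrary: s G)
  case 0
  then show ?case using poly_decay.monomial[of m s \<Gamma> G] by simp
next
  case (Suc k)
  obtain p D where p: "\<And>j. decay_multilinear \<Gamma> j (p j)"
    "\<And>x. K x = (\<Sum>j=1..D. p j (replicate j x))"
  proof -
    obtain p D where "\<forall>j. decay_multilinear \<Gamma> j (p j)"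
      "\<forall>d\<ge>D. \<forall>x. K x = (\<Sum>j=1..d. p j (replicate j x))"
      using poly_decay_coeffs[OF \<Gamma> K] by (elim exE conjE) (rule that)
    then show thesis by (intro that[of p D]) auto
  qed
  have G: "decay_multilinear \<Gamma> (Suc (s + k)) G" using Suc.prems by simp
  have eq: "G (replicate s x @ replicate (Suc k) (K x))
    = (\<Sum>j=1..D. slot s j G (p j) (replicate (s + j) x @ replicate k (K x)))" for x
  proof -
    let ?ws = "replicate s x @ 0 # replicate k (K x)"
    have lin: "linear (\<lambda>v. G (?ws[s := v]))"
      by (rule multilinearD[of "Suc (s + k)" G ?ws s]) (use G in \<open>simp_all add: decay_multilinear_def\<close>)
    have upd: "?ws[s := v] = replicate s x @ v # replicate k (K x)" for v
      by (simp add: list_update_append)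
    have "G (replicate s x @ replicate (Suc k) (K x)) = G (?ws[s := \<Sum>j=1..D. p j (replicate j x)])"
      unfolding upd by (simp add: p(2))
    also have "\<dots> = (\<Sum>j=1..D. G (?ws[s := p j (replicate j x)]))"
      by (rule linear_sum[OF lin])
    finally show ?thesis
      unfolding upd by (simp add: slot_def replicate_add)
  qed
  have "poly_decay \<Gamma> m (\<lambda>x. slot s j G (p j) (replicate (s + j) x @ replicate k (K x)))"
    if j: "j \<in> {1..D}" for j
  proof (rule Suc.IH)
    show "decay_multilinear \<Gamma> (s + j + k) (slot s j G (p j))"
      using decay_multilinear_slot[OF \<Gamma> G p(1), of s j] by (simp add: add_ac)
    show "m \<le> s + j + k" using Suc.prems(2) j by simp
  qed
  then have "poly_decay \<Gamma> m (\<lambda>x. \<Sum>j=1..D. slot s j G (p j) (replicate (s + j) x @ replicate k (K x)))"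
    by (rule poly_decay_sum)
  then show ?case by (simp only: eq)
qed

lemma poly_decay_compose:
  assumes \<Gamma>: "decay_function \<Gamma>" and K: "poly_decay \<Gamma> 1 K" and P: "poly_decay \<Gamma> m P"
  shows "poly_decay \<Gamma> m (\<lambda>x. P (K x))"
  using P
proof (induction rule: poly_decay.induct)
  case (monomial j p)
  then show ?case using poly_decay_slots[OF \<Gamma> K, of 0 j p m] by simp
qed (simp_all add: poly_decay.zero poly_decay.add)

text \<open>Replacing \<open>z\<close> by \<open>y\<close> one argument at a time gives
  \<open>j\<close> differences, each linear in \<open>y - z\<close>; hence the factor
  \<open>real j\<close> in the final constant.\<close>

lemma monomial_lipschitz:
  assumes "decay_multilinear \<Gamma> j p"
  obtains C where "0 \<le> C" "\<And>y z M. norm y \<le> M \<Longrightarrow> norm z \<le> M \<Longrightarrow>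
    norm (p (replicate j y) - p (replicate j z)) \<le> C * M ^ (j - 1) * norm (y - z)"
proof -
  obtain C where C: "decay_bound \<Gamma> j p C" and ml: "multilinear j p"
    using assms by (auto simp: decay_multilinear_def)
  have "norm (p (replicate j y) - p (replicate j z)) \<le> C * real j * M ^ (j - 1) * norm (y - z)"
    if M: "norm y \<le> M" "norm z \<le> M" for y z M
  proof -
    have M0: "0 \<le> M" using M(1) norm_ge_zero order_trans by blast
    have "norm (p (replicate a y @ replicate (j - a) z) - p (replicate j z))
        \<le> C * real a * M ^ (j - 1) * norm (y - z)" if "a \<le> j" for a
      using that
    proof (induction a)
      case (Suc a)
      define b where "b = j - Suc a"
      have j: "j = Suc (a + b)" using Suc.prems by (simp add: b_def)
      let ?ws = "\<lambda>v. replicate a y @ v # replicate b z"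
      have upd: "(?ws 0)[a := v] = ?ws v" for v by (simp add: list_update_append)
      have lin: "linear (\<lambda>v. p (?ws v))"
        using multilinearD[OF ml, of "?ws 0" a] j unfolding upd by simp
      have "norm (p (?ws (y - z))) \<le> C * (norm y ^ a * (norm (y - z) * norm z ^ b))"
        using decay_boundD(2)[OF C, of "?ws (y - z)"] j by (simp add: prod_list_replicate)
      also have "\<dots> \<le> C * (M ^ a * (norm (y - z) * M ^ b))"
        using decay_boundD(1)[OF C] M M0 by (intro mult_left_mono mult_mono power_mono) auto
      also have "\<dots> = C * M ^ (j - 1) * norm (y - z)" by (simp add: j power_add mult_ac)
      finally have 1: "norm (p (?ws y) - p (?ws z)) \<le> C * M ^ (j - 1) * norm (y - z)"
        by (simp add: linear_diff[OF lin])
      have eq: "replicate (Suc a) y @ replicate (j - Suc a) z = ?ws y"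
        "replicate a y @ replicate (j - a) z = ?ws z"
        using j by (simp_all add: replicate_app_Cons_same)
      have "norm (p (?ws z) - p (replicate j z)) \<le> C * real a * M ^ (j - 1) * norm (y - z)"
        using Suc unfolding eq by simp
      then show ?case
        unfolding eq using norm_triangle_ineq[of "p (?ws y) - p (?ws z)" "p (?ws z) - p (replicate j z)"] 1
        by (simp add: algebra_simps)
    qed simp
    from this[of j] show ?thesis by simp
  qed
  then show thesis using that[of "C * real j"] decay_boundD(1)[OF C] by simp
qed

text \<open>Degree at least two leaves a small factor besides \<open>y - z\<close>; it is the gain
  of one order in \<open>small_poly_perturb\<close>.\<close>

lemma poly_decay_lipschitz:
  assumes "poly_decay \<Gamma> 2 P"
  obtains C where "0 \<le> C" "\<And>y z. norm y \<le> 1 \<Longrightarrow> norm z \<le> 1 \<Longrightarrow>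
    norm (P y - P z) \<le> C * (norm y + norm z) * norm (y - z)"
proof -
  have "\<exists>C\<ge>0. \<forall>y z. norm y \<le> 1 \<longrightarrow> norm z \<le> 1 \<longrightarrow>
      norm (P y - P z) \<le> C * (norm y + norm z) * norm (y - z)"
    using assms
  proof (induction rule: poly_decay.induct)
    case (monomial j p)
    obtain C where C: "0 \<le> C" "\<And>y z M. norm y \<le> M \<Longrightarrow> norm z \<le> M \<Longrightarrow>
        norm (p (replicate j y) - p (replicate j z)) \<le> C * M ^ (j - 1) * norm (y - z)"
      using monomial_lipschitz[OF monomial(2)] by metis
    have "norm (p (replicate j y) - p (replicate j z)) \<le> C * (norm y + norm z) * norm (y - z)"
      if yz: "norm y \<le> 1" "norm z \<le> 1" for y z
    proof -
      let ?M = "max (norm y) (norm z)"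
      have "?M ^ (j - 1) \<le> ?M ^ 1"
        using monomial(1) yz by (intro power_decreasing) (auto simp: le_max_iff_disj)
      also have "\<dots> \<le> norm y + norm z" by auto
      finally have "C * ?M ^ (j - 1) * norm (y - z) \<le> C * (norm y + norm z) * norm (y - z)"
        using C(1) by (intro mult_right_mono mult_left_mono) auto
      then show ?thesis using C(2)[of y ?M z] by simp
    qed
    then show ?case using C(1) by blast
  next
    case (add P Q)
    then obtain C C' where C: "0 \<le> C" "\<And>y z. norm y \<le> 1 \<Longrightarrow> norm z \<le> 1 \<Longrightarrow>
        norm (P y - P z) \<le> C * (norm y + norm z) * norm (y - z)"
      "0 \<le> C'" "\<And>y z. norm y \<le> 1 \<Longrightarrow> norm z \<le> 1 \<Longrightarrow>
        norm (Q y - Q z) \<le> C' * (norm y + norm z) * norm (y - z)" by metis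
    have "norm ((P y + Q y) - (P z + Q z)) \<le> (C + C') * (norm y + norm z) * norm (y - z)"
      if "norm y \<le> 1" "norm z \<le> 1" for y z
      using norm_triangle_ineq[of "P y - P z" "Q y - Q z"] C(2,4)[OF that] by (simp add: algebra_simps)
    then show ?case using C(1,3) by (metis add_nonneg_nonneg)
  qed auto
  then show thesis using that by blast
qed

text \<open>Uniqueness of homogeneous parts. By induction the lower terms vanish on the diagonal;
  along the ray \<open>t x\<close> one divides by \<open>t ^ m\<close> and lets \<open>t\<close>
  tend to \<open>0\<close> from the right. The conclusion is about diagonal values, since the maps
  are not assumed symmetric.\<close>

lemma small_homogeneous_sum_zero:
  fixes q :: "nat \<Rightarrow> 'a::real_normed_vector list \<Rightarrow> 'b::real_normed_vector"
  assumes q: "\<And>j. multilinear j (q j)" and s: "small d (\<lambda>x. \<Sum>j=1..d. q j (replicate j x))"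
    and m: "m \<in> {1..d}"
  shows "q m (replicate m x) = 0"
  using m
proof (induction m rule: less_induct)
  case (less m)
  define c where "c j = q j (replicate j x)" for j
  have scale: "q j (replicate j (t *\<^sub>R x)) = t ^ j *\<^sub>R c j" for t j
    using multilinear_scale[OF q, of "replicate j x" j "\<lambda>_. t"] by (simp add: c_def prod_list_replicate)
  have sum: "(\<Sum>j=1..d. q j (replicate j (t *\<^sub>R x))) = t ^ m *\<^sub>R (\<Sum>j=m..d. t ^ (j - m) *\<^sub>R c j)" for t
  proof -
    have "(\<Sum>j=1..d. t ^ j *\<^sub>R c j) = (\<Sum>j=m..d. t ^ j *\<^sub>R c j)"
      using less by (intro sum.mono_neutral_right) (auto simp: c_def)
    also have "\<dots> = (\<Sum>j=m..d. t ^ m *\<^sub>R (t ^ (j - m) *\<^sub>R c j))"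
      by (intro sum.cong refl) (simp flip: power_add)
    finally show ?thesis by (simp add: scale scaleR_sum_right)
  qed
  have lim: "((\<lambda>t. norm (\<Sum>j=m..d. t ^ (j - m) *\<^sub>R c j)) \<longlongrightarrow> norm (c m)) (at_right 0)"
  proof -
    have "((\<lambda>t. norm (\<Sum>j=m..d. t ^ (j - m) *\<^sub>R c j)) \<longlongrightarrow> norm (\<Sum>j=m..d. 0 ^ (j - m) *\<^sub>R c j)) (at_right (0::real))"
      by (intro tendsto_intros)
    also have "(\<Sum>j=m..d. 0 ^ (j - m) *\<^sub>R c j) = c m"
      using less.prems by (subst sum.remove[of _ m]) (auto intro!: sum.neutral simp: power_0_left)
    finally show ?thesis .
  qed
  have "norm (c m) \<le> e * norm x ^ d" if "e > 0" for e
  proof (rule tendsto_upperbound[OF lim])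
    have "filterlim (\<lambda>t::real. t *\<^sub>R x) (nhds 0) (at_right 0)"
      by (auto intro!: tendsto_eq_intros)
    then have "\<forall>\<^sub>F t in at_right 0. norm (\<Sum>j=1..d. q j (replicate j (t *\<^sub>R x))) \<le> e * norm (t *\<^sub>R x) ^ d"
      using smallD[OF s that] by (auto simp: filterlim_iff)
    moreover have "\<forall>\<^sub>F t in at_right 0. t \<in> {0<..<1::real}"
      by (rule eventually_at_right_real) simp
    ultimately show "\<forall>\<^sub>F t in at_right 0. norm (\<Sum>j=m..d. t ^ (j - m) *\<^sub>R c j) \<le> e * norm x ^ d"
    proof eventually_elim
      case (elim t)
      then have t: "0 < t" "t \<le> 1" by auto
      have "t ^ m * norm (\<Sum>j=m..d. t ^ (j - m) *\<^sub>R c j) \<le> t ^ d * (e * norm x ^ d)"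
        using elim(1) t unfolding sum by (simp add: power_mult_distrib mult_ac)
      also have "\<dots> \<le> t ^ m * (e * norm x ^ d)"
        using less.prems t that by (intro mult_right_mono power_decreasing) auto
      finally show ?case using t by simp
    qed
  qed simp
  then have "norm (c m) \<le> 0"
  proof (cases "x = 0")
    case False
    have "norm (c m) \<le> 0 + e" if "e > 0" for e
      using \<open>\<And>e. e > 0 \<Longrightarrow> norm (c m) \<le> e * norm x ^ d\<close>[of "e / norm x ^ d"] that False by simp
    then show ?thesis by (rule field_le_epsilon)
  next
    case True
    then show ?thesis
      using less.prems multilinear_zero[OF q, of "replicate m x" m] by (simp add: c_def)
  qed
  then show ?case by (simp add: c_def)
qed

section \<open>Elimination of nonresonant terms\<close>

lemma poly_decay_bound_1:
  assumes "poly_decay \<Gamma> 1 P"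
  obtains C where "0 \<le> C" "\<And>x. norm x \<le> 1 \<Longrightarrow> norm (P x) \<le> C * norm x"
proof (rule poly_decay_big[OF assms])
  fix C assume "0 \<le> C" "\<And>x. norm x \<le> 1 \<Longrightarrow> norm (P x) \<le> C * norm x ^ 1"
  then show thesis by (intro that[of C]) simp_all
qed

lemma eventually_nhds_mult_le:
  assumes "0 \<le> C"
  shows "\<forall>\<^sub>F x in nhds 0. norm (x :: 'a::real_normed_vector) \<le> 1 \<and> C * norm x \<le> 1"
proof -
  have "0 < 1 / (C + 1)" using assms by simp
  from eventually_nhds_norm_le[OF this] show ?thesis
  proof (rule eventually_mono)
    fix x :: 'a assume x: "norm x \<le> 1 / (C + 1)"
    then have "norm x * (C + 1) \<le> 1" using assms by (simp add: pos_le_divide_eq)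
    then have "norm x + C * norm x \<le> 1" by (simp add: algebra_simps)
    then show "norm x \<le> 1 \<and> C * norm x \<le> 1"
      using mult_nonneg_nonneg[OF assms norm_ge_zero[of x]] norm_ge_zero[of x] by linarith
  qed
qed

lemma poly_decay_eventually_le:
  assumes "poly_decay \<Gamma> 1 P"
  obtains C where "\<forall>\<^sub>F x in nhds 0. norm (P x) \<le> C * norm x"
proof -
  obtain C where C: "\<And>x. norm x \<le> 1 \<Longrightarrow> norm (P x) \<le> C * norm x"
    by (rule poly_decay_bound_1[OF assms]) blast
  show thesis
    by (rule that[of C]) (rule eventually_mono[OF eventually_nhds_norm_le[OF zero_less_one] C])
qed

text \<open>A change of order \<open>n\<close> inside a polynomial of order two alters its value at
  order \<open>n + 1\<close>, because the Lipschitz factor near the origin is itself of order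
  one.\<close>

lemma small_poly_perturb:
  assumes P: "poly_decay \<Gamma> 2 P" and a: "poly_decay \<Gamma> 1 a" and b: "poly_decay \<Gamma> n b" and n: "1 \<le> n"
  shows "small n (\<lambda>x. P (a x + b x) - P (a x))"
proof -
  obtain C where C: "0 \<le> C" "\<And>y z. norm y \<le> 1 \<Longrightarrow> norm z \<le> 1 \<Longrightarrow>
      norm (P y - P z) \<le> C * (norm y + norm z) * norm (y - z)"
    by (rule poly_decay_lipschitz[OF P]) blast
  obtain Ca where Ca: "0 \<le> Ca" "\<And>x. norm x \<le> 1 \<Longrightarrow> norm (a x) \<le> Ca * norm x"
    by (rule poly_decay_bound_1[OF a]) blast
  obtain Cb where Cb: "0 \<le> Cb" "\<And>x. norm x \<le> 1 \<Longrightarrow> norm (b x) \<le> Cb * norm x ^ n"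
    by (rule poly_decay_big[OF b]) blast
  have "0 \<le> Ca + Cb" using Ca Cb by simp
  from eventually_nhds_mult_le[OF this]
  have "\<forall>\<^sub>F x in nhds 0. norm (P (a x + b x) - P (a x)) \<le> C * (2 * Ca + Cb) * Cb * norm x ^ Suc n"
  proof (rule eventually_mono)
    fix x :: "('a, 'b) linf" assume x: "norm x \<le> 1 \<and> (Ca + Cb) * norm x \<le> 1"
    have "norm x ^ n \<le> norm x ^ 1" using n x by (intro power_decreasing) auto
    then have "Cb * norm x ^ n \<le> Cb * norm x" using Cb(1) by (intro mult_left_mono) simp_all
    then have bx: "norm (b x) \<le> Cb * norm x" using Cb(2)[of x] x by linarith
    have ax: "norm (a x) \<le> Ca * norm x" using Ca(2) x by blast
    have abx: "norm (a x + b x) \<le> (Ca + Cb) * norm x"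
      using norm_triangle_ineq[of "a x" "b x"] ax bx by (simp add: algebra_simps)
    have "0 \<le> Cb * norm x" using Cb(1) by simp
    then have "norm (a x) \<le> 1" "norm (a x + b x) \<le> 1" using ax abx x by (simp_all add: algebra_simps)
    from C(2)[OF this(2,1)] have "norm (P (a x + b x) - P (a x)) \<le> C * (norm (a x + b x) + norm (a x)) * norm (b x)"
      by simp
    also have "\<dots> \<le> C * ((Ca + Cb) * norm x + Ca * norm x) * (Cb * norm x ^ n)"
      using C(1) Ca(1) Cb(1) abx ax Cb(2)[of x] x
      by (intro mult_mono mult_left_mono add_mono mult_nonneg_nonneg add_nonneg_nonneg) auto
    also have "\<dots> = C * (2 * Ca + Cb) * Cb * norm x ^ Suc n" by (simp add: algebra_simps)
    finally show "norm (P (a x + b x) - P (a x)) \<le> C * (2 * Ca + Cb) * Cb * norm x ^ Suc n" .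
  qed
  then show ?thesis by (rule small_bigI)
qed

text \<open>Here the change has order two: \<open>n - 1\<close> arguments of order one and one of
  order two make \<open>n + 1\<close>.\<close>

lemma small_monomial_perturb:
  assumes k: "decay_multilinear \<Gamma> n k" and a: "poly_decay \<Gamma> 1 a" and b: "poly_decay \<Gamma> 2 b" and n: "1 \<le> n"
  shows "small n (\<lambda>x. k (replicate n (a x + b x)) - k (replicate n (a x)))"
proof -
  obtain C where C: "0 \<le> C" "\<And>y z M. norm y \<le> M \<Longrightarrow> norm z \<le> M \<Longrightarrow>
      norm (k (replicate n y) - k (replicate n z)) \<le> C * M ^ (n - 1) * norm (y - z)"
    by (rule monomial_lipschitz[OF k]) blast
  obtain Ca where Ca: "0 \<le> Ca" "\<And>x. norm x \<le> 1 \<Longrightarrow> norm (a x) \<le> Ca * norm x"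
    by (rule poly_decay_bound_1[OF a]) blast
  obtain Cb where Cb: "0 \<le> Cb" "\<And>x. norm x \<le> 1 \<Longrightarrow> norm (b x) \<le> Cb * norm x ^ 2"
    by (rule poly_decay_big[OF b]) blast
  have "\<forall>\<^sub>F x in nhds 0. norm (k (replicate n (a x + b x)) - k (replicate n (a x)))
      \<le> C * (Ca + Cb) ^ (n - 1) * Cb * norm x ^ Suc n"
    using eventually_nhds_norm_le[OF zero_less_one]
  proof (rule eventually_mono)
    fix x :: "('a, 'b) linf" assume x: "norm x \<le> 1"
    have "norm x ^ 2 \<le> norm x ^ 1" using x by (intro power_decreasing) auto
    then have "Cb * norm x ^ 2 \<le> Cb * norm x" using Cb(1) by (intro mult_left_mono) simp_all
    then have bx: "norm (b x) \<le> Cb * norm x" using Cb(2)[OF x] by linarith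
    have 1: "norm (a x + b x) \<le> (Ca + Cb) * norm x"
      using norm_triangle_ineq[of "a x" "b x"] Ca(2)[OF x] bx by (simp add: algebra_simps)
    have 2: "norm (a x) \<le> (Ca + Cb) * norm x"
      using Ca(2)[OF x] mult_nonneg_nonneg[OF Cb(1) norm_ge_zero[of x]] by (simp add: algebra_simps)
    have "norm (k (replicate n (a x + b x)) - k (replicate n (a x)))
        \<le> C * ((Ca + Cb) * norm x) ^ (n - 1) * norm (b x)"
      using C(2)[OF 1 2] by simp
    also have "\<dots> \<le> C * ((Ca + Cb) * norm x) ^ (n - 1) * (Cb * norm x ^ 2)"
      using C(1) Ca(1) Cb(1) by (intro mult_left_mono Cb(2)[OF x] mult_nonneg_nonneg zero_le_power) auto
    also have "\<dots> = C * (Ca + Cb) ^ (n - 1) * Cb * norm x ^ (n - 1 + 2)"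
      by (simp only: power_mult_distrib power_add mult_ac)
    also have "n - 1 + 2 = Suc n" using n by simp
    finally show "norm (k (replicate n (a x + b x)) - k (replicate n (a x)))
      \<le> C * (Ca + Cb) ^ (n - 1) * Cb * norm x ^ Suc n" .
  qed
  then show ?thesis by (rule small_bigI)
qed

text \<open>Terms up to degree \<open>d\<close> vanish by \<open>small_homogeneous_sum_zero\<close>,
  and terms beyond \<open>Suc d\<close> are negligible; \<open>q\<close> is the coefficient in
  between.\<close>

lemma poly_decay_small_leading:
  fixes Q :: "('m::finite, 'v::real_normed_vector) linf \<Rightarrow> ('m, 'v) linf"
  assumes \<Gamma>: "decay_function \<Gamma>" and Q: "poly_decay \<Gamma> 1 Q" and s: "small d Q"
  shows "\<exists>q. decay_multilinear \<Gamma> (Suc d) q \<and> small (Suc d) (\<lambda>x. Q x - q (replicate (Suc d) x))"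
proof -
  obtain p D where p: "\<And>j. decay_multilinear \<Gamma> j (p j)"
    "\<And>d x. d \<ge> D \<Longrightarrow> Q x = (\<Sum>j=1..d. p j (replicate j x))"
  proof -
    obtain p D where "\<forall>j. decay_multilinear \<Gamma> j (p j)"
      "\<forall>d\<ge>D. \<forall>x. Q x = (\<Sum>j=1..d. p j (replicate j x))"
      using poly_decay_coeffs[OF \<Gamma> Q] by (elim exE conjE) (rule that)
    then show thesis by (intro that[of p D]) auto
  qed
  define low where "low x = (\<Sum>j=1..d. p j (replicate j x))" for x
  define high where "high x = (\<Sum>j=Suc (Suc d)..Suc d + D. p j (replicate j x))" for x
  have split: "Q x = low x + p (Suc d) (replicate (Suc d) x) + high x" for x
  proof -
    have "Q x = (\<Sum>j=1..Suc d + D. p j (replicate j x))" by (rule p(2)) simp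
    also have "\<dots> = (\<Sum>j=1..Suc d. p j (replicate j x)) + high x"
      unfolding high_def by (subst sum.ub_add_nat) auto
    finally show ?thesis by (simp add: low_def)
  qed
  have high: "poly_decay \<Gamma> (Suc (Suc d)) high"
    unfolding high_def [abs_def]
    by (rule poly_decay_sum) (rule poly_decay.monomial[OF _ p(1)], simp)
  have mid: "poly_decay \<Gamma> (Suc d) (\<lambda>x. p (Suc d) (replicate (Suc d) x))"
    by (rule poly_decay.monomial[OF order_refl p(1)])
  have "small d (\<lambda>x. Q x - p (Suc d) (replicate (Suc d) x) - high x)"
    by (rule small_diff[OF small_diff[OF s small_poly_decay[OF mid]]
          small_poly_decay[OF poly_decay_mono[OF high]]]) simp
  then have "small d (\<lambda>x. \<Sum>j=1..d. p j (replicate j x))"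
    by (simp add: split low_def)
  then have "p j (replicate j x) = 0" if "j \<in> {1..d}" for j x
    using p(1) that unfolding decay_multilinear_def by (intro small_homogeneous_sum_zero) auto
  then have "low x = 0" for x by (simp add: low_def)
  then have "Q x - p (Suc d) (replicate (Suc d) x) = high x" for x by (simp add: split)
  then show ?thesis
    using p(1) small_poly_decay[OF high] by (intro exI[of _ "p (Suc d)"]) simp
qed

text \<open>\<open>q\<close> is chosen before \<open>k\<close> and \<open>h\<close>, so that one
  statement serves the resonant and the nonresonant case. The equation is imposed on the diagonal,
  which is all that polynomials see. It cancels the leading contribution of \<open>q\<close>,
  \<open>k\<close> and \<open>h\<close> to the new defect; every other change gains an
  order.\<close>

lemma normal_form_step:
  fixes F :: "('m::finite, 'v::real_normed_vector) linf \<Rightarrow> ('m, 'v) linf"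
  assumes \<Gamma>: "decay_function \<Gamma>" and A: "decay_linear \<Gamma> A" and PF: "poly_decay \<Gamma> 2 PF"
    and \<rho>: "small (Suc n) \<rho>" and F: "\<And>x. F x = A x + PF x + \<rho> x" and n: "1 \<le> n"
    and K2: "poly_decay \<Gamma> 2 K2" and H2: "poly_decay \<Gamma> 2 H2"
    and s: "small n (\<lambda>x. F (x + K2 x) - ((A x + H2 x) + K2 (A x + H2 x)))"
  shows "\<exists>q. decay_multilinear \<Gamma> (Suc n) q \<and> (\<forall>k h. decay_multilinear \<Gamma> (Suc n) k \<longrightarrow>
    decay_multilinear \<Gamma> (Suc n) h \<longrightarrow>
    (\<forall>x. A (k (replicate (Suc n) x)) - k (replicate (Suc n) (A x)) - h (replicate (Suc n) x)
       = - q (replicate (Suc n) x)) \<longrightarrow>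
    small (Suc n) (\<lambda>x. F (x + (K2 x + k (replicate (Suc n) x)))
      - ((A x + (H2 x + h (replicate (Suc n) x))) + (K2 (A x + (H2 x + h (replicate (Suc n) x)))
        + k (replicate (Suc n) (A x + (H2 x + h (replicate (Suc n) x))))))))"
proof -
  obtain linA: "linear A" using decay_linearE[OF A] by metis
  have A1: "poly_decay \<Gamma> 1 A" by (rule poly_decay_linear[OF A])
  have id1: "poly_decay \<Gamma> 1 (\<lambda>x :: ('m, 'v) linf. x)" by (rule poly_decay_linear[OF decay_linear_id[OF \<Gamma>]])
  have low: "poly_decay \<Gamma> 1 P" if "poly_decay \<Gamma> 2 P" for P using that by (rule poly_decay_mono) simp
  define K where "K x = x + K2 x" for x
  define H where "H x = A x + H2 x" for x
  have K: "poly_decay \<Gamma> 1 K" unfolding K_def [abs_def] by (intro poly_decay.add id1 low K2)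
  have H: "poly_decay \<Gamma> 1 H" unfolding H_def [abs_def] by (intro poly_decay.add A1 low H2)
  \<comment> \<open>The polynomial part of the defect; the remainder \<open>\<rho>\<close> is
    already negligible at degree \<open>Suc n\<close>.\<close>
  define Q where "Q x = A (K x) + PF (K x) - (H x + K2 (H x))" for x
  have Q: "poly_decay \<Gamma> 1 Q"
    unfolding Q_def [abs_def]
    by (intro poly_decay_diff poly_decay.add poly_decay_compose[OF \<Gamma> K A1]
        poly_decay_compose[OF \<Gamma> K low[OF PF]] H poly_decay_compose[OF \<Gamma> H low[OF K2]])
  have \<rho>_comp: "small (Suc n) (\<lambda>x. \<rho> (P x))" if "poly_decay \<Gamma> 1 P" for P
    by (rule poly_decay_eventually_le[OF that]) (rule small_compose[OF \<rho>])
  have "small n (\<lambda>x. (F (x + K2 x) - ((A x + H2 x) + K2 (A x + H2 x))) - \<rho> (K x))"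
    by (intro small_diff s small_mono[OF \<rho>_comp[OF K]]) simp
  then have "small n Q"
    by (simp add: F Q_def [abs_def] K_def H_def algebra_simps)
  from poly_decay_small_leading[OF \<Gamma> Q this] obtain q where q: "decay_multilinear \<Gamma> (Suc n) q"
    and T: "small (Suc n) (\<lambda>x. Q x - q (replicate (Suc n) x))" by blast
  show ?thesis
  proof (intro exI[of _ q] conjI allI impI q)
    fix k h :: "('m, 'v) linf list \<Rightarrow> ('m, 'v) linf"
    assume k: "decay_multilinear \<Gamma> (Suc n) k" and h: "decay_multilinear \<Gamma> (Suc n) h"
      and hom: "\<forall>x. A (k (replicate (Suc n) x)) - k (replicate (Suc n) (A x)) - h (replicate (Suc n) x)
       = - q (replicate (Suc n) x)"
    define \<kappa> where "\<kappa> x = k (replicate (Suc n) x)" for x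
    define \<eta> where "\<eta> x = h (replicate (Suc n) x)" for x
    have \<kappa>: "poly_decay \<Gamma> (Suc n) \<kappa>" unfolding \<kappa>_def [abs_def] by (rule poly_decay.monomial[OF order_refl k])
    have \<eta>: "poly_decay \<Gamma> (Suc n) \<eta>" unfolding \<eta>_def [abs_def] by (rule poly_decay.monomial[OF order_refl h])
    have \<kappa>1: "poly_decay \<Gamma> 1 \<kappa>" using \<kappa> by (rule poly_decay_mono) simp
    have \<eta>2: "poly_decay \<Gamma> 2 \<eta>" using \<eta> by (rule poly_decay_mono) (use n in simp)
    have 1: "small (Suc n) (\<lambda>x. PF (K x + \<kappa> x) - PF (K x))"
      by (rule small_poly_perturb[OF PF K \<kappa>]) simp
    have 2: "small (Suc n) (\<lambda>x. \<rho> (K x + \<kappa> x))"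
      by (rule \<rho>_comp) (rule poly_decay.add[OF K \<kappa>1])
    have 3: "small (Suc n) (\<lambda>x. K2 (H x + \<eta> x) - K2 (H x))"
      by (rule small_poly_perturb[OF K2 H \<eta>]) simp
    have 4: "small (Suc n) (\<lambda>x. k (replicate (Suc n) (A x + (H2 x + \<eta> x))) - k (replicate (Suc n) (A x)))"
      by (rule small_monomial_perturb[OF k A1 poly_decay.add[OF H2 \<eta>2]]) simp
    have hom': "A (\<kappa> x) = k (replicate (Suc n) (A x)) + \<eta> x - q (replicate (Suc n) x)" for x
      using hom[rule_format, of x] unfolding \<kappa>_def \<eta>_def by (simp add: algebra_simps)
    \<comment> \<open>The perturbations come from \<open>PF\<close>, from the remainder, from
      \<open>K2\<close>, and from replacing the whole of \<open>H x + \<eta> x\<close> by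
      \<open>A x\<close> in the new term of \<open>K\<close>.\<close>
    have eq: "F (x + (K2 x + \<kappa> x)) - ((A x + (H2 x + \<eta> x)) + (K2 (A x + (H2 x + \<eta> x))
          + k (replicate (Suc n) (A x + (H2 x + \<eta> x)))))
      = (Q x - q (replicate (Suc n) x)) + (PF (K x + \<kappa> x) - PF (K x)) + \<rho> (K x + \<kappa> x)
        - (K2 (H x + \<eta> x) - K2 (H x))
        - (k (replicate (Suc n) (A x + (H2 x + \<eta> x))) - k (replicate (Suc n) (A x)))" for x
    proof -
      have e: "x + (K2 x + \<kappa> x) = K x + \<kappa> x" "A x + (H2 x + \<eta> x) = H x + \<eta> x"
        by (simp_all add: K_def H_def)
      show ?thesis
        unfolding e by (simp add: F Q_def linear_add[OF linA] hom' algebra_simps)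
    qed
    show "small (Suc n) (\<lambda>x. F (x + (K2 x + k (replicate (Suc n) x)))
      - ((A x + (H2 x + h (replicate (Suc n) x))) + (K2 (A x + (H2 x + h (replicate (Suc n) x)))
        + k (replicate (Suc n) (A x + (H2 x + h (replicate (Suc n) x)))))))"
      using small_diff[OF small_diff[OF small_add[OF small_add[OF T 1] 2] 3] 4]
      unfolding eq [symmetric] unfolding \<kappa>_def \<eta>_def .
  qed
qed

text \<open>The coefficients of \<open>H\<close> vanish identically outside \<open>J\<close>, so
  that its sum over all degrees can be read as a sum over \<open>J\<close> in the end.\<close>

theorem normal_form:
  fixes F :: "('m::finite, real ^ 'n) linf \<Rightarrow> ('m, real ^ 'n) linf"
  assumes N: "is_norm N" and \<Gamma>: "decay_function \<Gamma>" and A: "decay_linear \<Gamma> A" and PF: "poly_decay \<Gamma> 2 PF"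
    and \<rho>: "small r \<rho>" and F: "\<And>x. F x = A x + PF x + \<rho> x" and n: "1 \<le> n" "n \<le> r"
    and J: "\<And>j. 2 \<le> j \<Longrightarrow> j \<le> r \<Longrightarrow> j \<notin> J \<Longrightarrow> set_power (Spec_decay N \<Gamma> A) j \<inter> Spec_decay N \<Gamma> A = {}"
  shows "\<exists>k h. (\<forall>j. decay_multilinear \<Gamma> j (k j)) \<and> (\<forall>j. decay_multilinear \<Gamma> j (h j)) \<and>
    (\<forall>j vs. j \<notin> J \<longrightarrow> h j vs = 0) \<and>
    small n (\<lambda>x. F (x + (\<Sum>j=2..n. k j (replicate j x)))
      - ((A x + (\<Sum>j=2..n. h j (replicate j x)))
        + (\<Sum>j=2..n. k j (replicate j (A x + (\<Sum>j=2..n. h j (replicate j x)))))))"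
  using n
proof (induction n rule: nat_induct_at_least)
  \<comment> \<open>Degree one: \<open>K\<close> is the identity and \<open>H\<close> is
    \<open>A\<close>, the sums being empty.\<close>
  case base
  have "small 1 PF" using PF by (intro small_poly_decay) (simp add: numeral_2_eq_2)
  then have "small 1 (\<lambda>x. PF x + \<rho> x)"
    using small_mono[OF \<rho>] n by (intro small_add) auto
  then show ?case
    by (intro exI[of _ "\<lambda>_ _. 0"]) (simp add: F decay_multilinear_zero)
next
  case (Suc n)
  have "n \<le> r" using Suc.prems by simp
  from Suc.IH[OF this] obtain k h where kh: "\<forall>j. decay_multilinear \<Gamma> j (k j)"
      "\<forall>j. decay_multilinear \<Gamma> j (h j)" "\<forall>j vs. j \<notin> J \<longrightarrow> h j vs = 0"
    and s: "small n (\<lambda>x. F (x + (\<Sum>j=2..n. k j (replicate j x)))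
      - ((A x + (\<Sum>j=2..n. h j (replicate j x)))
        + (\<Sum>j=2..n. k j (replicate j (A x + (\<Sum>j=2..n. h j (replicate j x)))))))"
    by (elim exE conjE) (rule that)
  note k = kh(1)[rule_format] and h = kh(2)[rule_format] and hJ = kh(3)[rule_format]
  let ?d = "Suc n"
  have poly: "poly_decay \<Gamma> 2 (\<lambda>x. \<Sum>j=2..n. k j (replicate j x))" "poly_decay \<Gamma> 2 (\<lambda>x. \<Sum>j=2..n. h j (replicate j x))"
    by (rule poly_decay_sum, rule poly_decay.monomial[OF _ k], simp)
      (rule poly_decay_sum, rule poly_decay.monomial[OF _ h], simp)
  have \<rho>': "small ?d \<rho>" using Suc.prems by (intro small_mono[OF \<rho>])
  obtain q where q: "decay_multilinear \<Gamma> ?d q" and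
    next_small: "\<And>k' h'. decay_multilinear \<Gamma> ?d k' \<Longrightarrow> decay_multilinear \<Gamma> ?d h' \<Longrightarrow>
      (\<And>x. A (k' (replicate ?d x)) - k' (replicate ?d (A x)) - h' (replicate ?d x) = - q (replicate ?d x)) \<Longrightarrow>
      small ?d (\<lambda>x. F (x + ((\<Sum>j=2..n. k j (replicate j x)) + k' (replicate ?d x)))
        - ((A x + ((\<Sum>j=2..n. h j (replicate j x)) + h' (replicate ?d x)))
          + ((\<Sum>j=2..n. k j (replicate j (A x + ((\<Sum>j=2..n. h j (replicate j x)) + h' (replicate ?d x)))))
            + k' (replicate ?d (A x + ((\<Sum>j=2..n. h j (replicate j x)) + h' (replicate ?d x)))))))"
    using normal_form_step[OF \<Gamma> A PF \<rho>' F Suc.hyps poly s] by blast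
  obtain k' h' where k': "decay_multilinear \<Gamma> ?d k'" and h': "decay_multilinear \<Gamma> ?d h'"
    and hJ': "?d \<notin> J \<Longrightarrow> h' = (\<lambda>_. 0)"
    and hom: "\<And>x. A (k' (replicate ?d x)) - k' (replicate ?d (A x)) - h' (replicate ?d x) = - q (replicate ?d x)"
  proof (cases "?d \<in> J")
    case True
    obtain linA: "linear A" using decay_linearE[OF A] by metis
    show ?thesis
      by (rule that[OF decay_multilinear_zero q]) (use True linear_0[OF linA] in auto)
  next
    case False
    then have nonres: "set_power (Spec_decay N \<Gamma> A) ?d \<inter> Spec_decay N \<Gamma> A = {}"
      using Suc.hyps Suc.prems by (intro J) auto
    have "decay_multilinear \<Gamma> ?d (\<lambda>vs. - q vs)"
      using decay_multilinear_scaleR[OF q, of "-1"] by simp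
    from cohomological_equation[OF N \<Gamma> A nonres this] obtain k' where k': "decay_multilinear \<Gamma> ?d k'"
      "\<And>vs. length vs = ?d \<Longrightarrow> A (k' vs) - k' (map A vs) = - q vs" by blast
    show ?thesis
    proof (rule that[OF k'(1) decay_multilinear_zero])
      show "A (k' (replicate ?d x)) - k' (replicate ?d (A x)) - 0 = - q (replicate ?d x)" for x
        using k'(2)[of "replicate ?d x"] by (simp only: length_replicate map_replicate diff_0_right)
    qed simp
  qed
  have le: "2 \<le> ?d" using Suc.hyps by simp
  have sums: "(\<Sum>j=2..?d. (k(?d := k')) j (replicate j x)) = (\<Sum>j=2..n. k j (replicate j x)) + k' (replicate ?d x)"
    "(\<Sum>j=2..?d. (h(?d := h')) j (replicate j x)) = (\<Sum>j=2..n. h j (replicate j x)) + h' (replicate ?d x)" for x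
    using le by (simp_all del: replicate.simps)
  show ?case
  proof (rule exI[of _ "k(?d := k')"], rule exI[of _ "h(?d := h')"], intro conjI allI impI)
    show "decay_multilinear \<Gamma> j ((k(?d := k')) j)" "decay_multilinear \<Gamma> j ((h(?d := h')) j)" for j
      using k h k' h' by auto
    show "(h(?d := h')) j vs = 0" if "j \<notin> J" for j vs
      using hJ[OF that] hJ' that by (cases "j = ?d") auto
    show "small ?d (\<lambda>x. F (x + (\<Sum>j=2..?d. (k(?d := k')) j (replicate j x)))
      - ((A x + (\<Sum>j=2..?d. (h(?d := h')) j (replicate j x)))
        + (\<Sum>j=2..?d. (k(?d := k')) j (replicate j (A x + (\<Sum>j=2..?d. (h(?d := h')) j (replicate j x)))))))"
      unfolding sums by (rule next_small[OF k' h' hom])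
  qed
qed

lemma small_has_derivative:
  assumes L: "bounded_linear L" and s: "small 1 (\<lambda>x. G x - L x)" and G0: "G 0 = 0"
  shows "(G has_derivative L) (at 0)"
  unfolding has_derivative_at_alt
proof (intro conjI L allI impI)
  fix e :: real assume "e > 0"
  from smallD[OF s this] obtain d where "d > 0" "\<And>y. dist y 0 < d \<Longrightarrow> norm (G y - L y) \<le> e * norm y ^ 1"
    unfolding eventually_nhds_metric by blast
  then show "\<exists>d>0. \<forall>y. norm (y - 0) < d \<longrightarrow> norm (G y - G 0 - L (y - 0)) \<le> e * norm (y - 0)"
    by (intro exI[of _ d]) (simp add: G0)
qed

theorem theorem6:
  fixes N :: "real ^ 'n \<Rightarrow> real"
    and \<Gamma> :: "int ^ 'm \<Rightarrow> real"
    and r :: nat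
    and U :: "('m, real ^ 'n) linf set"
    and F A :: "('m, real ^ 'n) linf \<Rightarrow> ('m, real ^ 'n) linf"
    and J :: "nat set"
  assumes "is_norm N"
    and "decay_function \<Gamma>"
    and "1 \<le> r"
    and "open U" and "0 \<in> U"
    and "F \<in> Cr_decay N \<Gamma> r U"
    and "F 0 = 0"
    and "(F has_derivative A) (at 0)"
    and "A \<in> L_decay N \<Gamma>"
    and "\<exists>B. bounded_linear B \<and> B \<circ> A = id \<and> A \<circ> B = id"
  defines "J \<equiv> {j\<in>{2..r}. set_power (Spec_decay N \<Gamma> A) j \<inter> Spec_decay N \<Gamma> A \<noteq> {}}"
  shows "\<exists>K H. decay_polynomial N \<Gamma> r K \<and> decay_polynomial N \<Gamma> r H \<and>
           K 0 = 0 \<and> (K has_derivative id) (at 0) \<and>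
           (\<lambda>x. linf_norm N (F (K x) - K (H x))) \<in> o[at 0](\<lambda>x. linf_norm N x ^ r) \<and>
           (\<exists>h. (\<forall>j\<in>J. h j \<in> Lk_decay N \<Gamma> j) \<and>
                (\<forall>x. H x = A x + (\<Sum>j\<in>J. h j (replicate j x))))"
proof -
  note N = assms(1) and \<Gamma> = assms(2) and r = assms(3)
  note Lk = Lk_decay_iff[OF N \<Gamma>]
  obtain D where Cr: "is_Cr_with_derivs N r U F D"
    and DL: "\<And>j x. j \<in> {1..r} \<Longrightarrow> x \<in> U \<Longrightarrow> D j x \<in> Lk_decay N \<Gamma> j"
    using assms(6) unfolding Cr_decay_def by blast
  have dm: "decay_multilinear \<Gamma> j (D j 0)" if "j \<in> {1..r}" for j
    using DL[OF that assms(5)] Lk by blast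
  define f where "f j vs = (1 / fact j) *\<^sub>R D j 0 vs" for j vs
  have fdm: "decay_multilinear \<Gamma> j (f j)" if "j \<in> {1..r}" for j
    unfolding f_def [abs_def] by (rule decay_multilinear_scaleR[OF dm[OF that]])
  define L where "L x = D 1 0 [x]" for x
  have L: "decay_linear \<Gamma> L"
  proof -
    obtain C where C: "decay_bound \<Gamma> 1 (D 1 0) C" and ml: "multilinear 1 (D 1 0)"
      using dm[of 1] r by (auto simp: decay_multilinear_def)
    have eq: "L (hd vs) = D 1 0 vs" if "length vs = 1" for vs
      using that by (cases vs) (auto simp: L_def)
    show ?thesis
      using decay_bound_cong[OF C eq] multilinear_cong[OF ml eq]
      unfolding decay_linear_def decay_multilinear_def by blast
  qed
  define PF where "PF x = (\<Sum>j=2..r. f j (replicate j x))" for x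
  have PF: "poly_decay \<Gamma> 2 PF"
    unfolding PF_def [abs_def]
    by (rule poly_decay_sum) (rule poly_decay.monomial, simp, rule fdm, simp)
  define \<rho> where "\<rho> x = F x - (L x + PF x)" for x
  have "(\<Sum>j=1..r. (1 / fact j) *\<^sub>R D j 0 (replicate j x)) = L x + PF x" for x
    using r by (simp add: sum.atLeast_Suc_atMost L_def PF_def f_def numeral_2_eq_2)
  then have \<rho>: "small r \<rho>"
    using taylor_small[OF N Cr assms(4,5,7) r] by (simp add: \<rho>_def [abs_def])
  have F: "F x = L x + PF x + \<rho> x" for x by (simp add: \<rho>_def)
  \<comment> \<open>Uniqueness of derivatives identifies \<open>A\<close> with the first Taylor
    coefficient, whose decay bound is at hand.\<close>
  have "A = L"
  proof (rule has_derivative_unique[OF assms(8)])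
    obtain M where M: "linear L" "\<And>u. norm (L u) \<le> M * norm u"
      using decay_linearE[OF L] by metis
    have bl: "bounded_linear L"
      using M by (intro bounded_linear_intro[where K = M])
        (auto simp: linear_add linear_scale mult.commute)
    have "small 1 PF" using PF by (intro small_poly_decay) (simp add: numeral_2_eq_2)
    then have "small 1 (\<lambda>x. PF x + \<rho> x)"
      using small_mono[OF \<rho> r] by (rule small_add)
    then have "small 1 (\<lambda>x. F x - L x)" by (simp add: F)
    then show "(F has_derivative L) (at 0)" by (rule small_has_derivative[where L = L and G = F, OF bl _ assms(7)])
  qed
  then have A: "decay_linear \<Gamma> A" and FA: "\<And>x. F x = A x + PF x + \<rho> x"
    using L F by auto
  have nonres: "set_power (Spec_decay N \<Gamma> A) j \<inter> Spec_decay N \<Gamma> A = {}"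
    if "2 \<le> j" "j \<le> r" "j \<notin> J" for j
    using that by (simp add: J_def)
  have "\<exists>k h. (\<forall>j. decay_multilinear \<Gamma> j (k j)) \<and> (\<forall>j. decay_multilinear \<Gamma> j (h j)) \<and>
    (\<forall>j vs. j \<notin> J \<longrightarrow> h j vs = 0) \<and>
    small r (\<lambda>x. F (x + (\<Sum>j=2..r. k j (replicate j x)))
      - ((A x + (\<Sum>j=2..r. h j (replicate j x)))
        + (\<Sum>j=2..r. k j (replicate j (A x + (\<Sum>j=2..r. h j (replicate j x)))))))"
    by (rule normal_form[OF N \<Gamma> A PF \<rho> FA r order_refl]) (rule nonres)
  then obtain k h where kh: "\<forall>j. decay_multilinear \<Gamma> j (k j)" "\<forall>j. decay_multilinear \<Gamma> j (h j)"
      "\<forall>j vs. j \<notin> J \<longrightarrow> h j vs = 0"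
    and s: "small r (\<lambda>x. F (x + (\<Sum>j=2..r. k j (replicate j x)))
      - ((A x + (\<Sum>j=2..r. h j (replicate j x)))
        + (\<Sum>j=2..r. k j (replicate j (A x + (\<Sum>j=2..r. h j (replicate j x)))))))"
    by (elim exE conjE) (rule that)
  note k = kh(1)[rule_format] and h = kh(2)[rule_format] and hJ = kh(3)[rule_format]
  define K where "K x = x + (\<Sum>j=2..r. k j (replicate j x))" for x
  define H where "H x = A x + (\<Sum>j=2..r. h j (replicate j x))" for x
  have small: "small r (\<lambda>x. F (K x) - K (H x))"
    using s by (simp add: K_def [abs_def] H_def [abs_def])
  have dpoly: "decay_polynomial N \<Gamma> r (\<lambda>x. B x + (\<Sum>j=2..r. p j (replicate j x)))"
    if B: "decay_linear \<Gamma> B" and p: "\<And>j. decay_multilinear \<Gamma> j (p j)" for B p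
    unfolding decay_polynomial_def
  proof (intro exI[of _ "p(1 := \<lambda>vs. B (hd vs))"] conjI ballI allI)
    show "(p(1 := \<lambda>vs. B (hd vs))) j \<in> Lk_decay N \<Gamma> j" if "j \<in> {1..r}" for j
      using B p unfolding Lk decay_linear_def by auto
    show "B x + (\<Sum>j=2..r. p j (replicate j x)) = (\<Sum>j=1..r. (p(1 := \<lambda>vs. B (hd vs))) j (replicate j x))" for x
      using r by (simp add: sum.atLeast_Suc_atMost numeral_2_eq_2)
  qed
  show ?thesis
  proof (rule exI[of _ K], rule exI[of _ H], intro conjI)
    show "decay_polynomial N \<Gamma> r K"
      unfolding K_def [abs_def] by (rule dpoly[OF decay_linear_id[OF \<Gamma>] k])
    show "decay_polynomial N \<Gamma> r H"
      unfolding H_def [abs_def] by (rule dpoly[OF A h])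
    have "k j (replicate j 0) = 0" if "j \<in> {2..r}" for j
      using that k[of j] multilinear_zero[of j "k j" "replicate j 0"] by (auto simp: decay_multilinear_def)
    then show K0: "K 0 = 0" by (simp add: K_def)
    have "poly_decay \<Gamma> 2 (\<lambda>x. \<Sum>j=2..r. k j (replicate j x))"
      by (rule poly_decay_sum) (rule poly_decay.monomial[OF _ k], simp)
    then have "small 1 (\<lambda>x. K x - id x)"
      by (simp add: K_def small_poly_decay numeral_2_eq_2)
    then show "(K has_derivative id) (at 0)"
      by (rule small_has_derivative[where L = id and G = K, OF bounded_linear_ident[folded id_def] _ K0])
    show "(\<lambda>x. linf_norm N (F (K x) - K (H x))) \<in> o[at 0](\<lambda>x. linf_norm N x ^ r)"
    proof (rule landau_o.smallI)
      fix e :: real assume "e > 0"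
      obtain c1 C1 where c1: "0 < c1" "0 < C1" "\<And>x :: ('m, real ^ 'n) linf. c1 * norm x \<le> linf_norm N x"
        "\<And>x :: ('m, real ^ 'n) linf. linf_norm N x \<le> C1 * norm x"
        using linf_norm_equiv[OF N] by metis
      have pos: "0 \<le> linf_norm N x" for x :: "('m, real ^ 'n) linf"
        using c1(3)[of x] c1(1) by (meson less_imp_le mult_nonneg_nonneg norm_ge_zero order_trans)
      \<comment> \<open>\<open>C1\<close> converts the norm of the defect, and \<open>c1 ^ r\<close>
        that of the comparison function.\<close>
      define e' where "e' = e * c1 ^ r / C1"
      have "e' > 0" using \<open>e > 0\<close> c1 by (simp add: e'_def)
      from smallD[OF small this]
      have "\<forall>\<^sub>F x in nhds 0. norm (linf_norm N (F (K x) - K (H x))) \<le> e * norm (linf_norm N x ^ r)"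
      proof (rule eventually_mono)
        fix x :: "('m, real ^ 'n) linf"
        assume x: "norm (F (K x) - K (H x)) \<le> e' * norm x ^ r"
        have "linf_norm N (F (K x) - K (H x)) \<le> C1 * (e' * norm x ^ r)"
          using c1(4) x mult_left_mono[OF x, of C1] c1(2) by (meson less_imp_le order_trans)
        also have "\<dots> = e * (c1 * norm x) ^ r"
          using c1(2) by (simp add: e'_def power_mult_distrib)
        also have "\<dots> \<le> e * linf_norm N x ^ r"
          using \<open>e > 0\<close> c1 by (intro mult_left_mono power_mono) auto
        finally show "norm (linf_norm N (F (K x) - K (H x))) \<le> e * norm (linf_norm N x ^ r)"
          using pos by simp
      qed
      then show "\<forall>\<^sub>F x in at 0. norm (linf_norm N (F (K x) - K (H x))) \<le> e * norm (linf_norm N x ^ r)"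
        by (simp add: eventually_nhds_conv_at)
    qed
    have JH: "H x = A x + (\<Sum>j\<in>J. h j (replicate j x))" for x
      unfolding H_def by (intro arg_cong2[where f = "(+)"] refl sum.mono_neutral_right) (auto simp: J_def hJ)
    show "\<exists>h. (\<forall>j\<in>J. h j \<in> Lk_decay N \<Gamma> j) \<and> (\<forall>x. H x = A x + (\<Sum>j\<in>J. h j (replicate j x)))"
      using h JH Lk by blast
  qed
qed

end
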